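(* Fix the dimension $d$ and a sparsity parameter $\zeta\in(0,d]$. Let $\psi$ be a real random variable with $\mathbb{E}\psi=0$, $\operatorname{Var}\psi=1$ and $\mathbb{E}|\psi|^4=C$. Define the random vector \[ w=\sqrt{d/\zeta}\,(\xi_1\psi_1,\dots,\xi_d\psi_d)^{\mathsf T}\in\mathbb{R}^d, \] where $\xi_i\sim\textsc{bernoulli}(\zeta/d)$ are iid, $\psi_i$ are iid copies of $\psi$, and all are independent. Let $\varepsilon,\delta\in(0,1)$, and suppose \[ n\ge\frac{25d\,\big(1\vee(2C\zeta^{-1}\log(2d/\delta))\big)}{\varepsilon^2}. \] Let $\widehat K_n=\frac1n\sum_{i=1}^nw_iw_i^{\mathsf T}$ with $w_1,\dots,w_n$ iid copies of $w$. Then with probability at least $1-\delta$, $\lambda_{\min}(\widehat K_n)>1-\varepsilon$.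
   Context: $x\vee y=\max\{x,y\}$; $\lambda_{\min}$ is the minimum eigenvalue. *)

theory Defs
  imports "HOL-Probability.Probability"
begin

text \<open>Real eigenvalues of a square real matrix, and the minimum eigenvalue
  (meaningful for symmetric matrices, whose eigenvalues are all real).\<close>
definition real_eigenvalues :: "real^'n^'n \<Rightarrow> real set" where
  "real_eigenvalues A = {l. \<exists>v. v \<noteq> 0 \<and> A *v v = l *\<^sub>R v}"

definition lambda_min :: "real^'n^'n \<Rightarrow> real" where
  "lambda_min A = Min (real_eigenvalues A)"

definition outer_prod :: "real^'n \<Rightarrow> real^'n^'n" where
  "outer_prod w = (\<chi> a b. w $ a * w $ b)"

end

theory Submission
  imports Defs "HOL-Computational_Algebra.Polynomial"
begin

text \<open>
  Let \<open>u A = tr (exp A)\<close>. In a rank-one direction \<open>w w\<^sup>T\<close> all derivatives of \<open>u\<close> are nonnegative,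
  because they are sums of products of numbers \<open>w \<bullet> exp (r A) w\<close>. Hence \<open>u (A - s w w\<^sup>T)\<close> is at
  most its second-order Taylor polynomial, while the average of \<open>u (A \<plusminus> h w w\<^sup>T)\<close> is at least its
  second-order Taylor polynomial. The second-order term only involves fourth moments of \<open>w\<close>, so
  in expectation the heavy-tailed summands \<open>w w\<^sup>T\<close> can be traded for tiny symmetric jumps along
  \<open>y y\<^sup>T\<close> with random signs \<open>y\<close> and along the coordinate directions, which carry the excess fourth
  moment \<open>a - 1\<close> where \<open>a = C d / \<zeta>\<close>. To use jumps that are small but frequent, the number of
  summands is first randomised binomially; this costs a factor 2 by Chebyshev's inequality.

  The jumps \<open>y y\<^sup>T\<close> are controlled by comparing \<open>exp (x v \<bullet> M v)\<close>, for a unit vector \<open>v\<close>, with the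
  integral of \<open>exp (x \<theta> \<bullet> M \<theta>)\<close> over a ball (Jensen's inequality on a small ball around \<open>v\<close>),
  whose expectation factorises; a union bound handles the coordinate jumps. If
  \<open>ln (2 d / \<delta>) \<le> 12\<close>, the matrix Chernoff bound suffices.
\<close>

text \<open>The matrix Chernoff bound needs about \<open>(d + a) * L\<close> samples with
  \<open>L = ln (2 * d / \<delta>)\<close>, whereas the hypothesis on \<open>n\<close> only provides
  the larger of \<open>d\<close> and \<open>2 * a * L\<close>, up to constants: for large
  \<open>L\<close> the factor \<open>L\<close> must be kept away from \<open>d\<close>. This is why
  the fourth moment is split. The sign part is controlled by comparing volumes of balls, at a cost
  linear in \<open>d\<close>; the excess part consists of diagonal, hence commuting, jumps, and
  their union bound pairs \<open>L\<close> with \<open>a\<close> only.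

  Two obstacles shape the rest. The one-step comparison has the coefficient
  \<open>1 - s - 2 * m\<close>, which is negative when the jumps are many and small, so it cannot be
  iterated as it stands; a step taken with small probability \<open>p\<close> has the coefficient
  \<open>1 - p * (s + 2 * m)\<close> instead. And the quadratic form is treated with an exponential
  parameter governed by \<open>X\<close>, at least the \<open>s\<close> of the trace exponential:
  the potential is run at that parameter and then raised to the power \<open>q = s / X\<close>, at
  most 1, which multiplies the volume cost \<open>d * ln (13/3)\<close> by \<open>q\<close>.\<close>

subsection \<open>Spectral theorem for real symmetric matrices\<close>

lemma linear_coeff_zero_of_nonneg_quadratic:
  fixes b c :: real
  assumes "\<And>t. 0 \<le> t * b + t\<^sup>2 * c"
  shows "b = 0"
proof (rule ccontr)
  assume "b \<noteq> 0"
  define k where "k = \<bar>c\<bar> + 1"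
  have k: "k > 0" "c < k" by (auto simp: k_def)
  have "(- b / k) * b + (- b / k)\<^sup>2 * c = (b\<^sup>2 / k) * (c / k - 1)"
    using k by (simp add: field_simps power2_eq_square)
  also have "\<dots> < 0"
    using k \<open>b \<noteq> 0\<close> by (intro mult_pos_neg) auto
  finally show False using assms[of "- b / k"] by linarith
qed

lemma inner_symmetric_matrix:
  fixes A :: "real^'n^'n"
  assumes "transpose A = A"
  shows "x \<bullet> (A *v y) = (A *v x) \<bullet> y"
  using assms by (metis dot_lmul_matrix vector_transpose_matrix)

text \<open>Maximise the Rayleigh quotient over the unit sphere of \<open>S\<close>. Stationarity
  makes the residual \<open>A *v x - c *\<^sub>R x\<close> orthogonal to \<open>S\<close>; it also
  lies in \<open>S\<close>, so it vanishes.\<close>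

lemma symmetric_eigenvector_in_invariant_subspace:
  fixes A :: "real^'n^'n"
  assumes sym: "transpose A = A" and S: "subspace S" and inv: "\<And>x. x \<in> S \<Longrightarrow> A *v x \<in> S"
    and "S \<noteq> {0}"
  obtains x c where "x \<in> S" "norm x = 1" "A *v x = c *\<^sub>R x"
proof -
  obtain y where "y \<in> S" "y \<noteq> 0" using \<open>S \<noteq> {0}\<close> subspace_0[OF S] by auto
  then have "(1 / norm y) *\<^sub>R y \<in> S \<inter> sphere 0 1" using S by (auto simp: subspace_scale)
  then have ne: "S \<inter> sphere 0 1 \<noteq> {}" by blast
  have comp: "compact (S \<inter> sphere 0 1)"
    by (simp add: S closed_Int_compact closed_subspace)
  have "continuous_on (S \<inter> sphere 0 1) (\<lambda>x. x \<bullet> (A *v x))"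
    by (intro continuous_intros linear_continuous_on_compose[OF continuous_on_id matrix_vector_mul_linear])
  from continuous_attains_sup[OF comp ne this]
  obtain x where x: "x \<in> S" "norm x = 1"
    and mx: "\<And>z. z \<in> S \<Longrightarrow> norm z = 1 \<Longrightarrow> z \<bullet> (A *v z) \<le> x \<bullet> (A *v x)" by auto
  define c where "c = x \<bullet> (A *v x)"
  have le: "z \<bullet> (A *v z) \<le> c * (z \<bullet> z)" if "z \<in> S" for z
  proof (cases "z = 0")
    case False
    then have "((1 / norm z) *\<^sub>R z) \<bullet> (A *v ((1 / norm z) *\<^sub>R z)) \<le> c"
      using mx[of "(1 / norm z) *\<^sub>R z"] S that by (auto simp: c_def subspace_scale)
    then have "(z \<bullet> (A *v z)) / (norm z)\<^sup>2 \<le> c"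
      by (simp add: matrix_vector_mult_scaleR power2_eq_square)
    then show ?thesis using False by (simp add: field_simps power2_norm_eq_inner)
  qed simp
  have orth: "z \<bullet> (A *v x - c *\<^sub>R x) = 0" if z: "z \<in> S" for z
  proof -
    have "0 \<le> t * (2 * (c * (x \<bullet> z) - z \<bullet> (A *v x))) + t\<^sup>2 * (c * (z \<bullet> z) - z \<bullet> (A *v z))" for t
    proof -
      have "x + t *\<^sub>R z \<in> S" using S x z by (simp add: subspace_add subspace_scale)
      from le[OF this] show ?thesis
        using x(2) inner_symmetric_matrix[OF sym, of x z]
        by (simp add: c_def inner_add_left inner_add_right matrix_vector_right_distrib norm_eq_1
            matrix_vector_mult_scaleR algebra_simps power2_eq_square inner_commute)
    qed
    then have "2 * (c * (x \<bullet> z) - z \<bullet> (A *v x)) = 0"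
      by (rule linear_coeff_zero_of_nonneg_quadratic)
    then show ?thesis by (simp add: inner_diff_right inner_commute)
  qed
  have "A *v x - c *\<^sub>R x \<in> S" using S x inv by (simp add: subspace_diff subspace_scale)
  from orth[OF this] have "A *v x = c *\<^sub>R x" by simp
  with x show ?thesis using that by blast
qed

text \<open>A relation rather than a chosen basis: the same \<open>B\<close> then serves for shifts,
  multiples and powers of \<open>A\<close>, and only the eigenvalue function changes.\<close>

definition eigenbasis :: "real^'n^'n \<Rightarrow> (real^'n) set \<Rightarrow> (real^'n \<Rightarrow> real) \<Rightarrow> bool" where
  "eigenbasis A B l \<longleftrightarrow> finite B \<and> pairwise orthogonal B \<and> (\<forall>v\<in>B. norm v = 1) \<and> span B = UNIV
     \<and> (\<forall>v\<in>B. A *v v = l v *\<^sub>R v)"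

text \<open>Induction on the dimension: split off one unit eigenvector \<open>x\<close>; by symmetry
  its orthogonal complement inside \<open>S\<close> is again invariant.\<close>

lemma symmetric_eigenbasis_of_invariant_subspace:
  fixes A :: "real^'n^'n"
  assumes sym: "transpose A = A" and S: "subspace S" and inv: "\<And>x. x \<in> S \<Longrightarrow> A *v x \<in> S"
  shows "\<exists>B. finite B \<and> pairwise orthogonal B \<and> (\<forall>v\<in>B. norm v = 1) \<and> span B = S
     \<and> (\<forall>v\<in>B. \<exists>c. A *v v = c *\<^sub>R v)"
  using S inv
proof (induction "dim S" arbitrary: S rule: less_induct)
  case less
  show ?case
  proof (cases "S = {0}")
    case True
    then show ?thesis by (intro exI[of _ "{}"]) auto
  next
    case False
    obtain x c where x: "x \<in> S" "norm x = 1" "A *v x = c *\<^sub>R x"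
      using symmetric_eigenvector_in_invariant_subspace[OF sym less.prems False] by blast
    define S' where "S' = S \<inter> {y. x \<bullet> y = 0}"
    have S': "subspace S'" unfolding S'_def by (intro subspace_inter less.prems subspace_hyperplane)
    have inv': "A *v y \<in> S'" if "y \<in> S'" for y
      using that less.prems(2) x inner_symmetric_matrix[OF sym, of x y] by (auto simp: S'_def)
    have "x \<notin> span S'" using S' x(2) by (auto simp: span_eq_iff[THEN iffD2] S'_def norm_eq_1)
    have "S' \<subset> S" using x \<open>x \<notin> span S'\<close> by (auto simp: S'_def intro: span_base)
    then have "dim S' < dim S"
      using S' less.prems(1) by (intro dim_psubset) (simp add: span_eq_iff[THEN iffD2])
    from less.hyps[OF this S' inv'] obtain B where B: "finite B" "pairwise orthogonal B"
      "\<forall>v\<in>B. norm v = 1" "span B = S'" "\<forall>v\<in>B. \<exists>c. A *v v = c *\<^sub>R v" by blast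
    have BS: "v \<in> S'" if "v \<in> B" for v using that B(4) span_base by blast
    have "span (insert x B) = S"
    proof
      show "span (insert x B) \<subseteq> S"
        using x BS less.prems(1) by (intro span_minimal) (auto simp: S'_def)
      show "S \<subseteq> span (insert x B)"
      proof
        fix y assume y: "y \<in> S"
        have "y - (x \<bullet> y) *\<^sub>R x \<in> S'"
          using x y less.prems(1)
          by (auto simp: S'_def subspace_diff subspace_scale inner_diff_right norm_eq_1)
        then show "y \<in> span (insert x B)" using B(4) by (auto simp: span_insert)
      qed
    qed
    then show ?thesis
      using B x BS by (intro exI[of _ "insert x B"])
        (auto simp: pairwise_insert orthogonal_def S'_def inner_commute)
  qed
qed

lemma symmetric_eigenbasis_exists:
  fixes A :: "real^'n^'n"
  assumes "transpose A = A"
  obtains B l where "eigenbasis A B l"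
proof -
  obtain B where B: "finite B" "pairwise orthogonal B" "\<forall>v\<in>B. norm v = 1" "span B = (UNIV :: (real^'n) set)"
    "\<forall>v\<in>B. \<exists>c. A *v v = c *\<^sub>R v"
    using symmetric_eigenbasis_of_invariant_subspace[OF assms, of UNIV] by auto
  then obtain l where "\<forall>v\<in>B. A *v v = l v *\<^sub>R v" by metis
  then show ?thesis using B that unfolding eigenbasis_def by blast
qed

context
  fixes A :: "real^'n^'n" and B l
  assumes eb: "eigenbasis A B l"
begin

lemma eigenbasis_finite: "finite B"
  and eigenbasis_norm: "v \<in> B \<Longrightarrow> norm v = 1"
  and eigenbasis_eigen: "v \<in> B \<Longrightarrow> A *v v = l v *\<^sub>R v"
  and eigenbasis_inner_self: "v \<in> B \<Longrightarrow> v \<bullet> v = 1"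
  using eb by (auto simp: eigenbasis_def norm_eq_1)

lemma eigenbasis_inner: "v \<in> B \<Longrightarrow> v' \<in> B \<Longrightarrow> v \<bullet> v' = (if v = v' then 1 else 0)"
  using eb by (auto simp: eigenbasis_def norm_eq_1 pairwise_def orthogonal_def)

lemma eigenbasis_expand: "x = (\<Sum>v\<in>B. (v \<bullet> x) *\<^sub>R v)"
proof -
  define y where "y = x - (\<Sum>v\<in>B. (v \<bullet> x) *\<^sub>R v)"
  have "v \<bullet> y = 0" if "v \<in> B" for v
    using that eigenbasis_finite
    by (simp add: y_def inner_diff_right inner_sum_right eigenbasis_inner if_distrib cong: if_cong)
  then have "orthogonal y v" if "v \<in> B" for v
    using that by (simp add: orthogonal_def inner_commute)
  then have "orthogonal y y"
    using orthogonal_to_span[of y B y] eb by (simp add: eigenbasis_def)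
  then show ?thesis by (simp add: orthogonal_self y_def)
qed

lemma eigenbasis_parseval: "x \<bullet> y = (\<Sum>v\<in>B. (v \<bullet> x) * (v \<bullet> y))"
  by (subst (1) eigenbasis_expand[of x]) (simp add: inner_sum_left)

text \<open>Completeness relation, from Parseval at two coordinate vectors. It turns sums over the
  eigenbasis back into coordinates.\<close>

lemma eigenbasis_mat_unit: "(\<Sum>v\<in>B. v $ i * v $ j) = (if i = j then 1 else 0)"
  using eigenbasis_parseval[of "axis i 1" "axis j 1"]
  by (simp only: inner_axis) (auto simp: axis_def)

lemma eigenbasis_quadratic: "x \<bullet> (A *v x) = (\<Sum>v\<in>B. l v * (v \<bullet> x)\<^sup>2)"
proof -
  have "A *v x = (\<Sum>v\<in>B. (v \<bullet> x) *\<^sub>R (A *v v))"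
    by (subst (1) eigenbasis_expand[of x])
      (simp add: linear_sum[OF matrix_vector_mul_linear] matrix_vector_mult_scaleR)
  also have "\<dots> = (\<Sum>v\<in>B. (l v * (v \<bullet> x)) *\<^sub>R v)"
    by (intro sum.cong) (auto simp: eigenbasis_eigen)
  finally show ?thesis
    by (simp add: inner_sum_right power2_eq_square inner_commute mult_ac)
qed

lemma eigenbasis_trace: "trace (M :: real^'n^'n) = (\<Sum>v\<in>B. v \<bullet> (M *v v))"
proof -
  have "(\<Sum>v\<in>B. v \<bullet> (M *v v)) = (\<Sum>v\<in>B. \<Sum>i\<in>UNIV. \<Sum>j\<in>UNIV. M $ i $ j * (v $ i * v $ j))"
    by (simp add: inner_vec_def matrix_vector_mult_def sum_distrib_left mult_ac)
  also have "\<dots> = (\<Sum>i\<in>UNIV. \<Sum>j\<in>UNIV. M $ i $ j * (\<Sum>v\<in>B. v $ i * v $ j))"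
    by (simp add: sum_distrib_left sum.swap[of _ _ B])
  also have "\<dots> = trace M"
    by (simp add: eigenbasis_mat_unit trace_def if_distrib cong: if_cong)
  finally show ?thesis ..
qed

lemma eigenbasis_card: "card B = CARD('n)"
proof -
  have "real (card B) = real CARD('n)"
    using eigenbasis_trace[of "mat 1"] eigenbasis_inner_self by (simp add: trace_I)
  then show ?thesis by simp
qed

lemma eigenbasis_nonempty: "B \<noteq> {}"
  using eigenbasis_mat_unit[of undefined undefined] by auto

lemma eigenbasis_eigenvalue: "v \<in> B \<Longrightarrow> l v = v \<bullet> (A *v v)"
  by (simp add: eigenbasis_eigen eigenbasis_inner_self)

lemma eigenbasis_shift: "eigenbasis (A + c *\<^sub>R mat 1) B (\<lambda>v. l v + c)"
  using eb unfolding eigenbasis_def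
  by (simp add: matrix_vector_mult_add_rdistrib algebra_simps scaleR_matrix_vector_assoc[symmetric])

lemma eigenbasis_scale: "eigenbasis (c *\<^sub>R A) B (\<lambda>v. c * l v)"
  using eb unfolding eigenbasis_def
  by (simp add: scaleR_matrix_vector_assoc[symmetric])

lemma eigenbasis_real_eigenvalues: "real_eigenvalues A = l ` B"
proof
  show "l ` B \<subseteq> real_eigenvalues A"
  proof (clarsimp simp: real_eigenvalues_def)
    fix v assume "v \<in> B"
    then show "\<exists>x. x \<noteq> 0 \<and> A *v x = l v *\<^sub>R x"
      using eigenbasis_eigen[of v] eigenbasis_norm[of v] by (intro exI[of _ v]) auto
  qed
  show "real_eigenvalues A \<subseteq> l ` B"
  proof
    fix c assume "c \<in> real_eigenvalues A"
    then obtain x where x: "x \<noteq> 0" "A *v x = c *\<^sub>R x" by (auto simp: real_eigenvalues_def)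
    then obtain v where v: "v \<in> B" "v \<bullet> x \<noteq> 0" using eigenbasis_expand[of x]
      by (metis (no_types, lifting) scaleR_eq_0_iff sum.neutral)
    have "A *v x = (\<Sum>v\<in>B. (v \<bullet> x) *\<^sub>R (A *v v))"
      by (subst (1) eigenbasis_expand[of x])
        (simp add: linear_sum[OF matrix_vector_mul_linear] matrix_vector_mult_scaleR)
    also have "\<dots> = (\<Sum>v\<in>B. (l v * (v \<bullet> x)) *\<^sub>R v)"
      by (intro sum.cong) (auto simp: eigenbasis_eigen)
    finally have "v \<bullet> (A *v x) = l v * (v \<bullet> x)"
      using v(1) eigenbasis_finite
      by (simp add: inner_sum_right eigenbasis_inner if_distrib cong: if_cong)
    then have "c = l v" using v x by simp
    then show "c \<in> l ` B" using v by blast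
  qed
qed

end

subsection \<open>The trace exponential along rank-one directions\<close>

primrec mpow :: "real^'n^'n \<Rightarrow> nat \<Rightarrow> real^'n^'n" where
  "mpow A 0 = mat 1"
| "mpow A (Suc k) = mpow A k ** A"

text \<open>A series of traces, so that rank-one updates and measurability can be treated one power
  at a time, where only polynomials in the entries occur.\<close>

definition tr_exp :: "real^'n^'n \<Rightarrow> real" where
  "tr_exp A = (\<Sum>m. trace (mpow A m) / fact m)"

lemma eigenbasis_mpow:
  assumes "eigenbasis A B l"
  shows "eigenbasis (mpow A m) B (\<lambda>v. l v ^ m)"
proof -
  have "mpow A m *v v = l v ^ m *\<^sub>R v" if "A *v v = l v *\<^sub>R v" for v
    by (induction m) (simp_all add: that matrix_vector_mul_assoc[symmetric] matrix_vector_mult_scaleR)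
  then show ?thesis using assms by (auto simp: eigenbasis_def)
qed

lemma trace_mpow_eigenbasis:
  assumes "eigenbasis A B l"
  shows "trace (mpow A m) = (\<Sum>v\<in>B. l v ^ m)"
  using eigenbasis_trace[OF assms] eigenbasis_eigenvalue[OF eigenbasis_mpow[OF assms]] by simp

lemma tr_exp_sums_eigenbasis:
  assumes "eigenbasis A B l"
  shows "(\<lambda>m. trace (mpow A m) / fact m) sums (\<Sum>v\<in>B. exp (l v))"
proof -
  have "(\<lambda>m. \<Sum>v\<in>B. l v ^ m / fact m) sums (\<Sum>v\<in>B. exp (l v))"
    using exp_converges[where 'a = real] by (intro sums_sum) (simp add: field_simps)
  then show ?thesis by (simp add: trace_mpow_eigenbasis[OF assms] sum_divide_distrib)
qed

lemma tr_exp_eigenbasis: "eigenbasis A B l \<Longrightarrow> tr_exp A = (\<Sum>v\<in>B. exp (l v))"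
  unfolding tr_exp_def by (rule sums_unique[OF tr_exp_sums_eigenbasis, symmetric])

lemma tr_exp_sums:
  assumes "transpose A = A"
  shows "(\<lambda>m. trace (mpow A m) / fact m) sums tr_exp A"
  using symmetric_eigenbasis_exists[OF assms] tr_exp_sums_eigenbasis tr_exp_eigenbasis by metis

lemma tr_exp_pos:
  assumes "transpose A = A"
  shows "0 < tr_exp A"
proof -
  obtain B l where "eigenbasis A B l" using symmetric_eigenbasis_exists[OF assms] by blast
  from this eigenbasis_finite[OF this] eigenbasis_nonempty[OF this] show ?thesis
    by (simp add: tr_exp_eigenbasis sum_pos)
qed

lemma tr_exp_shift:
  assumes "transpose A = A"
  shows "tr_exp (A + c *\<^sub>R mat 1) = exp c * tr_exp A"
proof -
  obtain B l where "eigenbasis A B l" using symmetric_eigenbasis_exists[OF assms] by blast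
  then show ?thesis
    by (simp add: tr_exp_eigenbasis[OF eigenbasis_shift] tr_exp_eigenbasis exp_add sum_distrib_left mult.commute)
qed

lemma outer_prod_mult_vec: "outer_prod w *v x = (w \<bullet> x) *\<^sub>R w"
  by (simp add: vec_eq_iff outer_prod_def matrix_vector_mult_def inner_vec_def sum_distrib_left
      sum_distrib_right mult_ac)

lemma transpose_outer_prod [simp]: "transpose (outer_prod w) = outer_prod w"
  by (simp add: vec_eq_iff outer_prod_def transpose_def mult.commute)

lemma transpose_add: "transpose (A + B) = transpose A + transpose (B :: real^'n^'m)"
  by (simp add: vec_eq_iff transpose_def)

lemma transpose_diff: "transpose (A - B) = transpose A - transpose (B :: real^'n^'m)"
  by (simp add: vec_eq_iff transpose_def)

lemma transpose_scaleR_matrix: "transpose (c *\<^sub>R A) = c *\<^sub>R transpose (A :: real^'n^'m)"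
  by (simp add: vec_eq_iff transpose_def)

lemma transpose_minus: "transpose (- A) = - transpose (A :: real^'n^'m)"
  by (simp add: vec_eq_iff transpose_def)

lemmas transpose_simps = transpose_add transpose_diff transpose_minus transpose_scaleR_matrix transpose_mat

text \<open>Sort the expanded product by its rightmost rank-one factor: to the right of it stand
  only powers of \<open>A\<close>, which contribute a scalar, and to the left a full power of
  \<open>M t\<close>.\<close>

lemma mpow_rank_one_update:
  fixes A :: "real^'n^'n" and w :: "real^'n"
  defines "M t \<equiv> A + t *\<^sub>R outer_prod w"
  shows "mpow (M t) j *v x
    = mpow A j *v x + t *\<^sub>R (\<Sum>i<j. (w \<bullet> (mpow A (j - Suc i) *v x)) *\<^sub>R (mpow (M t) i *v w))"
proof (induction j arbitrary: x)
  case (Suc j)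
  have "mpow (M t) (Suc j) *v x = mpow (M t) j *v (A *v x) + (t * (w \<bullet> x)) *\<^sub>R (mpow (M t) j *v w)"
    by (simp add: M_def matrix_vector_mul_assoc[symmetric] matrix_vector_mult_add_rdistrib
        matrix_vector_right_distrib scaleR_matrix_vector_assoc[symmetric] outer_prod_mult_vec
        matrix_vector_mult_scaleR)
  also have "mpow (M t) j *v (A *v x) = mpow A (Suc j) *v x
      + t *\<^sub>R (\<Sum>i<j. (w \<bullet> (mpow A (Suc j - Suc i) *v x)) *\<^sub>R (mpow (M t) i *v w))"
  proof -
    have "mpow A (j - Suc i) *v (A *v x) = mpow A (Suc j - Suc i) *v x" if "i < j" for i
      using that by (simp add: matrix_vector_mul_assoc Suc_diff_Suc flip: mpow.simps(2))
    then show ?thesis unfolding Suc.IH by (simp add: matrix_vector_mul_assoc)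
  qed
  finally show ?case by (simp add: algebra_simps)
qed simp

section \<open>Taylor inequalities for polynomials with nonnegative coefficients\<close>

lemma poly_mono_nonneg_coeffs:
  fixes p :: "real poly"
  assumes "\<And>k. 0 \<le> coeff p k" "0 \<le> t"
  shows "\<bar>poly p (-t)\<bar> \<le> poly p t" "coeff p 0 \<le> poly p t" "0 \<le> poly p t"
proof -
  have "\<bar>poly p (-t)\<bar> \<le> (\<Sum>k\<le>degree p. \<bar>coeff p k * (-t) ^ k\<bar>)"
    unfolding poly_altdef by (rule sum_abs)
  also have "\<dots> = poly p t"
    unfolding poly_altdef using assms by (intro sum.cong) (auto simp: abs_mult power_abs)
  finally show "\<bar>poly p (-t)\<bar> \<le> poly p t" .
  then show "0 \<le> poly p t" by linarith
  have "coeff p 0 * t ^ 0 \<le> (\<Sum>k\<le>degree p. coeff p k * t ^ k)"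
    by (rule member_le_sum) (use assms in auto)
  then show "coeff p 0 \<le> poly p t" by (simp add: poly_altdef)
qed

text \<open>With \<^term>\<open>q = pCons c r\<close> the right-hand side minus the left-hand side collapses to
  \<^term>\<open>t ^ 3 * poly (pderiv (pderiv r)) t / 2\<close>.\<close>

lemma nonneg_coeffs_backward_taylor:
  fixes q :: "real poly"
  assumes q: "\<And>k. 0 \<le> coeff q k" and "0 \<le> t"
  shows "poly q 0 \<le> poly q t - t * poly (pderiv q) t + t\<^sup>2 / 2 * poly (pderiv (pderiv q)) t"
proof (cases q)
  case (pCons c r)
  have r: "0 \<le> coeff r k" for k using q[of "Suc k"] by (simp add: pCons)
  have "0 \<le> poly (pderiv (pderiv r)) t"
    using r \<open>0 \<le> t\<close> by (intro poly_mono_nonneg_coeffs(3)) (auto simp: coeff_pderiv)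
  then have "0 \<le> t ^ 3 * poly (pderiv (pderiv r)) t / 2" using \<open>0 \<le> t\<close> by simp
  also have "\<dots> = poly q t - t * poly (pderiv q) t + t\<^sup>2 / 2 * poly (pderiv (pderiv q)) t - poly q 0"
    by (simp add: pCons pderiv_pCons pderiv_add algebra_simps power2_eq_square power3_eq_cube)
  finally show ?thesis by linarith
qed

text \<open>Only even powers survive in the symmetric sum, and dropping those of degree at least 4
  makes it smaller. With \<open>r\<close> the part of \<open>p\<close> from degree 3 on, the dropped
  terms are \<open>t ^ 3 * (poly r t - poly r (-t))\<close>.\<close>

lemma nonneg_coeffs_even_part:
  fixes p :: "real poly"
  assumes p: "\<And>k. 0 \<le> coeff p k"
  shows "2 * coeff p 0 + 2 * t\<^sup>2 * coeff p 2 \<le> poly p t + poly p (-t)"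
proof -
  have *: "2 * coeff p 0 + 2 * t\<^sup>2 * coeff p 2 \<le> poly p t + poly p (-t)" if "0 \<le> t" for t
  proof -
    obtain c0 c1 c2 r where pr: "p = pCons c0 (pCons c1 (pCons c2 r))" by (metis pCons_cases)
    have r: "0 \<le> coeff r k" for k using p[of "Suc (Suc (Suc k))"] by (simp add: pr)
    have "0 \<le> t ^ 3 * (poly r t - poly r (-t))"
      using poly_mono_nonneg_coeffs(1)[OF r that] that by (intro mult_nonneg_nonneg) auto
    also have "\<dots> = poly p t + poly p (-t) - (2 * coeff p 0 + 2 * t\<^sup>2 * coeff p 2)"
      by (simp add: pr algebra_simps power2_eq_square power3_eq_cube numeral_2_eq_2)
    finally show ?thesis by linarith
  qed
  show ?thesis using *[of t] *[of "-t"] by (cases "0 \<le> t") auto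
qed

section \<open>Divided differences of the exponential and the second-order term\<close>

definition exp_slope :: "real \<Rightarrow> real \<Rightarrow> real" where
  "exp_slope x y = (if x = y then exp x else (exp x - exp y) / (x - y))"

text \<open>Half the second derivative of \<open>tr_exp (A + t *\<^sub>R outer_prod w)\<close> at
  \<open>t = 0\<close> in an eigenbasis of \<open>A\<close> (Daleckii-Krein formula).\<close>

definition rank_one_hessian :: "(real^'n) set \<Rightarrow> (real^'n \<Rightarrow> real) \<Rightarrow> real^'n \<Rightarrow> real" where
  "rank_one_hessian B l w =
     (\<Sum>v\<in>B. \<Sum>v'\<in>B. exp_slope (l v) (l v') / 2 * ((v \<bullet> w)\<^sup>2 * (v' \<bullet> w)\<^sup>2))"

text \<open>Arises from placing two rank-one factors in a cyclic word of length \<open>m\<close>: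
  the exponents are the lengths of the two gaps and add up to \<open>m - 2\<close>. It is not
  symmetric in \<open>x\<close> and \<open>y\<close>; \<open>slope_sum\<close> symmetrises
  it.\<close>

definition slope_coeff :: "nat \<Rightarrow> real \<Rightarrow> real \<Rightarrow> real" where
  "slope_coeff m x y = (\<Sum>j<m. \<Sum>i<j. x ^ (j - Suc i) * y ^ (m - Suc j + i))"

abbreviation slope_sum :: "nat \<Rightarrow> (real^'n) set \<Rightarrow> (real^'n \<Rightarrow> real) \<Rightarrow> real^'n \<Rightarrow> real" where
  "slope_sum m B l w \<equiv> \<Sum>v\<in>B. \<Sum>v'\<in>B. (slope_coeff m (l v) (l v') + slope_coeff m (l v') (l v)) / 2
     * ((v \<bullet> w)\<^sup>2 * (v' \<bullet> w)\<^sup>2)"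

lemma exp_series_shifted: "(\<lambda>m. of_nat m * z ^ (m - 1) / fact m) sums exp (z :: real)"
proof -
  have "of_nat (Suc m) * z ^ (Suc m - 1) / fact (Suc m) = z ^ m /\<^sub>R fact m" for m
    by (simp del: of_nat_Suc add: divide_inverse)
  then have "(\<lambda>m. of_nat (Suc m) * z ^ (Suc m - 1) / fact (Suc m)) sums exp z"
    using exp_converges[of z] by (simp only:)
  then show ?thesis by (subst (asm) sums_Suc_iff) simp
qed

text \<open>Multiplied by \<open>x - y\<close>, the geometric sums collapse to
  \<open>H m x y - m * y ^ (m - 1)\<close> with a symmetric \<open>H\<close>. Adding the same with
  \<open>x\<close> and \<open>y\<close> exchanged cancels \<open>H\<close> and leaves the series of
  \<open>exp x - exp y\<close>, divided by \<open>x - y\<close>.\<close>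

lemma exp_slope_series:
  "(\<lambda>m. (slope_coeff m x y + slope_coeff m y x) / fact m) sums exp_slope x y"
proof -
  note k_def = slope_coeff_def
  note e = exp_series_shifted
  show ?thesis
  proof (cases "x = y")
    case False
    define H where "H m x y = (\<Sum>i<m. x ^ (m - Suc i) * y ^ i)" for m and x y :: real
    have H: "H m x y * (x - y) = x ^ m - y ^ m" for m and x y :: real
      unfolding H_def using power_diff_sumr2[of y m x] by (simp add: algebra_simps)
    have kH: "slope_coeff m x y * (x - y) = H m x y - of_nat m * y ^ (m - 1)" for m and x y :: real
    proof -
      have "slope_coeff m x y = (\<Sum>j<m. y ^ (m - Suc j) * H j x y)"
        unfolding k_def H_def sum_distrib_left power_add by (simp only: mult_ac)
      then have "slope_coeff m x y * (x - y) = (\<Sum>j<m. y ^ (m - Suc j) * (x ^ j - y ^ j))"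
        by (simp add: sum_distrib_right mult.assoc H)
      also have "\<dots> = (\<Sum>j<m. y ^ (m - Suc j) * x ^ j) - (\<Sum>j<m. y ^ (m - 1))"
        unfolding sum_subtractf[symmetric]
        by (intro sum.cong) (auto simp: algebra_simps simp flip: power_add)
      also have "(\<Sum>j<m. y ^ (m - Suc j) * x ^ j) = H m x y"
      proof -
        have "(\<Sum>j<m. y ^ (m - Suc j) * x ^ j) = (\<Sum>j<m. y ^ (m - Suc (m - Suc j)) * x ^ (m - Suc j))"
          by (rule sum.nat_diff_reindex[symmetric])
        also have "\<dots> = H m x y"
          unfolding H_def by (intro sum.cong refl) (simp add: mult.commute)
        finally show ?thesis .
      qed
      finally show ?thesis by simp
    qed
    have Hs: "H m y x = H m x y" for m
    proof -
      have "H m y x * (x - y) = H m x y * (x - y)" using H[of m x y] H[of m y x] by (simp add: algebra_simps)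
      then show ?thesis using False by simp
    qed
    have "(slope_coeff m x y + slope_coeff m y x) / fact m
      = (of_nat m * x ^ (m - 1) / fact m - of_nat m * y ^ (m - 1) / fact m) / (x - y)" for m
    proof -
      have "(slope_coeff m x y + slope_coeff m y x) * (x - y) = of_nat m * x ^ (m - 1) - of_nat m * y ^ (m - 1)"
        using kH[of m x y] kH[of m y x] Hs[of m] by (simp add: algebra_simps)
      then have "slope_coeff m x y + slope_coeff m y x = (of_nat m * x ^ (m - 1) - of_nat m * y ^ (m - 1)) / (x - y)"
        using False by (simp add: eq_divide_eq)
      then show ?thesis by (simp add: diff_divide_distrib mult.commute)
    qed
    then show ?thesis
      using sums_divide[OF sums_diff[OF e[of x] e[of y]], of "x - y"] False by (simp add: exp_slope_def)
  next
    case True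
    have "slope_coeff m x x = (\<Sum>j<m. \<Sum>i<j. x ^ (m - 2))" for m
      unfolding k_def
    proof (intro sum.cong refl)
      fix j i assume "j \<in> {..<m}" "i \<in> {..<j}"
      then have "j - Suc i + (m - Suc j + i) = m - 2" by auto
      then show "x ^ (j - Suc i) * x ^ (m - Suc j + i) = x ^ (m - 2)" by (metis power_add)
    qed
    also have "\<dots> m = (\<Sum>j<m. real j) * x ^ (m - 2)" for m
      by (simp add: sum_distrib_right)
    also have "\<dots> m = of_nat (m * (m - 1) div 2) * x ^ (m - 2)" for m
      by (simp add: Sum_Ico_nat lessThan_atLeast0 flip: of_nat_sum)
    finally have kx: "slope_coeff m x x = of_nat (m * (m - 1) div 2) * x ^ (m - 2)" for m .
    have "slope_coeff m x x + slope_coeff m x x = of_nat (m * (m - 1)) * x ^ (m - 2)" for m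
    proof -
      have "2 * (m * (m - 1) div 2) = m * (m - 1)" by (cases m) auto
      then have "2 * real (m * (m - 1) div 2) = real (m * (m - 1))" by linarith
      then show ?thesis unfolding kx by (simp only: mult_2[symmetric] mult.assoc[symmetric])
    qed
    then have eq: "(slope_coeff m x x + slope_coeff m x x) / fact m = of_nat (m * (m - 1)) * x ^ (m - 2) / fact m" for m
      by simp
    define g where "g m = of_nat (m * (m - 1)) * x ^ (m - 2) / fact m" for m :: nat
    have g2: "g (Suc (Suc m)) = x ^ m /\<^sub>R fact m" for m
    proof -
      have "a * b * y / (a * (b * f)) = y / f" if "a > 0" "b > 0" for a b y f :: real
        using that by simp
      from this[of "real (Suc (Suc m))" "real (Suc m)" "x ^ m" "fact m"]
      have "real (Suc (Suc m)) * real (Suc m) * x ^ m / (real (Suc (Suc m)) * (real (Suc m) * fact m)) = x ^ m / fact m"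
        by (simp only: of_nat_0_less_iff zero_less_Suc)
      moreover have "g (Suc (Suc m)) = real (Suc (Suc m)) * real (Suc m) * x ^ m / (real (Suc (Suc m)) * (real (Suc m) * fact m))"
        unfolding g_def by (simp only: fact_Suc of_nat_mult diff_Suc_1 diff_Suc_Suc numeral_2_eq_2 diff_zero)
      ultimately show ?thesis by (simp add: divide_inverse)
    qed
    \<comment> \<open>The factor \<open>m * (m - 1)\<close> vanishes for \<open>m = 0\<close> and
      \<open>m = 1\<close>, exactly where \<open>m - 2\<close> is truncated, so the index can be
      shifted by two.\<close>
    have "(\<lambda>m. g (Suc (Suc m))) sums exp x" unfolding g2 by (rule exp_converges)
    then have "g sums (exp x + g 1 + g 0)" using sums_Suc_iff[of "\<lambda>m. g (Suc m)"] sums_Suc_iff[of g] by auto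
    moreover have "g 1 = 0" "g 0 = 0" by (simp_all add: g_def)
    ultimately have "g sums exp x" by simp
    then have "(\<lambda>m. (slope_coeff m x x + slope_coeff m x x) / fact m) sums exp_slope x x"
      unfolding eq g_def exp_slope_def by simp
    then show ?thesis using True by (simp only:)
  qed
qed


section \<open>Traces of powers along a rank-one line\<close>

context
  fixes A :: "real^'n^'n" and B l and w :: "real^'n"
  assumes eb: "eigenbasis A B l" and l_nonneg: "\<And>v. v \<in> B \<Longrightarrow> 0 \<le> l v"
begin

private definition "M t = A + t *\<^sub>R outer_prod w"
private definition "mom k = (\<Sum>v\<in>B. l v ^ k * (v \<bullet> w)\<^sup>2)"
text \<open>The number \<open>w \<bullet> A^r (A + t w w^T)^j w\<close> in eigencoordinates. Its
  recursion involves only the moments \<open>mom k\<close>, nonnegative because the eigenvalues are;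
  this is where the nonnegative coefficients come from.\<close>

private definition "mixed r j t = (\<Sum>v\<in>B. l v ^ r * (v \<bullet> w) * (v \<bullet> (mpow (M t) j *v w)))"

private lemma mom_nonneg: "0 \<le> mom k"
  unfolding mom_def by (intro sum_nonneg mult_nonneg_nonneg) (auto simp: l_nonneg)

private lemma inner_mpow: "x \<bullet> (mpow A k *v y) = (\<Sum>v\<in>B. l v ^ k * (v \<bullet> x) * (v \<bullet> y))"
proof -
  have "mpow A k *v y = (\<Sum>v\<in>B. (v \<bullet> y) *\<^sub>R (mpow A k *v v))"
    by (subst (1) eigenbasis_expand[OF eb, of y])
      (simp add: linear_sum[OF matrix_vector_mul_linear] matrix_vector_mult_scaleR)
  also have "\<dots> = (\<Sum>v\<in>B. (l v ^ k * (v \<bullet> y)) *\<^sub>R v)"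
    by (intro sum.cong) (auto simp: eigenbasis_eigen[OF eigenbasis_mpow[OF eb]])
  finally show ?thesis
    by (simp add: inner_sum_right inner_commute mult_ac)
qed

private lemma mom_eq: "w \<bullet> (mpow A k *v w) = mom k"
  by (simp add: inner_mpow mom_def power2_eq_square mult.assoc)

private lemma mixed_rec: "mixed r j t = mom (r + j) + t * (\<Sum>i<j. mom (j - Suc i) * mixed r i t)"
proof -
  have "v \<bullet> (mpow (M t) j *v w) = l v ^ j * (v \<bullet> w) + t * (\<Sum>i<j. mom (j - Suc i) * (v \<bullet> (mpow (M t) i *v w)))"
    if "v \<in> B" for v
  proof -
    have "v \<bullet> (mpow A j *v w) = l v ^ j * (v \<bullet> w)"
      using that eigenbasis_finite[OF eb]
      by (simp add: inner_mpow eigenbasis_inner[OF eb] if_distrib if_distribR cong: if_cong)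
    then show ?thesis
      unfolding M_def mpow_rank_one_update[of A t w j]
      by (simp add: inner_add_right inner_sum_right mom_eq)
  qed
  then have "mixed r j t = (\<Sum>v\<in>B. l v ^ r * (v \<bullet> w) * (l v ^ j * (v \<bullet> w))
      + t * (\<Sum>i<j. mom (j - Suc i) * (l v ^ r * (v \<bullet> w) * (v \<bullet> (mpow (M t) i *v w)))))"
    unfolding mixed_def
    by (intro sum.cong refl) (simp add: distrib_left sum_distrib_left mult_ac)
  also have "\<dots> = mom (r + j) + t * (\<Sum>i<j. mom (j - Suc i) * mixed r i t)"
    unfolding sum.distrib mom_def[of "r + j"] mixed_def sum_distrib_left
    by (subst sum.swap) (simp add: power_add power2_eq_square mult_ac)
  finally show ?thesis .
qed

private lemma mixed_poly:
  "\<exists>p. (\<forall>k. 0 \<le> coeff p k) \<and> (\<forall>t. mixed r j t = poly p t) \<and> coeff p 0 = mom (r + j)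
     \<and> coeff p 1 = (\<Sum>i<j. mom (j - Suc i) * mom (r + i))"
proof (induction j rule: less_induct)
  case (less j)
  then obtain P where P: "\<And>i. i < j \<Longrightarrow> (\<forall>k. 0 \<le> coeff (P i) k) \<and> (\<forall>t. mixed r i t = poly (P i) t)
     \<and> coeff (P i) 0 = mom (r + i)" by metis
  define p where "p = pCons (mom (r + j)) (\<Sum>i<j. smult (mom (j - Suc i)) (P i))"
  have "0 \<le> coeff p k" for k
    using P mom_nonneg by (cases k) (auto simp: p_def coeff_sum intro!: sum_nonneg)
  moreover have "mixed r j t = poly p t" for t
    using P by (subst mixed_rec) (simp add: p_def poly_sum)
  ultimately show ?case
    using P by (intro exI[of _ p]) (simp add: p_def coeff_sum)
qed

private lemma trace_rank_one_update:
  "trace (mpow (M t) m) = trace (mpow A m) + t * (\<Sum>j<m. mixed (m - Suc j) j t)"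
proof -
  have "trace (mpow (M t) m) = (\<Sum>v\<in>B. v \<bullet> (mpow A m *v v)
     + t * (\<Sum>j<m. (w \<bullet> (mpow A (m - Suc j) *v v)) * (v \<bullet> (mpow (M t) j *v w))))"
    unfolding eigenbasis_trace[OF eb] M_def mpow_rank_one_update[of A t w m]
    by (simp add: inner_add_right inner_sum_right)
  also have "\<dots> = (\<Sum>v\<in>B. v \<bullet> (mpow A m *v v)
     + t * (\<Sum>j<m. l v ^ (m - Suc j) * (v \<bullet> w) * (v \<bullet> (mpow (M t) j *v w))))"
    by (intro sum.cong refl arg_cong2[where f = "(+)"] arg_cong2[where f = "(*)"])
      (auto simp: eigenbasis_eigen[OF eigenbasis_mpow[OF eb]] inner_commute)
  also have "\<dots> = trace (mpow A m) + t * (\<Sum>j<m. mixed (m - Suc j) j t)"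
    unfolding sum.distrib eigenbasis_trace[OF eb] mixed_def sum_distrib_left[symmetric]
    by (subst sum.swap) simp
  finally show ?thesis .
qed

lemma trace_mpow_rank_one_poly:
  "\<exists>p. (\<forall>k. 0 \<le> coeff p k) \<and> (\<forall>t. trace (mpow (A + t *\<^sub>R outer_prod w) m) = poly p t)
    \<and> coeff p 0 = trace (mpow A m)
    \<and> coeff p 1 = (\<Sum>v\<in>B. of_nat m * l v ^ (m - 1) * (v \<bullet> w)\<^sup>2)
    \<and> coeff p 2 = slope_sum m B l w"
proof -
  obtain P where P: "\<And>r j. (\<forall>k. 0 \<le> coeff (P r j) k) \<and> (\<forall>t. mixed r j t = poly (P r j) t)
     \<and> coeff (P r j) 0 = mom (r + j) \<and> coeff (P r j) 1 = (\<Sum>i<j. mom (j - Suc i) * mom (r + i))"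
    using mixed_poly by metis
  define p where "p = pCons (trace (mpow A m)) (\<Sum>j<m. P (m - Suc j) j)"
  have "0 \<le> coeff p k" for k
    using P by (cases k)
      (auto simp: p_def coeff_sum trace_mpow_eigenbasis[OF eb] l_nonneg intro!: sum_nonneg)
  moreover have "trace (mpow (A + t *\<^sub>R outer_prod w) m) = poly p t" for t
    using P trace_rank_one_update[of t m] by (simp add: p_def poly_sum M_def)
  moreover have "coeff p 0 = trace (mpow A m)" by (simp add: p_def)
  moreover have "coeff p 1 = (\<Sum>v\<in>B. of_nat m * l v ^ (m - 1) * (v \<bullet> w)\<^sup>2)"
  proof -
    have "coeff p 1 = (\<Sum>j<m. mom (m - Suc j + j))" using P by (simp add: p_def coeff_sum)
    also have "\<dots> = (\<Sum>j<m. mom (m - 1))" by (intro sum.cong) auto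
    finally show ?thesis by (simp add: mom_def sum_distrib_left mult_ac)
  qed
  moreover have "coeff p 2 = slope_sum m B l w"
  proof -
    let ?s = "\<lambda>v v'. slope_coeff m (l v) (l v') * ((v \<bullet> w)\<^sup>2 * (v' \<bullet> w)\<^sup>2)"
    have "coeff p 2 = (\<Sum>j<m. \<Sum>i<j. mom (j - Suc i) * mom (m - Suc j + i))"
      using P by (simp add: p_def coeff_sum numeral_2_eq_2)
    also have "\<dots> = (\<Sum>j<m. \<Sum>i<j. \<Sum>v\<in>B. \<Sum>v'\<in>B.
        (l v ^ (j - Suc i) * l v' ^ (m - Suc j + i)) * ((v \<bullet> w)\<^sup>2 * (v' \<bullet> w)\<^sup>2))"
      by (simp add: mom_def sum_product mult_ac)
    also have "\<dots> = (\<Sum>v\<in>B. \<Sum>v'\<in>B. ?s v v')"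
    proof -
      have "(\<Sum>j<m. \<Sum>i<j. \<Sum>v\<in>B. \<Sum>v'\<in>B. g j i v v') = (\<Sum>v\<in>B. \<Sum>v'\<in>B. \<Sum>j<m. \<Sum>i<j. g j i v v')"
        for g :: "nat \<Rightarrow> nat \<Rightarrow> real^'n \<Rightarrow> real^'n \<Rightarrow> real"
      proof -
        have "(\<Sum>i<j. \<Sum>v\<in>B. \<Sum>v'\<in>B. g j i v v') = (\<Sum>v\<in>B. \<Sum>v'\<in>B. \<Sum>i<j. g j i v v')" for j
          by (subst sum.swap, rule sum.cong[OF refl], rule sum.swap)
        then have "(\<Sum>j<m. \<Sum>i<j. \<Sum>v\<in>B. \<Sum>v'\<in>B. g j i v v') = (\<Sum>j<m. \<Sum>v\<in>B. \<Sum>v'\<in>B. \<Sum>i<j. g j i v v')"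
          by (intro sum.cong refl) blast
        also have "\<dots> = (\<Sum>v\<in>B. \<Sum>v'\<in>B. \<Sum>j<m. \<Sum>i<j. g j i v v')"
          by (subst sum.swap, rule sum.cong[OF refl], rule sum.swap)
        finally show ?thesis .
      qed
      then show ?thesis unfolding slope_coeff_def sum_distrib_right .
    qed
    \<comment> \<open>Exchanging \<open>v\<close> and \<open>v'\<close> leaves the double sum
      unchanged, so the coefficient may be symmetrised, which is the form that
      \<open>exp_slope_series\<close> sums.\<close>
    also have "\<dots> = ((\<Sum>v\<in>B. \<Sum>v'\<in>B. ?s v v') + (\<Sum>v\<in>B. \<Sum>v'\<in>B. ?s v' v)) / 2"
      unfolding sum.swap[of "\<lambda>v v'. ?s v' v" B B] by simp
    also have "\<dots> = (\<Sum>v\<in>B. \<Sum>v'\<in>B. (?s v v' + ?s v' v) / 2)"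
      by (simp add: sum.distrib sum_divide_distrib add_divide_distrib)
    also have "\<dots> = slope_sum m B l w"
      by (intro sum.cong refl) (simp add: field_simps)
    finally show ?thesis .
  qed
  ultimately show ?thesis by blast
qed

lemma rank_one_coeff_sums:
  "(\<lambda>m. (\<Sum>v\<in>B. of_nat m * l v ^ (m - 1) * (v \<bullet> w)\<^sup>2) / fact m) sums (\<Sum>v\<in>B. exp (l v) * (v \<bullet> w)\<^sup>2)"
  "(\<lambda>m. slope_sum m B l w / fact m) sums rank_one_hessian B l w"
proof -
  note exp_series_shifted
  then have "(\<lambda>m. \<Sum>v\<in>B. (of_nat m * l v ^ (m - 1) / fact m) * (v \<bullet> w)\<^sup>2) sums
    (\<Sum>v\<in>B. exp (l v) * (v \<bullet> w)\<^sup>2)"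
    by (intro sums_sum sums_mult2)
  then show "(\<lambda>m. (\<Sum>v\<in>B. of_nat m * l v ^ (m - 1) * (v \<bullet> w)\<^sup>2) / fact m) sums (\<Sum>v\<in>B. exp (l v) * (v \<bullet> w)\<^sup>2)"
    by (simp add: sum_divide_distrib)
  let ?k = "\<lambda>m v v'. (slope_coeff m (l v) (l v') + slope_coeff m (l v') (l v)) / 2 * ((v \<bullet> w)\<^sup>2 * (v' \<bullet> w)\<^sup>2)"
  have "(\<lambda>m. \<Sum>v\<in>B. \<Sum>v'\<in>B. ((slope_coeff m (l v) (l v') + slope_coeff m (l v') (l v)) / fact m) / 2
        * ((v \<bullet> w)\<^sup>2 * (v' \<bullet> w)\<^sup>2)) sums rank_one_hessian B l w"
    unfolding rank_one_hessian_def
    by (intro sums_sum sums_mult2 sums_divide exp_slope_series)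
  moreover have "(\<Sum>v\<in>B. \<Sum>v'\<in>B. ((slope_coeff m (l v) (l v') + slope_coeff m (l v') (l v)) / fact m) / 2
        * ((v \<bullet> w)\<^sup>2 * (v' \<bullet> w)\<^sup>2)) = (\<Sum>v\<in>B. \<Sum>v'\<in>B. ?k m v v') / fact m" for m
    by (simp only: sum_divide_distrib) (intro sum.cong refl, simp)
  ultimately show "(\<lambda>m. (\<Sum>v\<in>B. \<Sum>v'\<in>B. ?k m v v') / fact m) sums rank_one_hessian B l w"
    by (simp only:)
qed

end

text \<open>The polynomial expansion above assumes nonnegative eigenvalues. A multiple of the
  identity provides them and only multiplies \<open>tr_exp\<close> and
  \<open>rank_one_hessian\<close> by \<open>exp c\<close>.\<close>

lemma symmetric_shift_eigenvalues_nonneg: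
  fixes A :: "real^'n^'n"
  assumes "transpose A = A"
  obtains c B l where "eigenbasis (A + c *\<^sub>R mat 1) B l" "\<And>v. v \<in> B \<Longrightarrow> 0 \<le> l v" "0 \<le> c"
proof -
  obtain B l where eb: "eigenbasis A B l" using symmetric_eigenbasis_exists[OF assms] by blast
  define c where "c = (\<Sum>v\<in>B. \<bar>l v\<bar>)"
  have "\<bar>l v\<bar> \<le> c" if "v \<in> B" for v
    unfolding c_def using that eigenbasis_finite[OF eb] by (intro member_le_sum) auto
  then have "0 \<le> l v + c" if "v \<in> B" for v using that by fastforce
  moreover have "0 \<le> c" by (simp add: c_def sum_nonneg)
  ultimately show ?thesis using that eigenbasis_shift[OF eb] by blast
qed

lemma eigenbasis_nonneg_iff:
  assumes "eigenbasis A B l"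
  shows "(\<forall>v\<in>B. 0 \<le> l v) \<longleftrightarrow> (\<forall>x. 0 \<le> x \<bullet> (A *v x))"
  using eigenbasis_eigenvalue[OF assms] eigenbasis_quadratic[OF assms]
  by (auto intro!: sum_nonneg)

lemma rank_one_hessian_shift:
  "rank_one_hessian B (\<lambda>v. l v + c) w = exp c * rank_one_hessian B l w"
proof -
  have "exp_slope (x + c) (y + c) = exp c * exp_slope x y" for x y
    by (simp add: exp_slope_def exp_add right_diff_distrib mult.commute)
  then show ?thesis by (simp add: rank_one_hessian_def sum_distrib_left mult_ac)
qed

text \<open>The line from \<open>A - t *\<^sub>R outer_prod w\<close> to \<open>A\<close> is
  expanded at its lower end, shifted to be positive semidefinite, where all coefficients are
  nonnegative. The backward Taylor inequality then uses the derivatives at the upper end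
  \<open>A\<close>. It is summed over all powers.\<close>

lemma tr_exp_rank_one_downdate:
  fixes A :: "real^'n^'n"
  assumes eb: "eigenbasis A B l" and sym: "transpose A = A" and "0 \<le> t"
  shows "tr_exp (A - t *\<^sub>R outer_prod w)
      \<le> tr_exp A - t * (\<Sum>v\<in>B. exp (l v) * (v \<bullet> w)\<^sup>2) + t\<^sup>2 * rank_one_hessian B l w"
    and "tr_exp (A - t *\<^sub>R outer_prod w) \<le> tr_exp A"
proof -
  let ?P = "outer_prod w"
  have sym0: "transpose (A - t *\<^sub>R ?P) = A - t *\<^sub>R ?P" using sym by (simp add: transpose_simps)
  then obtain c B' l' where eb': "eigenbasis (A - t *\<^sub>R ?P + c *\<^sub>R mat 1) B' l'"
    and l': "\<And>v. v \<in> B' \<Longrightarrow> 0 \<le> l' v"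
    using symmetric_shift_eigenvalues_nonneg by metis
  define A1 where "A1 = A + c *\<^sub>R mat 1"
  define A0 where "A0 = A - t *\<^sub>R ?P + c *\<^sub>R mat 1"
  have A01: "A1 = A0 + t *\<^sub>R ?P" by (simp add: A1_def A0_def)
  have eb1: "eigenbasis A1 B (\<lambda>v. l v + c)" unfolding A1_def by (rule eigenbasis_shift[OF eb])
  have "0 \<le> x \<bullet> (A1 *v x)" for x
  proof -
    have "0 \<le> x \<bullet> (A0 *v x)"
      using eigenbasis_nonneg_iff[OF eb'] l' by (auto simp: A0_def)
    also have "\<dots> \<le> x \<bullet> (A1 *v x)"
      using \<open>0 \<le> t\<close>
      by (simp add: A01 matrix_vector_mult_add_rdistrib inner_add_right outer_prod_mult_vec
          scaleR_matrix_vector_assoc[symmetric] inner_commute mult.assoc)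
    finally show ?thesis .
  qed
  then have "\<forall>v\<in>B. 0 \<le> l v + c" by (simp only: eigenbasis_nonneg_iff[OF eb1] simp_thms)
  then have l1: "0 \<le> l v + c" if "v \<in> B" for v using that by (rule bspec)
  let ?c1 = "\<lambda>m. \<Sum>v\<in>B. of_nat m * (l v + c) ^ (m - 1) * (v \<bullet> w)\<^sup>2"
  let ?c2 = "\<lambda>m. slope_sum m B (\<lambda>v. l v + c) w"
  have step: "trace (mpow A0 m) \<le> trace (mpow A1 m) - t * ?c1 m + t\<^sup>2 * ?c2 m
      \<and> trace (mpow A0 m) \<le> trace (mpow A1 m)" for m
  proof -
    obtain p where "\<And>k. 0 \<le> coeff p k" and p: "\<And>s. trace (mpow (A1 + s *\<^sub>R ?P) m) = poly p s"
      "coeff p 0 = trace (mpow A1 m)" "coeff p 1 = ?c1 m" "coeff p 2 = ?c2 m"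
      using trace_mpow_rank_one_poly[OF eb1 l1, of w m] by blast
    obtain q where q: "\<And>k. 0 \<le> coeff q k" "\<And>s. trace (mpow (A0 + s *\<^sub>R ?P) m) = poly q s"
      using trace_mpow_rank_one_poly[OF eb'[folded A0_def] l', of w m] by blast
    have "poly p s = poly q (t + s)" for s
      using p(1)[of s] q(2)[of "t + s"] by (simp add: A01 scaleR_add_left add.assoc)
    \<comment> \<open>\<open>p\<close> and \<open>q\<close> parametrise the same line from its two
      ends, so the derivatives of \<open>q\<close> at \<open>t\<close> can be read off from the
      coefficients of \<open>p\<close>.\<close>
    then have pq: "p = pcompose q [:t, 1:]" by (simp add: poly_eq_poly_eq_iff[symmetric] poly_pcompose fun_eq_iff)
    have d1: "poly (pderiv q) t = coeff p 1"
    proof -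
      have "coeff p 1 = poly (pderiv p) 0" by (simp add: poly_0_coeff_0 coeff_pderiv)
      then show ?thesis by (simp add: pq pderiv_pcompose pderiv_pCons poly_pcompose)
    qed
    have d2: "poly (pderiv (pderiv q)) t = 2 * coeff p 2"
    proof -
      have "2 * coeff p 2 = poly (pderiv (pderiv p)) 0" by (simp add: poly_0_coeff_0 coeff_pderiv numeral_2_eq_2)
      then show ?thesis by (simp add: pq pderiv_pcompose pderiv_pCons poly_pcompose pderiv_mult)
    qed
    have "trace (mpow A1 m) = poly q t" using q(2)[of t] by (simp add: A01)
    moreover have "trace (mpow A0 m) = poly q 0" using q(2)[of 0] by simp
    ultimately show ?thesis
      using nonneg_coeffs_backward_taylor[OF q(1) \<open>0 \<le> t\<close>] poly_mono_nonneg_coeffs(2)[OF q(1) \<open>0 \<le> t\<close>]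
      unfolding d1 d2 p(3) p(4) by (simp add: poly_0_coeff_0)
  qed
  have sym0': "transpose A0 = A0" and sym1: "transpose A1 = A1"
    using sym by (simp_all add: A0_def A1_def transpose_simps)
  note s0 = tr_exp_sums[OF sym0'] and s1 = tr_exp_sums[OF sym1]
  note sc = rank_one_coeff_sums[OF eb1 l1, of w]
  have e0: "tr_exp A0 = exp c * tr_exp (A - t *\<^sub>R ?P)" unfolding A0_def by (rule tr_exp_shift[OF sym0])
  have e1: "tr_exp A1 = exp c * tr_exp A" unfolding A1_def by (rule tr_exp_shift[OF sym])
  have "tr_exp A0 \<le> tr_exp A1" using step by (intro sums_le[OF _ s0 s1]) (simp add: divide_right_mono)
  then show "tr_exp (A - t *\<^sub>R ?P) \<le> tr_exp A" unfolding e0 e1 by simp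
  have "(\<lambda>m. trace (mpow A1 m) / fact m - t * (?c1 m / fact m) + t\<^sup>2 * (?c2 m / fact m)) sums
     (tr_exp A1 - t * (\<Sum>v\<in>B. exp (l v + c) * (v \<bullet> w)\<^sup>2) + t\<^sup>2 * rank_one_hessian B (\<lambda>v. l v + c) w)"
    by (intro sums_add sums_diff sums_mult s1 sc)
  moreover have "trace (mpow A0 m) / fact m \<le> trace (mpow A1 m) / fact m - t * (?c1 m / fact m) + t\<^sup>2 * (?c2 m / fact m)" for m
    using divide_right_mono[OF conjunct1[OF step[of m]], of "fact m"]
    by (simp add: add_divide_distrib diff_divide_distrib)
  ultimately have "tr_exp A0 \<le> tr_exp A1 - t * (\<Sum>v\<in>B. exp (l v + c) * (v \<bullet> w)\<^sup>2) + t\<^sup>2 * rank_one_hessian B (\<lambda>v. l v + c) w"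
    by (intro sums_le[OF _ s0])
  also have "\<dots> = exp c * (tr_exp A - t * (\<Sum>v\<in>B. exp (l v) * (v \<bullet> w)\<^sup>2) + t\<^sup>2 * rank_one_hessian B l w)"
    unfolding e1 rank_one_hessian_shift exp_add
    by (simp add: right_diff_distrib distrib_left sum_distrib_left mult_ac)
  finally show "tr_exp (A - t *\<^sub>R ?P) \<le> tr_exp A - t * (\<Sum>v\<in>B. exp (l v) * (v \<bullet> w)\<^sup>2) + t\<^sup>2 * rank_one_hessian B l w"
    unfolding e0 by simp
qed

text \<open>Here the centre \<open>A\<close> of the line is shifted: positivity of the coefficients
  there is enough, as the polynomial identity holds for parameters of either sign.\<close>

lemma tr_exp_rank_one_even:
  fixes A :: "real^'n^'n"
  assumes eb: "eigenbasis A B l" and sym: "transpose A = A"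
  shows "2 * tr_exp A + 2 * t\<^sup>2 * rank_one_hessian B l w
      \<le> tr_exp (A + t *\<^sub>R outer_prod w) + tr_exp (A - t *\<^sub>R outer_prod w)"
proof -
  let ?P = "outer_prod w"
  define c where "c = (\<Sum>v\<in>B. \<bar>l v\<bar>)"
  have "\<bar>l v\<bar> \<le> c" if "v \<in> B" for v
    unfolding c_def using that eigenbasis_finite[OF eb] by (intro member_le_sum) auto
  then have l1: "0 \<le> l v + c" if "v \<in> B" for v using that by fastforce
  define A1 where "A1 = A + c *\<^sub>R mat 1"
  have eb1: "eigenbasis A1 B (\<lambda>v. l v + c)" unfolding A1_def by (rule eigenbasis_shift[OF eb])
  let ?c2 = "\<lambda>m. slope_sum m B (\<lambda>v. l v + c) w"
  have step: "2 * trace (mpow A1 m) + 2 * t\<^sup>2 * ?c2 m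
      \<le> trace (mpow (A1 + t *\<^sub>R ?P) m) + trace (mpow (A1 - t *\<^sub>R ?P) m)" for m
  proof -
    obtain p where p: "\<And>k. 0 \<le> coeff p k" "\<And>s. trace (mpow (A1 + s *\<^sub>R ?P) m) = poly p s"
      "coeff p 0 = trace (mpow A1 m)"
      "coeff p 1 = (\<Sum>v\<in>B. of_nat m * (l v + c) ^ (m - 1) * (v \<bullet> w)\<^sup>2)" "coeff p 2 = ?c2 m"
      using trace_mpow_rank_one_poly[OF eb1 l1, of w m] by blast
    show ?thesis using nonneg_coeffs_even_part[OF p(1), of t] p(2)[of t] p(2)[of "-t"] p(3,5) by simp
  qed
  have syms: "transpose A1 = A1" "transpose (A1 + t *\<^sub>R ?P) = A1 + t *\<^sub>R ?P" "transpose (A1 - t *\<^sub>R ?P) = A1 - t *\<^sub>R ?P"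
    "transpose (A + t *\<^sub>R ?P) = A + t *\<^sub>R ?P" "transpose (A - t *\<^sub>R ?P) = A - t *\<^sub>R ?P"
    using sym by (simp_all add: A1_def transpose_simps)
  have eqs: "A1 + t *\<^sub>R ?P = A + t *\<^sub>R ?P + c *\<^sub>R mat 1" "A1 - t *\<^sub>R ?P = A - t *\<^sub>R ?P + c *\<^sub>R mat 1"
    by (simp_all add: A1_def)
  have "(\<lambda>m. 2 * (trace (mpow A1 m) / fact m) + 2 * t\<^sup>2 * (?c2 m / fact m)) sums
      (2 * tr_exp A1 + 2 * t\<^sup>2 * rank_one_hessian B (\<lambda>v. l v + c) w)"
    by (intro sums_add sums_mult tr_exp_sums syms rank_one_coeff_sums(2)[OF eb1 l1, of w])
  moreover have "(\<lambda>m. trace (mpow (A1 + t *\<^sub>R ?P) m) / fact m + trace (mpow (A1 - t *\<^sub>R ?P) m) / fact m) sums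
     (tr_exp (A1 + t *\<^sub>R ?P) + tr_exp (A1 - t *\<^sub>R ?P))"
    by (intro sums_add tr_exp_sums syms)
  ultimately have "2 * tr_exp A1 + 2 * t\<^sup>2 * rank_one_hessian B (\<lambda>v. l v + c) w
     \<le> tr_exp (A1 + t *\<^sub>R ?P) + tr_exp (A1 - t *\<^sub>R ?P)"
  proof (rule sums_le[rotated])
    fix m
    show "2 * (trace (mpow A1 m) / fact m) + 2 * t\<^sup>2 * (?c2 m / fact m)
      \<le> trace (mpow (A1 + t *\<^sub>R ?P) m) / fact m + trace (mpow (A1 - t *\<^sub>R ?P) m) / fact m"
      using divide_right_mono[OF step[of m], of "fact m"] by (simp add: add_divide_distrib)
  qed
  then have "exp c * (2 * tr_exp A + 2 * t\<^sup>2 * rank_one_hessian B l w)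
     \<le> exp c * (tr_exp (A + t *\<^sub>R ?P) + tr_exp (A - t *\<^sub>R ?P))"
    unfolding eqs tr_exp_shift[OF syms(4)] tr_exp_shift[OF syms(5)] rank_one_hessian_shift
    unfolding A1_def tr_exp_shift[OF sym] by (simp add: algebra_simps)
  then show ?thesis by simp
qed

section \<open>The smallest eigenvalue and the trace exponential\<close>

lemma tr_exp_ge_exp_eigenvalue:
  assumes sym: "transpose A = A" and "c \<in> real_eigenvalues A"
  shows "exp c \<le> tr_exp A"
proof -
  obtain B l where eb: "eigenbasis A B l" using symmetric_eigenbasis_exists[OF sym] by blast
  then obtain v where v: "v \<in> B" "c = l v" using assms eigenbasis_real_eigenvalues[OF eb] by auto
  have "exp (l v) \<le> (\<Sum>v\<in>B. exp (l v))"
    using v eigenbasis_finite[OF eb] by (intro member_le_sum) auto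
  then show ?thesis using v by (simp add: tr_exp_eigenbasis[OF eb])
qed

text \<open>Makes the event in the theorem a countable union of measurable sets. If all eigenvalues
  exceed \<open>c\<close>, the trace tends to 0 as \<open>k\<close> grows; an eigenvalue at most
  \<open>c\<close> alone contributes at least 1.\<close>

lemma lambda_min_gt_iff_tr_exp:
  fixes K :: "real^'n^'n"
  assumes sym: "transpose K = K"
  shows "c < lambda_min K \<longleftrightarrow> (\<exists>k::nat. tr_exp (real k *\<^sub>R (c *\<^sub>R mat 1 - K)) < 1)"
proof -
  obtain B l where eb: "eigenbasis K B l" using symmetric_eigenbasis_exists[OF sym] by blast
  have fin: "finite B" "B \<noteq> {}" using eigenbasis_finite[OF eb] eigenbasis_nonempty[OF eb] by auto
  have min: "c < lambda_min K \<longleftrightarrow> (\<forall>v\<in>B. c < l v)"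
    unfolding lambda_min_def eigenbasis_real_eigenvalues[OF eb] using fin by simp
  have "eigenbasis (real k *\<^sub>R (c *\<^sub>R mat 1 - K)) B (\<lambda>v. real k * ((-1) * l v + c))" for k
    using eigenbasis_scale[OF eigenbasis_shift[OF eigenbasis_scale[OF eb, of "-1"], of c], of "real k"]
    by simp
  then have te: "tr_exp (real k *\<^sub>R (c *\<^sub>R mat 1 - K)) = (\<Sum>v\<in>B. exp (real k * (c - l v)))" for k
    by (subst tr_exp_eigenbasis) auto
  show ?thesis unfolding te min
  proof
    assume *: "\<forall>v\<in>B. c < l v"
    have "(\<lambda>k. exp (real k * (c - l v))) \<longlonglongrightarrow> 0" if "v \<in> B" for v
    proof -
      have "(\<lambda>k. exp (c - l v) ^ k) \<longlonglongrightarrow> 0" using * that by (intro LIMSEQ_realpow_zero) auto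
      then show ?thesis by (simp add: exp_of_nat_mult)
    qed
    then have "(\<lambda>k. \<Sum>v\<in>B. exp (real k * (c - l v))) \<longlonglongrightarrow> (\<Sum>v\<in>B. 0)" by (intro tendsto_sum)
    then have "\<forall>\<^sub>F k in sequentially. (\<Sum>v\<in>B. exp (real k * (c - l v))) < 1"
      by (intro order_tendstoD) auto
    then show "\<exists>k::nat. (\<Sum>v\<in>B. exp (real k * (c - l v))) < 1" by (auto simp: eventually_sequentially)
  next
    assume "\<exists>k::nat. (\<Sum>v\<in>B. exp (real k * (c - l v))) < 1"
    then obtain k :: nat where k: "(\<Sum>v\<in>B. exp (real k * (c - l v))) < 1" ..
    show "\<forall>v\<in>B. c < l v"
    proof
      fix v assume v: "v \<in> B"
      have "exp (real k * (c - l v)) \<le> (\<Sum>v\<in>B. exp (real k * (c - l v)))"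
        using v fin by (intro member_le_sum) auto
      with k have "real k * (c - l v) < 0" by (metis exp_less_one_iff le_less_trans)
      then show "c < l v" by (simp add: mult_less_0_iff)
    qed
  qed
qed

lemma lambda_min_le_imp_tr_exp_ge:
  fixes K :: "real^'n^'n"
  assumes sym: "transpose K = K" and "lambda_min K \<le> c" "0 \<le> s"
  shows "exp (- (s * c)) \<le> tr_exp ((- s) *\<^sub>R K)"
proof -
  obtain B l where eb: "eigenbasis K B l" using symmetric_eigenbasis_exists[OF sym] by blast
  have "lambda_min K \<in> l ` B"
    unfolding lambda_min_def eigenbasis_real_eigenvalues[OF eb]
    using eigenbasis_finite[OF eb] eigenbasis_nonempty[OF eb] by (intro Min_in) auto
  then have "(- s) * lambda_min K \<in> real_eigenvalues ((- s) *\<^sub>R K)"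
    unfolding eigenbasis_real_eigenvalues[OF eigenbasis_scale[OF eb]] by auto
  then have "exp ((- s) * lambda_min K) \<le> tr_exp ((- s) *\<^sub>R K)"
    by (intro tr_exp_ge_exp_eigenvalue) (simp_all only: transpose_scaleR_matrix sym)
  moreover have "exp (- (s * c)) \<le> exp ((- s) * lambda_min K)" using assms by (simp add: mult_left_mono)
  ultimately show ?thesis by linarith
qed

subsection \<open>Fourth moments and isotropic laws\<close>

definition sign_vecs :: "(real^'n) set" where
  "sign_vecs = {y. \<forall>i. y $ i \<in> {-1, 1}}"

lemma finite_sign_vecs: "finite (sign_vecs :: (real^'n) set)"
proof -
  have "sign_vecs \<subseteq> vec_lambda ` (PiE UNIV (\<lambda>_::'n. {-1, 1 :: real}))"
  proof
    fix y :: "real^'n" assume "y \<in> sign_vecs"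
    then have "y = vec_lambda (\<lambda>i. y $ i)" "(\<lambda>i. y $ i) \<in> PiE UNIV (\<lambda>_::'n. {-1, 1 :: real})"
      by (auto simp: sign_vecs_def)
    then show "y \<in> vec_lambda ` (PiE UNIV (\<lambda>_::'n. {-1, 1 :: real}))" by blast
  qed
  then show ?thesis by (rule finite_subset) (intro finite_imageI finite_PiE, auto)
qed

lemma card_sign_vecs_pos: "0 < card (sign_vecs :: (real^'n) set)"
proof -
  have "((\<chi> i. 1) :: real^'n) \<in> sign_vecs" by (simp add: sign_vecs_def)
  then show ?thesis using finite_sign_vecs card_gt_0_iff by blast
qed

lemma sign_vecs_square: "y \<in> sign_vecs \<Longrightarrow> y $ i * y $ i = 1"
  by (auto simp: sign_vecs_def dest: spec[of _ i])

text \<open>Expectation over independent fair signs, kept as a finite average so that it exchanges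
  freely with sums and integrals.\<close>

definition sign_avg :: "(real^'n \<Rightarrow> real) \<Rightarrow> real" where
  "sign_avg f = (\<Sum>y\<in>sign_vecs. f y) / real (card (sign_vecs :: (real^'n) set))"

lemma sign_avg_mono: "(\<And>y. y \<in> sign_vecs \<Longrightarrow> f y \<le> g y) \<Longrightarrow> sign_avg f \<le> sign_avg g"
  unfolding sign_avg_def by (intro divide_right_mono sum_mono) auto

lemma sign_avg_cong: "(\<And>y. y \<in> sign_vecs \<Longrightarrow> f y = g y) \<Longrightarrow> sign_avg f = sign_avg g"
  unfolding sign_avg_def by (intro arg_cong2[where f = "(/)"] sum.cong) auto

lemma sign_avg_add: "sign_avg (\<lambda>y. f y + g y) = sign_avg f + sign_avg g"
  and sign_avg_cmult: "sign_avg (\<lambda>y. c * f y) = c * sign_avg f"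
  by (simp_all add: sign_avg_def sum.distrib add_divide_distrib sum_distrib_left)

lemma sign_avg_sum: "sign_avg (\<lambda>y. \<Sum>i\<in>I. f i y) = (\<Sum>i\<in>I. sign_avg (f i))"
  unfolding sign_avg_def by (subst sum.swap) (simp add: sum_divide_distrib)

lemma sign_avg_const: "sign_avg (\<lambda>y :: real^'n. c) = c"
  using card_sign_vecs_pos[where 'n = 'n] by (simp add: sign_avg_def)

text \<open>Flipping coordinate \<open>j\<close> permutes the sign vectors and negates every
  summand.\<close>

lemma sign_avg_odd:
  fixes f :: "real^'n \<Rightarrow> real"
  assumes f: "\<And>y. f (\<chi> k. if k = j then - (y $ j) else y $ k) = f y"
  shows "sign_avg (\<lambda>y. y $ j * f y) = 0"
proof -
  define r where "r y = (\<chi> k. if k = j then - (y $ j) else y $ k)" for y :: "real^'n"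
  have rr: "r (r y) = y" for y by (simp add: r_def vec_eq_iff)
  have rs: "r y \<in> sign_vecs" if "y \<in> sign_vecs" for y
    using that by (auto simp: r_def sign_vecs_def)
  have "(\<Sum>y\<in>sign_vecs. y $ j * f y) = (\<Sum>y\<in>sign_vecs. r y $ j * f (r y))"
    by (rule sum.reindex_bij_witness[of _ r r]) (auto simp: rr rs)
  also have "\<dots> = - (\<Sum>y\<in>sign_vecs. y $ j * f y)"
    using f by (simp add: sum_negf r_def)
  finally show ?thesis by (simp add: sign_avg_def)
qed

lemma sign_avg_pair: "sign_avg (\<lambda>y :: real^'n. y $ j * y $ k) = (if j = k then 1 else 0)"
proof (cases "j = k")
  case True
  have "sign_avg (\<lambda>y :: real^'n. y $ j * y $ k) = sign_avg (\<lambda>y :: real^'n. 1)"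
    using True by (intro sign_avg_cong) (auto simp: sign_vecs_def dest: spec[of _ k])
  then show ?thesis using True by (simp add: sign_avg_const)
next
  case False
  then show ?thesis using sign_avg_odd[of "\<lambda>y. y $ k" j] by simp
qed

text \<open>The mean of \<open>(x \<bullet> w)\<^sup>2 * (z \<bullet> w)\<^sup>2\<close> when
  \<open>w\<close> has independent centred coordinates of variance 1 and fourth moment
  \<open>\<mu>\<close>: three Wick pairings plus the deviation from the Gaussian value 3.
  \<open>moment_tensor\<close> is the same in coordinates.\<close>

definition quartic_moment :: "real \<Rightarrow> real^'n \<Rightarrow> real^'n \<Rightarrow> real" where
  "quartic_moment \<mu> x z = (x \<bullet> x) * (z \<bullet> z) + 2 * (x \<bullet> z)\<^sup>2 + (\<mu> - 3) * (\<Sum>j\<in>UNIV. (x $ j)\<^sup>2 * (z $ j)\<^sup>2)"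

definition moment_tensor :: "real \<Rightarrow> 'n \<Rightarrow> 'n \<Rightarrow> 'n \<Rightarrow> 'n \<Rightarrow> real" where
  "moment_tensor \<mu> j k l m = (if j = k \<and> l = m then 1 else 0) + (if j = l \<and> k = m then 1 else 0)
     + (if j = m \<and> k = l then 1 else 0) + (\<mu> - 3) * (if j = k \<and> j = l \<and> j = m then 1 else 0)"

text \<open>The three exchange rules generate all permutations of the indices. Among four indices,
  one occurs alone, or they form two pairs, or all agree. Applied both to sign vectors and to a
  sparse row.\<close>

lemma fourth_moment_tensor:
  fixes E :: "'n \<Rightarrow> 'n \<Rightarrow> 'n \<Rightarrow> 'n \<Rightarrow> real"
  assumes sym: "\<And>j k l m. E j k l m = E k j l m" "\<And>j k l m. E j k l m = E j l k m"
      "\<And>j k l m. E j k l m = E j k m l"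
    and single: "\<And>j k l m. j \<notin> {k, l, m} \<Longrightarrow> E j k l m = 0"
    and pair: "\<And>j k. j \<noteq> k \<Longrightarrow> E j j k k = 1" and four: "\<And>j. E j j j j = \<mu>"
  shows "E j k l m = moment_tensor \<mu> j k l m"
proof -
  consider "j = k" "j = l" "j = m" | "j = k" "l = m" "j \<noteq> l" | "j = l" "k = m" "j \<noteq> k"
    | "j = m" "k = l" "j \<noteq> k" | "j \<notin> {k, l, m}" | "k \<notin> {j, l, m}" | "l \<notin> {j, k, m}" | "m \<notin> {j, k, l}"
    by auto
  then show ?thesis
  proof cases
    case 1 then show ?thesis by (simp add: four moment_tensor_def)
  next
    case 2 then show ?thesis by (simp add: pair moment_tensor_def)
  next
    case 3 then show ?thesis using sym(2)[of j k j k] by (simp add: pair moment_tensor_def)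
  next
    case 4
    have "E j k k j = E j j k k" using sym(3)[of j k k j] sym(2)[of j k j k] by simp
    then show ?thesis using 4 by (simp add: pair moment_tensor_def)
  next
    case 5 then show ?thesis by (auto simp: single moment_tensor_def)
  next
    case 6
    have "E j k l m = 0" using single[OF 6] sym(1)[of j k l m] by simp
    then show ?thesis using 6 by (auto simp: moment_tensor_def)
  next
    case 7
    have "E j k l m = 0" using single[OF 7] sym(2)[of j k l m] sym(1)[of j l k m] by simp
    then show ?thesis using 7 by (auto simp: moment_tensor_def)
  next
    case 8
    have "E j k l m = 0" using single[OF 8] sym(3)[of j k l m] sym(2)[of j k m l] sym(1)[of j m k l] by simp
    then show ?thesis using 8 by (auto simp: moment_tensor_def)
  qed
qed

lemma quartic_moment_expand:
  fixes E :: "'n::finite \<Rightarrow> 'n \<Rightarrow> 'n \<Rightarrow> 'n \<Rightarrow> real"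
  assumes E: "\<And>j k l m. E j k l m = moment_tensor \<mu> j k l m"
  shows "(\<Sum>j\<in>UNIV. \<Sum>k\<in>UNIV. \<Sum>l\<in>UNIV. \<Sum>m\<in>UNIV. (x $ j * x $ k * z $ l * z $ m) * E j k l m) = quartic_moment \<mu> x z"
proof -
  let ?S = "\<lambda>f. \<Sum>j\<in>UNIV. \<Sum>k\<in>UNIV. \<Sum>l\<in>UNIV. \<Sum>m\<in>UNIV. (x $ j * x $ k * z $ l * z $ m) * (f j k l m :: real)"
  have s1: "?S (\<lambda>j k l m. if j = k \<and> l = m then 1 else 0) = (x \<bullet> x) * (z \<bullet> z)"
  proof -
    have "(\<Sum>m\<in>UNIV. (x $ j * x $ k * z $ l * z $ m) * (if j = k \<and> l = m then 1 else 0))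
      = (if j = k then x $ j * x $ k * z $ l * z $ l else 0)" for j k l by (simp add: if_distrib cong: if_cong)
    moreover have "(\<Sum>l\<in>UNIV. if j = k then x $ j * x $ k * z $ l * z $ l else 0) = (if j = k then x $ j * x $ k * (z \<bullet> z) else 0)" for j k
      by (simp add: inner_vec_def sum_distrib_left mult_ac)
    ultimately show ?thesis by (simp add: inner_vec_def sum_distrib_right)
  qed
  have s2: "?S (\<lambda>j k l m. if j = l \<and> k = m then 1 else 0) = (x \<bullet> z)\<^sup>2"
  proof -
    have "(\<Sum>m\<in>UNIV. (x $ j * x $ k * z $ l * z $ m) * (if j = l \<and> k = m then 1 else 0))
      = (if j = l then x $ j * x $ k * z $ l * z $ k else 0)" for j k l by (simp add: if_distrib cong: if_cong)
    then show ?thesis by (simp add: inner_vec_def power2_eq_square sum_product mult_ac)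
  qed
  have s3: "?S (\<lambda>j k l m. if j = m \<and> k = l then 1 else 0) = (x \<bullet> z)\<^sup>2"
  proof -
    have "(\<Sum>m\<in>UNIV. (x $ j * x $ k * z $ l * z $ m) * (if j = m \<and> k = l then 1 else 0))
      = (if k = l then x $ j * x $ k * z $ l * z $ j else 0)" for j k l by (simp add: if_distrib cong: if_cong)
    then show ?thesis by (simp add: inner_vec_def power2_eq_square sum_product mult_ac)
  qed
  have s4: "?S (\<lambda>j k l m. if j = k \<and> j = l \<and> j = m then 1 else 0) = (\<Sum>j\<in>UNIV. (x $ j)\<^sup>2 * (z $ j)\<^sup>2)"
  proof -
    have "(\<Sum>m\<in>UNIV. (x $ j * x $ k * z $ l * z $ m) * (if j = k \<and> j = l \<and> j = m then 1 else 0))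
      = (if j = l then if j = k then x $ j * x $ k * z $ l * z $ j else 0 else 0)" for j k l
      by (cases "j = l"; cases "j = k") (auto simp: if_distrib cong: if_cong)
    then show ?thesis by (simp add: power2_eq_square mult_ac)
  qed
  have "?S E = ?S (\<lambda>j k l m. if j = k \<and> l = m then 1 else 0) + ?S (\<lambda>j k l m. if j = l \<and> k = m then 1 else 0)
    + ?S (\<lambda>j k l m. if j = m \<and> k = l then 1 else 0) + (\<mu> - 3) * ?S (\<lambda>j k l m. if j = k \<and> j = l \<and> j = m then 1 else 0)"
    unfolding sum_distrib_left sum.distrib[symmetric] E moment_tensor_def
    by (intro sum.cong refl) (simp add: distrib_left)
  then show ?thesis unfolding s1 s2 s3 s4 by (simp add: quartic_moment_def)
qed

lemma inner_square_product_expand: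
  fixes x z w :: "real^'n"
  shows "(x \<bullet> w)\<^sup>2 * (z \<bullet> w)\<^sup>2 = (\<Sum>j\<in>UNIV. \<Sum>k\<in>UNIV. \<Sum>l\<in>UNIV. \<Sum>m\<in>UNIV.
     (x $ j * x $ k * z $ l * z $ m) * (w $ j * w $ k * w $ l * w $ m))"
proof -
  have 1: "(x \<bullet> w)\<^sup>2 = (\<Sum>j\<in>UNIV. \<Sum>k\<in>UNIV. (x $ j * x $ k) * (w $ j * w $ k))" for x :: "real^'n"
    by (simp add: inner_vec_def power2_eq_square sum_product mult_ac)
  show ?thesis unfolding 1 sum_distrib_right unfolding sum_distrib_left
    by (intro sum.cong refl) (simp only: mult_ac)
qed

lemma sign_avg_quartic: "sign_avg (\<lambda>y. (x \<bullet> y)\<^sup>2 * (z \<bullet> y)\<^sup>2) = quartic_moment 1 x (z :: real^'n)"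
proof -
  let ?E = "\<lambda>j k l m. sign_avg (\<lambda>y :: real^'n. y $ j * y $ k * y $ l * y $ m)"
  have "?E j k l m = moment_tensor 1 j k l m" for j k l m
  proof (rule fourth_moment_tensor)
    fix j k l m :: 'n
    assume "j \<notin> {k, l, m}"
    then have "sign_avg (\<lambda>y :: real^'n. y $ j * (y $ k * (y $ l * y $ m))) = 0"
      by (intro sign_avg_odd) auto
    then show "?E j k l m = 0" by (simp only: mult.assoc)
  next
    fix j k :: 'n
    have "?E j j k k = sign_avg (\<lambda>y :: real^'n. 1)" for j k
      by (intro sign_avg_cong) (simp add: sign_vecs_square mult.assoc)
    then show "?E j j k k = 1" "?E j j j j = 1" by (simp_all add: sign_avg_const)
  qed (simp_all add: mult_ac)
  note E = quartic_moment_expand[OF this, of x z]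
  show ?thesis
    unfolding inner_square_product_expand sign_avg_sum sign_avg_cmult by (rule E)
qed

lemma sign_avg_inner_square: "sign_avg (\<lambda>y. (x \<bullet> y)\<^sup>2) = x \<bullet> (x :: real^'n)"
proof -
  have "(x \<bullet> y)\<^sup>2 = (\<Sum>j\<in>UNIV. \<Sum>k\<in>UNIV. (x $ j * x $ k) * (y $ j * y $ k))" for y :: "real^'n"
    by (simp add: inner_vec_def power2_eq_square sum_product mult_ac)
  then show ?thesis
    by (simp add: sign_avg_sum sign_avg_cmult sign_avg_pair inner_vec_def if_distrib cong: if_cong)
qed

lemma quartic_moment_nonneg: "1 \<le> \<mu> \<Longrightarrow> 0 \<le> quartic_moment \<mu> x (z :: real^'n)"
proof -
  assume "1 \<le> \<mu>"
  have "0 \<le> sign_avg (\<lambda>y. (x \<bullet> y)\<^sup>2 * (z \<bullet> y)\<^sup>2)"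
    using sign_avg_mono[of "\<lambda>_. 0" "\<lambda>y. (x \<bullet> y)\<^sup>2 * (z \<bullet> y)\<^sup>2"] by (simp add: sign_avg_const)
  then have "0 \<le> quartic_moment 1 x z" by (simp add: sign_avg_quartic)
  also have "\<dots> \<le> quartic_moment \<mu> x z"
    unfolding quartic_moment_def using \<open>1 \<le> \<mu>\<close> by (intro add_left_mono mult_right_mono sum_nonneg) auto
  finally show ?thesis .
qed

lemma quartic_moment_split:
  "quartic_moment \<mu> x z = quartic_moment 1 x z + (\<mu> - 1) * (\<Sum>j\<in>UNIV. (x \<bullet> axis j 1)\<^sup>2 * (z \<bullet> axis j 1)\<^sup>2)"
  by (simp add: quartic_moment_def inner_axis algebra_simps)

text \<open>\<open>exp_slope x y\<close> is the mean of exp between \<open>x\<close> and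
  \<open>y\<close>, and convexity bounds this mean by the trapezoid value. Factoring out
  \<open>exp y\<close> reduces it to the one-variable inequality \<open>*\<close>.\<close>

lemma exp_slope_le: "exp_slope x y \<le> (exp x + exp y) / 2"
proof -
  have *: "2 * (exp t - 1) \<le> t * (exp t + 1)" if "0 \<le> t" for t :: real
  proof -
    have "(\<lambda>t. t * (exp t + 1) - 2 * (exp t - 1)) 0 \<le> (\<lambda>t. t * (exp t + 1) - 2 * (exp t - 1)) t"
    proof (rule DERIV_nonneg_imp_nondecreasing[OF that])
      fix u :: real assume "0 \<le> u" "u \<le> t"
      have "exp u * (1 - u) \<le> exp u * exp (- u)"
        using exp_ge_add_one_self[of "-u"] by (intro mult_left_mono) auto
      then have "0 \<le> 1 * (exp u + 1) + u * exp u - 2 * exp u" by (simp add: exp_minus algebra_simps)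
      moreover have "((\<lambda>t. t * (exp t + 1) - 2 * (exp t - 1)) has_real_derivative
           1 * (exp u + 1) + u * exp u - 2 * exp u) (at u)"
        by (auto intro!: derivative_eq_intros simp: algebra_simps)
      ultimately show "\<exists>y. ((\<lambda>t. t * (exp t + 1) - 2 * (exp t - 1)) has_real_derivative y) (at u) \<and> 0 \<le> y"
        by blast
    qed
    then show ?thesis by simp
  qed
  have lt: "(exp x - exp y) / (x - y) \<le> (exp x + exp y) / 2" if "y < x" for x y :: real
  proof -
    have "exp y * (2 * (exp (x - y) - 1)) \<le> exp y * ((x - y) * (exp (x - y) + 1))"
      using that by (intro mult_left_mono *) auto
    moreover have "exp y * exp (x - y) = exp x" by (simp flip: exp_add)
    ultimately have "2 * (exp x - exp y) \<le> (x - y) * (exp x + exp y)" by (simp add: algebra_simps)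
    then show ?thesis using that by (simp add: divide_le_eq algebra_simps)
  qed
  show ?thesis
  proof (cases x y rule: linorder_cases)
    case less
    have "(exp x - exp y) / (x - y) = (exp y - exp x) / (y - x)"
      by (metis minus_diff_eq minus_divide_divide)
    then show ?thesis using lt[OF less] less by (simp add: exp_slope_def)
  qed (use lt in \<open>auto simp: exp_slope_def\<close>)
qed


section \<open>Measurability, jumps and moment assumptions\<close>

lemma borel_measurable_mpow_entry: "(\<lambda>A :: real^'n^'n. mpow A m $ i $ j) \<in> borel_measurable borel"
proof (induction m arbitrary: j)
  case (Suc m)
  have "(\<lambda>A :: real^'n^'n. A $ k $ j) \<in> borel_measurable borel" for k
    by (intro borel_measurable_continuous_onI continuous_intros)
  with Suc show ?case by (simp add: matrix_matrix_mult_def)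
qed simp

lemma borel_measurable_tr_exp [measurable]: "(tr_exp :: real^'n^'n \<Rightarrow> real) \<in> borel_measurable borel"
  unfolding tr_exp_def[abs_def] trace_def
  by (intro borel_measurable_suminf borel_measurable_divide borel_measurable_sum
      borel_measurable_mpow_entry borel_measurable_const)

lemma borel_measurable_outer_prod [measurable]: "(outer_prod :: real^'n \<Rightarrow> real^'n^'n) \<in> borel_measurable borel"
  unfolding outer_prod_def[abs_def]
  by (intro borel_measurable_continuous_onI continuous_intros)

text \<open>A sum of two averages, so constants are doubled; hence the coefficient
  \<open>1 - s - 2 * m\<close> that accompanies it. The sign of the jump is averaged separately
  because \<open>outer_prod y\<close> equals \<open>outer_prod (- y)\<close>.\<close>

definition jump_avg :: "real \<Rightarrow> real \<Rightarrow> (real^'n^'n \<Rightarrow> real) \<Rightarrow> real^'n^'n \<Rightarrow> real" where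
  "jump_avg h1 h2 f A = sign_avg (\<lambda>y. (f (A + h1 *\<^sub>R outer_prod y) + f (A - h1 *\<^sub>R outer_prod y)) / 2)
     + (\<Sum>j\<in>UNIV. (f (A + h2 *\<^sub>R outer_prod (axis j 1)) + f (A - h2 *\<^sub>R outer_prod (axis j 1))) / 2) / real CARD('n)"

text \<open>A second-order comparison sees only moments of order two and four, so these are all that
  is recorded about one summand; \<open>a\<close> is the fourth moment of a coordinate.\<close>

locale isotropic_law = prob_space P for P :: "(real^'n) measure" +
  fixes a :: real
  assumes sets_P [measurable_cong]: "sets P = sets borel"
    and a_ge_1: "1 \<le> a"
    and integrable_second: "\<And>j k. integrable P (\<lambda>w. w $ j * w $ k)"
    and second: "\<And>j k. (\<integral>w. w $ j * w $ k \<partial>P) = (if j = k then 1 else 0)"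
    and integrable_fourth: "\<And>j k l m. integrable P (\<lambda>w. w $ j * w $ k * w $ l * w $ m)"
    and fourth: "\<And>j k l m. (\<integral>w. w $ j * w $ k * w $ l * w $ m \<partial>P) =
       moment_tensor a j k l m"
begin

lemma has_bochner_integral_inner_square: "has_bochner_integral P (\<lambda>w. (x \<bullet> w)\<^sup>2) (x \<bullet> x)"
proof -
  have eq: "(x \<bullet> w)\<^sup>2 = (\<Sum>j\<in>UNIV. \<Sum>k\<in>UNIV. (x $ j * x $ k) * (w $ j * w $ k))" for w
    by (simp add: inner_vec_def power2_eq_square sum_product mult_ac)
  have "has_bochner_integral P (\<lambda>w. \<Sum>j\<in>UNIV. \<Sum>k\<in>UNIV. (x $ j * x $ k) * (w $ j * w $ k))
     (\<Sum>j\<in>UNIV. \<Sum>k\<in>UNIV. (x $ j * x $ k) * (if j = k then 1 else 0))"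
    by (intro has_bochner_integral_sum has_bochner_integral_mult_right)
      (simp add: has_bochner_integral_iff integrable_second second)
  moreover have "(\<Sum>j\<in>UNIV. \<Sum>k\<in>UNIV. (x $ j * x $ k) * (if j = k then 1 else 0)) = x \<bullet> x"
    by (simp add: inner_vec_def if_distrib cong: if_cong)
  ultimately show ?thesis unfolding eq by simp
qed

lemma has_bochner_integral_quartic:
  "has_bochner_integral P (\<lambda>w. (x \<bullet> w)\<^sup>2 * (z \<bullet> w)\<^sup>2) (quartic_moment a x z)"
  unfolding inner_square_product_expand quartic_moment_expand[OF fourth, symmetric]
  by (intro has_bochner_integral_sum has_bochner_integral_mult_right)
    (simp add: has_bochner_integral_iff integrable_fourth)

lemma has_bochner_integral_hessian:
  "has_bochner_integral P (rank_one_hessian B l)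
     (\<Sum>v\<in>B. \<Sum>v'\<in>B. exp_slope (l v) (l v') / 2 * quartic_moment a v v')"
  unfolding rank_one_hessian_def
  by (intro has_bochner_integral_sum has_bochner_integral_mult_right has_bochner_integral_quartic)

lemma expectation_hessian:
  "(\<integral>w. rank_one_hessian B l w \<partial>P)
     = sign_avg (rank_one_hessian B l) + (a - 1) * (\<Sum>j\<in>UNIV. rank_one_hessian B l (axis j 1))"
proof -
  have "(\<Sum>j\<in>UNIV. rank_one_hessian B l (axis j 1)) =
      (\<Sum>v\<in>B. \<Sum>v'\<in>B. exp_slope (l v) (l v') / 2 * (\<Sum>j\<in>UNIV. (v \<bullet> axis j 1)\<^sup>2 * (v' \<bullet> axis j 1)\<^sup>2))"
    unfolding rank_one_hessian_def sum_distrib_left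
    by (subst sum.swap, rule sum.cong[OF refl], rule sum.swap)
  moreover have "sign_avg (rank_one_hessian B l) = (\<Sum>v\<in>B. \<Sum>v'\<in>B. exp_slope (l v) (l v') / 2 * quartic_moment 1 v v')"
    unfolding rank_one_hessian_def[abs_def] sign_avg_sum sign_avg_cmult sign_avg_quartic ..
  ultimately show ?thesis
    unfolding has_bochner_integral_integral_eq[OF has_bochner_integral_hessian] quartic_moment_split[of a]
    by (simp add: distrib_left sum.distrib sum_distrib_left mult_ac)
qed

text \<open>Although \<open>w\<close> is unbounded, the integrand is bounded: subtracting a positive
  semidefinite matrix only lowers \<open>tr_exp\<close>.\<close>

lemma integrable_tr_exp:
  assumes "transpose A = A" "0 \<le> s"
  shows "integrable P (\<lambda>w. tr_exp (A - s *\<^sub>R outer_prod w))"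
proof (rule integrable_const_bound[where B = "tr_exp A"])
  obtain B l where eb: "eigenbasis A B l" using symmetric_eigenbasis_exists[OF assms(1)] by blast
  have "norm (tr_exp (A - s *\<^sub>R outer_prod w)) \<le> tr_exp A" for w
    using tr_exp_rank_one_downdate(2)[OF eb assms] tr_exp_pos[of "A - s *\<^sub>R outer_prod w"] assms
    by (simp add: transpose_simps less_imp_le)
  then show "AE w in P. norm (tr_exp (A - s *\<^sub>R outer_prod w)) \<le> tr_exp A" by simp
qed measurable

lemma expectation_tr_exp_le:
  assumes sym: "transpose A = A" and s: "0 \<le> s" and eb: "eigenbasis A B l"
  shows "(\<integral>w. tr_exp (A - s *\<^sub>R outer_prod w) \<partial>P)
     \<le> (1 - s) * tr_exp A + s\<^sup>2 * (\<integral>w. rank_one_hessian B l w \<partial>P)"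
proof -
  have 1: "has_bochner_integral P (\<lambda>w. \<Sum>v\<in>B. exp (l v) * (v \<bullet> w)\<^sup>2) (\<Sum>v\<in>B. exp (l v) * (v \<bullet> v))"
    by (intro has_bochner_integral_sum has_bochner_integral_mult_right has_bochner_integral_inner_square)
  have "(\<Sum>v\<in>B. exp (l v) * (v \<bullet> v)) = tr_exp A"
    unfolding tr_exp_eigenbasis[OF eb] by (intro sum.cong refl) (simp add: eigenbasis_inner_self[OF eb])
  with 1 have 1: "has_bochner_integral P (\<lambda>w. \<Sum>v\<in>B. exp (l v) * (v \<bullet> w)\<^sup>2) (tr_exp A)" by simp
  have 2: "has_bochner_integral P (rank_one_hessian B l) (\<integral>w. rank_one_hessian B l w \<partial>P)"
    using has_bochner_integral_hessian[of B l] by (simp add: has_bochner_integral_iff)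
  have 3: "has_bochner_integral P (\<lambda>w. tr_exp A - s * (\<Sum>v\<in>B. exp (l v) * (v \<bullet> w)\<^sup>2) + s\<^sup>2 * rank_one_hessian B l w)
     (tr_exp A - s * tr_exp A + s\<^sup>2 * (\<integral>w. rank_one_hessian B l w \<partial>P))"
    by (intro has_bochner_integral_add has_bochner_integral_diff has_bochner_integral_mult_right 1 2)
      (simp add: has_bochner_integral_iff prob_space)
  have "(\<integral>w. tr_exp (A - s *\<^sub>R outer_prod w) \<partial>P)
    \<le> (\<integral>w. tr_exp A - s * (\<Sum>v\<in>B. exp (l v) * (v \<bullet> w)\<^sup>2) + s\<^sup>2 * rank_one_hessian B l w \<partial>P)"
    using 3 by (intro integral_mono integrable_tr_exp sym s tr_exp_rank_one_downdate(1)[OF eb])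
      (auto simp: has_bochner_integral_iff)
  also have "\<dots> = (1 - s) * tr_exp A + s\<^sup>2 * (\<integral>w. rank_one_hessian B l w \<partial>P)"
    using 3 by (simp add: has_bochner_integral_iff algebra_simps)
  finally show ?thesis .
qed

text \<open>Replacing \<open>exp_slope\<close> by the average of two exponentials decouples the
  double sum. What remains is the mean of \<open>(w \<bullet> w) *\<^sub>R outer_prod w\<close>,
  which is \<open>d + a - 1\<close> times the identity.\<close>

lemma expectation_tr_exp_chernoff:
  assumes sym: "transpose A = A" and s: "0 \<le> s"
  shows "(\<integral>w. tr_exp (A - s *\<^sub>R outer_prod w) \<partial>P)
     \<le> (1 - s + s\<^sup>2 * (real CARD('n) + a - 1) / 2) * tr_exp A"
proof -
  obtain B l where eb: "eigenbasis A B l" using symmetric_eigenbasis_exists[OF sym] by blast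
  let ?Q = "quartic_moment a"
  have Qs: "?Q v v' = ?Q v' v" for v v' by (simp add: quartic_moment_def inner_commute mult.commute)
  \<comment> \<open>The three terms of \<open>quartic_moment\<close> contribute \<open>d\<close>, 2
    and \<open>a - 3\<close>.\<close>
  have Qsum: "(\<Sum>v'\<in>B. ?Q v v') = real CARD('n) + a - 1" if v: "v \<in> B" for v
  proof -
    have "(\<Sum>v'\<in>B. \<Sum>j\<in>UNIV. (v $ j)\<^sup>2 * (v' $ j)\<^sup>2) = (\<Sum>j\<in>UNIV. (v $ j)\<^sup>2 * (\<Sum>v'\<in>B. v' $ j * v' $ j))"
      by (subst sum.swap) (simp add: sum_distrib_left power2_eq_square)
    also have "\<dots> = v \<bullet> v" unfolding eigenbasis_mat_unit[OF eb] by (simp add: inner_vec_def power2_eq_square)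
    finally have 1: "(\<Sum>v'\<in>B. \<Sum>j\<in>UNIV. (v $ j)\<^sup>2 * (v' $ j)\<^sup>2) = 1" using v by (simp add: eigenbasis_inner_self[OF eb])
    have 2: "(\<Sum>v'\<in>B. (v \<bullet> v')\<^sup>2) = 1"
      using eigenbasis_parseval[OF eb, of v v] eigenbasis_inner_self[OF eb v] by (simp add: power2_eq_square inner_commute)
    have 3: "(\<Sum>v'\<in>B. (v \<bullet> v) * (v' \<bullet> v')) = real CARD('n)"
      using v eigenbasis_card[OF eb] eigenbasis_inner_self[OF eb] by simp
    show ?thesis
      unfolding quartic_moment_def sum.distrib sum_distrib_left[symmetric] 1 2
      using 3 by (simp add: sum_distrib_left)
  qed
  have "(\<integral>w. rank_one_hessian B l w \<partial>P) = (\<Sum>v\<in>B. \<Sum>v'\<in>B. exp_slope (l v) (l v') / 2 * ?Q v v')"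
    by (rule has_bochner_integral_integral_eq[OF has_bochner_integral_hessian])
  also have "\<dots> \<le> (\<Sum>v\<in>B. \<Sum>v'\<in>B. (exp (l v) + exp (l v')) / 4 * ?Q v v')"
  proof (intro sum_mono mult_right_mono quartic_moment_nonneg a_ge_1)
    fix v v' show "exp_slope (l v) (l v') / 2 \<le> (exp (l v) + exp (l v')) / 4"
      using exp_slope_le[of "l v" "l v'"] by simp
  qed
  also have "\<dots> = (\<Sum>v\<in>B. \<Sum>v'\<in>B. exp (l v) / 4 * ?Q v v') + (\<Sum>v\<in>B. \<Sum>v'\<in>B. exp (l v') / 4 * ?Q v v')"
    by (simp add: sum.distrib[symmetric] add_divide_distrib distrib_right)
  also have "(\<Sum>v\<in>B. \<Sum>v'\<in>B. exp (l v') / 4 * ?Q v v') = (\<Sum>v\<in>B. \<Sum>v'\<in>B. exp (l v) / 4 * ?Q v v')"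
    by (subst sum.swap) (simp only: Qs)
  also have "(\<Sum>v\<in>B. \<Sum>v'\<in>B. exp (l v) / 4 * ?Q v v') = (\<Sum>v\<in>B. exp (l v) / 4 * (real CARD('n) + a - 1))"
    unfolding sum_distrib_left[symmetric] by (intro sum.cong refl) (simp add: Qsum)
  also have "\<dots> = tr_exp A / 4 * (real CARD('n) + a - 1)"
    unfolding tr_exp_eigenbasis[OF eb] by (simp add: sum_distrib_right sum_divide_distrib)
  finally have "(\<integral>w. rank_one_hessian B l w \<partial>P) \<le> tr_exp A / 2 * (real CARD('n) + a - 1)" by simp
  then have "s\<^sup>2 * (\<integral>w. rank_one_hessian B l w \<partial>P) \<le> s\<^sup>2 * (tr_exp A / 2 * (real CARD('n) + a - 1))"
    by (intro mult_left_mono) auto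
  with expectation_tr_exp_le[OF sym s eb]
  have "(\<integral>w. tr_exp (A - s *\<^sub>R outer_prod w) \<partial>P) \<le> (1 - s) * tr_exp A + s\<^sup>2 * (tr_exp A / 2 * (real CARD('n) + a - 1))"
    by linarith
  also have "\<dots> = (1 - s + s\<^sup>2 * (real CARD('n) + a - 1) / 2) * tr_exp A" by (simp add: field_simps)
  finally show ?thesis .
qed

text \<open>The two averages in \<^const>\<open>jump_avg\<close> are jumps along rank-one directions whose second-order effect
  matches that of \<^term>\<open>outer_prod w\<close>: random sign vectors reproduce everything except the excess
  fourth moment \<^term>\<open>a - 1\<close>, which coordinate directions supply.\<close>

lemma expectation_tr_exp_le_jumps:
  fixes m h1 h2 :: real
  assumes sym: "transpose A = A" and s: "0 \<le> s" and m: "0 < m"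
    and h1: "m * h1\<^sup>2 = s\<^sup>2" and h2: "m * h2\<^sup>2 = s\<^sup>2 * (a - 1) * real CARD('n)"
  shows "(\<integral>w. tr_exp (A - s *\<^sub>R outer_prod w) \<partial>P)
     \<le> (1 - s - 2 * m) * tr_exp A + m * jump_avg h1 h2 tr_exp A"
proof -
  obtain B l where eb: "eigenbasis A B l" using symmetric_eigenbasis_exists[OF sym] by blast
  let ?H = "rank_one_hessian B l"
  let ?T = "\<lambda>h y. (tr_exp (A + h *\<^sub>R outer_prod y) + tr_exp (A - h *\<^sub>R outer_prod y)) / 2"
  have e: "tr_exp A + h\<^sup>2 * ?H w \<le> ?T h w" for h w
    using tr_exp_rank_one_even[OF eb sym, of h w] by simp
  have "tr_exp A + h1\<^sup>2 * sign_avg ?H = sign_avg (\<lambda>y. tr_exp A + h1\<^sup>2 * ?H y)"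
    by (simp add: sign_avg_add sign_avg_cmult sign_avg_const)
  also have "\<dots> \<le> sign_avg (\<lambda>y. ?T h1 y)"
    by (intro sign_avg_mono e)
  finally have 1: "m * (tr_exp A + h1\<^sup>2 * sign_avg ?H)
     \<le> m * sign_avg (\<lambda>y. ?T h1 y)"
    using m by (intro mult_left_mono) auto
  have "real CARD('n) * tr_exp A + h2\<^sup>2 * (\<Sum>j\<in>UNIV. ?H (axis j 1)) = (\<Sum>j\<in>UNIV. tr_exp A + h2\<^sup>2 * ?H (axis j 1))"
    by (simp add: sum.distrib sum_distrib_left)
  also have "\<dots> \<le> (\<Sum>j\<in>UNIV. ?T h2 (axis j 1))"
    by (intro sum_mono e)
  finally have "(real CARD('n) * tr_exp A + h2\<^sup>2 * (\<Sum>j\<in>UNIV. ?H (axis j 1))) / real CARD('n) \<le>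
     (\<Sum>j\<in>UNIV. ?T h2 (axis j 1)) / real CARD('n)"
    by (rule divide_right_mono) simp
  then have "tr_exp A + h2\<^sup>2 * (\<Sum>j\<in>UNIV. ?H (axis j 1)) / real CARD('n) \<le>
     (\<Sum>j\<in>UNIV. ?T h2 (axis j 1)) / real CARD('n)"
    by (simp add: add_divide_distrib)
  then have 2: "m * (tr_exp A + h2\<^sup>2 * (\<Sum>j\<in>UNIV. ?H (axis j 1)) / real CARD('n)) \<le>
     m * ((\<Sum>j\<in>UNIV. ?T h2 (axis j 1)) / real CARD('n))"
    using m by (intro mult_left_mono) auto
  have "s\<^sup>2 * (\<integral>w. ?H w \<partial>P) = m * h1\<^sup>2 * sign_avg ?H + m * h2\<^sup>2 * (\<Sum>j\<in>UNIV. ?H (axis j 1)) / real CARD('n)"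
    unfolding expectation_hessian h1 h2 by (simp add: distrib_left)
  with expectation_tr_exp_le[OF sym s eb] 1 2 show ?thesis unfolding jump_avg_def by (simp add: algebra_simps)
qed

end

subsection \<open>A potential controlling quadratic forms with zero diagonal\<close>

definition ball_integral :: "real \<Rightarrow> (real^'n \<Rightarrow> real) \<Rightarrow> real" where
  "ball_integral r f = (\<integral>\<theta>. indicator (cball 0 r) \<theta> * f \<theta> \<partial>lborel)"

lemma integrable_cball_continuous:
  fixes f :: "real^'n \<Rightarrow> real"
  assumes "continuous_on UNIV f"
  shows "integrable lborel (\<lambda>\<theta>. indicator (cball c r) \<theta> * f \<theta>)"
  using borel_integrable_compact[OF compact_cball continuous_on_subset[OF assms subset_UNIV], of c r]
  by (simp only: real_scaleR_def)

lemma ball_integral_mono: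
  assumes "continuous_on UNIV f" "continuous_on UNIV g" "\<And>\<theta>. norm \<theta> \<le> r \<Longrightarrow> f \<theta> \<le> g \<theta>"
  shows "ball_integral r f \<le> ball_integral r g"
  unfolding ball_integral_def
  by (intro integral_mono integrable_cball_continuous assms) (auto simp: indicator_def assms)

lemma ball_integral_add:
  assumes "continuous_on UNIV f" "continuous_on UNIV g"
  shows "ball_integral r (\<lambda>\<theta>. f \<theta> + g \<theta>) = ball_integral r f + ball_integral r g"
  unfolding ball_integral_def distrib_left
  by (intro Bochner_Integration.integral_add integrable_cball_continuous assms)

lemma ball_integral_cmult: "ball_integral r (\<lambda>\<theta>. c * f \<theta>) = c * ball_integral r f"
  unfolding ball_integral_def by (simp add: mult.left_commute)

lemma ball_integral_sum:
  assumes "\<And>i. i \<in> I \<Longrightarrow> continuous_on UNIV (f i)"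
  shows "ball_integral r (\<lambda>\<theta>. \<Sum>i\<in>I. f i \<theta>) = (\<Sum>i\<in>I. ball_integral r (f i))"
  unfolding ball_integral_def sum_distrib_left
  by (intro Bochner_Integration.integral_sum integrable_cball_continuous assms)

lemma ball_integral_const: "0 \<le> r \<Longrightarrow> ball_integral r (\<lambda>\<theta> :: real^'n. c) = c * measure lborel (cball (0 :: real^'n) r)"
  unfolding ball_integral_def by simp

lemma distr_lborel_sign_change:
  fixes e :: "'a::euclidean_space \<Rightarrow> real"
  assumes e: "\<And>j. j \<in> Basis \<Longrightarrow> \<bar>e j\<bar> = 1"
  shows "distr lborel borel (\<lambda>x. \<Sum>j\<in>Basis. (e j * (x \<bullet> j)) *\<^sub>R j) = lborel"
proof -
  have "(\<Prod>j\<in>Basis. \<bar>e j\<bar>) = 1" using e by (simp cong: prod.cong)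
  moreover have "\<And>j. j \<in> Basis \<Longrightarrow> e j \<noteq> 0" using e by fastforce
  ultimately show ?thesis
    using lborel_affine_euclidean[of e 0] by (simp add: density_1)
qed

text \<open>Coordinate reflections preserve Lebesgue measure and the ball. They are the symmetries
  that annihilate odd integrands and mixed second moments.\<close>

lemma ball_integral_sign_change:
  fixes e :: "real^'n \<Rightarrow> real" and f :: "real^'n \<Rightarrow> real"
  assumes e: "\<And>j. j \<in> Basis \<Longrightarrow> \<bar>e j\<bar> = 1" and f: "continuous_on UNIV f"
  shows "ball_integral r (\<lambda>x. f (\<Sum>j\<in>Basis. (e j * (x \<bullet> j)) *\<^sub>R j)) = ball_integral r f"
proof -
  let ?T = "\<lambda>x. \<Sum>j\<in>Basis. (e j * (x \<bullet> j)) *\<^sub>R j"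
  have nT: "norm (?T x) = norm x" for x
  proof -
    have "?T x \<bullet> ?T x = (\<Sum>j\<in>Basis. (e j * (x \<bullet> j))\<^sup>2)"
      by (simp add: inner_sum_right inner_sum_left_Basis power2_eq_square cong: sum.cong)
    also have "\<dots> = (\<Sum>j\<in>Basis. (x \<bullet> j)\<^sup>2)"
      by (intro sum.cong refl) (metis e abs_mult mult_1 power2_abs)
    also have "\<dots> = x \<bullet> x" by (simp add: power2_eq_square euclidean_inner[of x x])
    finally show ?thesis by (simp add: norm_eq_sqrt_inner)
  qed
  have [measurable]: "f \<in> borel_measurable borel" by (rule borel_measurable_continuous_onI[OF f])
  have "ball_integral r f = (\<integral>\<theta>. indicator (cball 0 r) \<theta> * f \<theta> \<partial>(distr lborel borel ?T))"
    unfolding ball_integral_def by (simp add: distr_lborel_sign_change[OF e])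
  also have "\<dots> = (\<integral>x. indicator (cball 0 r) (?T x) * f (?T x) \<partial>lborel)"
    by (intro integral_distr borel_measurable_times borel_measurable_indicator borel_measurable_continuous_onI f) auto
  also have "\<dots> = ball_integral r (\<lambda>x. f (?T x))"
    unfolding ball_integral_def by (intro Bochner_Integration.integral_cong refl) (simp add: indicator_def nT)
  finally show ?thesis ..
qed

lemma ball_integral_odd:
  assumes f: "continuous_on UNIV f" and odd: "\<And>x. f (- x) = - f x"
  shows "ball_integral r f = 0"
proof -
  have neg: "(\<Sum>j\<in>Basis. (- 1 * (x \<bullet> j)) *\<^sub>R j) = - x" for x :: "real^'n"
    by (simp add: sum_negf euclidean_representation)
  have "ball_integral r (\<lambda>x. f (\<Sum>j\<in>Basis. (- 1 * (x \<bullet> j)) *\<^sub>R j)) = ball_integral r f"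
    by (rule ball_integral_sign_change[OF _ f]) simp
  then have "ball_integral r (\<lambda>x. f (- x)) = ball_integral r f" by (simp only: neg)
  then show ?thesis using ball_integral_cmult[of r "-1" f] by (simp add: odd)
qed

lemma ball_integral_coord_product:
  fixes j k :: "'n::finite"
  assumes "j \<noteq> k"
  shows "ball_integral r (\<lambda>x :: real^'n. x $ j * x $ k) = 0"
proof -
  let ?e = "\<lambda>b :: real^'n. if b = axis j 1 then -1 else 1 :: real"
  let ?T = "\<lambda>x :: real^'n. \<Sum>b\<in>Basis. (?e b * (x \<bullet> b)) *\<^sub>R b"
  have "?T x $ i = (if i = j then - (x $ i) else x $ i)" for x i
  proof -
    have "?T x $ i = ?T x \<bullet> axis i 1" by (simp add: inner_axis)
    also have "\<dots> = ?e (axis i 1) * (x \<bullet> axis i 1)"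
      by (subst inner_sum_left_Basis) (auto simp: axis_in_Basis_iff)
    finally show ?thesis by (simp add: inner_axis axis_eq_axis)
  qed
  then have "ball_integral r (\<lambda>x. ?T x $ j * ?T x $ k) = - ball_integral r (\<lambda>x. x $ j * x $ k)"
    using assms ball_integral_cmult[of r "-1" "\<lambda>x. x $ j * x $ k"] by simp
  moreover have "ball_integral r (\<lambda>x. ?T x $ j * ?T x $ k) = ball_integral r (\<lambda>x. x $ j * x $ k)"
    by (rule ball_integral_sign_change[where f = "\<lambda>x. x $ j * x $ k"]) (auto intro!: continuous_intros)
  ultimately show ?thesis by linarith
qed

lemma continuous_on_quadratic [continuous_intros]:
  fixes M :: "real^'n^'n" and f g :: "real^'n \<Rightarrow> real^'n"
  assumes "continuous_on S f" "continuous_on S g"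
  shows "continuous_on S (\<lambda>x. f x \<bullet> (M *v g x))"
  using assms(1) linear_continuous_on_compose[OF assms(2) matrix_vector_mul_linear[of M]]
  by (rule continuous_on_inner)

text \<open>This is why the identity is removed from the sign jumps:
  \<open>outer_prod y - mat 1\<close> has zero diagonal, so the quadratic term averages to 0 in
  Jensen's inequality.\<close>

lemma ball_integral_zero_diag_quadratic:
  fixes M :: "real^'n^'n"
  assumes "\<And>i. M $ i $ i = 0"
  shows "ball_integral r (\<lambda>x. x \<bullet> (M *v x)) = 0"
proof -
  have "x \<bullet> (M *v x) = (\<Sum>i\<in>UNIV. \<Sum>j\<in>UNIV. M $ i $ j * (x $ i * x $ j))" for x
    by (simp add: inner_vec_def matrix_vector_mult_def sum_distrib_left mult_ac)
  then have "ball_integral r (\<lambda>x. x \<bullet> (M *v x)) = (\<Sum>i\<in>UNIV. \<Sum>j\<in>UNIV. M $ i $ j * ball_integral r (\<lambda>x. x $ i * x $ j))"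
    by (simp add: ball_integral_sum ball_integral_cmult continuous_intros)
  also have "\<dots> = 0"
  proof (intro sum.neutral ballI)
    fix i j show "M $ i $ j * ball_integral r (\<lambda>x. x $ i * x $ j) = 0"
      by (cases "i = j") (simp_all add: assms ball_integral_coord_product)
  qed
  finally show ?thesis .
qed

lemma cosh_le_quadratic:
  fixes t :: real
  assumes "\<bar>t\<bar> \<le> 3/10"
  shows "(exp t + exp (-t)) / 2 \<le> 1 + 51/100 * t\<^sup>2"
proof -
  have "exp t \<le> 1 + t + t\<^sup>2 / 2 + t ^ 3 / 6 + t ^ 4 / 12" if "\<bar>t\<bar> \<le> 3/10" for t :: real
  proof -
    obtain u where u: "\<bar>u\<bar> \<le> \<bar>t\<bar>" "exp t = (\<Sum>m<4. t ^ m / fact m) + exp u / fact 4 * t ^ 4"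
      using Maclaurin_exp_le[of t 4] by blast
    have "exp u \<le> exp (3/10)" using u(1) that by simp
    also have "\<dots> \<le> 1 + 3/10 + (3/10 :: real)\<^sup>2" by (intro exp_bound) auto
    also have "\<dots> \<le> 2" by (simp add: power2_eq_square)
    finally have "exp u / fact 4 * t ^ 4 \<le> 2 / fact 4 * t ^ 4"
      by (intro mult_right_mono divide_right_mono) auto
    also have "\<dots> = t ^ 4 / 12" by (simp add: fact_numeral)
    finally have "exp u / fact 4 * t ^ 4 \<le> t ^ 4 / 12" .
    moreover have "(\<Sum>m<4. t ^ m / fact m) = 1 + t + t\<^sup>2 / 2 + t ^ 3 / 6"
      by (simp add: eval_nat_numeral)
    ultimately show ?thesis using u(2) by linarith
  qed
  from this[of t] this[of "-t"] assms
  have "(exp t + exp (-t)) / 2 \<le> 1 + t\<^sup>2 / 2 + t ^ 4 / 12" by simp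
  also have "t ^ 4 / 12 \<le> t\<^sup>2 / 100"
  proof -
    have "t\<^sup>2 \<le> (3/10)\<^sup>2" using assms by (metis abs_ge_zero power2_abs power_mono)
    \<comment> \<open>Any bound on \<open>t\<^sup>2\<close> up to 12/100 would do, since the quartic
      term carries 1/12 and the slack over 1/2 is 1/100; here \<open>t\<^sup>2\<close> is at most
      9/100.\<close>
    then have "t\<^sup>2 * t\<^sup>2 \<le> (12/100) * t\<^sup>2" by (intro mult_right_mono) (auto simp: power2_eq_square)
    then show ?thesis by (simp add: power4_eq_xxxx power2_eq_square)
  qed
  finally show ?thesis by simp
qed

text \<open>The constant \<open>51/100\<close> replaces \<open>1/2\<close> in the bound on \<open>cosh t\<close> for small \<^term>\<open>t\<close>, and
  \<open>2 (\<theta> \<bullet> \<theta>)\<^sup>2 + 1\<close> bounds the mean square of \<open>(\<theta> \<bullet> y)\<^sup>2 - \<theta> \<bullet> \<theta> + 1\<close> over sign vectors \<open>y\<close>.\<close>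

definition potential_rate :: "real \<Rightarrow> real^'n \<Rightarrow> real" where
  "potential_rate x \<theta> = 51/100 * x\<^sup>2 * (2 * (\<theta> \<bullet> \<theta>)\<^sup>2 + 1)"

text \<open>\<open>\<tau>\<close> counts the sign jumps made so far, \<open>M\<close> is their sum
  without the diagonal, and \<open>c\<close> counts the identities removed. Kept apart, these
  contribute \<open>x * c\<close> at every point of the ball, whatever its norm. The discount per
  jump is chosen so that the mean does not grow.\<close>

definition potential :: "real \<Rightarrow> nat \<Rightarrow> real^'n^'n \<Rightarrow> real \<Rightarrow> real" where
  "potential x \<tau> M c = ball_integral (13/10) (\<lambda>\<theta>. exp (x * (\<theta> \<bullet> (M *v \<theta>) + c) - real \<tau> * potential_rate x \<theta>))"

lemma continuous_on_potential_rate [continuous_intros]: "continuous_on S (potential_rate x)"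
  unfolding potential_rate_def[abs_def] by (intro continuous_intros)

lemma continuous_on_potential_integrand:
  "continuous_on UNIV (\<lambda>\<theta>. exp (x * (\<theta> \<bullet> (M *v \<theta>) + c) - real \<tau> * potential_rate x \<theta>))"
  by (intro continuous_intros)

text \<open>Jensen's inequality on the ball of radius \<open>3/10\<close> around \<^term>\<open>v\<close>, which lies in the ball of
  radius \<open>13/10\<close> around the origin. The constant \<open>40962/10000\<close> is \<open>2 ((1 + \<rho>\<^sup>2)\<^sup>2 + 4 \<rho>\<^sup>2) + 1\<close>
  for \<open>\<rho> = 3/10\<close>.\<close>

lemma exp_quadratic_le_potential:
  fixes M :: "real^'n^'n"
  assumes v: "norm v = 1" and diag: "\<And>i. M $ i $ i = 0" and sym: "transpose M = M"
  shows "exp (x * (v \<bullet> (M *v v) + c) - real \<tau> * (51/100 * x\<^sup>2 * (40962/10000)))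
     * measure lborel (cball (0 :: real^'n) (3/10)) \<le> potential x \<tau> M c"
proof -
  let ?F = "\<lambda>\<theta>. x * (\<theta> \<bullet> (M *v \<theta>) + c) - real \<tau> * potential_rate x \<theta>"
  define b where "b = x * (v \<bullet> (M *v v) + c) - real \<tau> * (51/100 * x\<^sup>2 * (40962/10000))"
  define g where "g = 51/100 * x\<^sup>2"
  \<comment> \<open>The terms odd in \<open>\<eta>\<close>, which integrate to 0 over the centred
    ball.\<close>
  define O1 where "O1 \<eta> = 2 * x * (v \<bullet> (M *v \<eta>)) - 8 * real \<tau> * g * ((v \<bullet> \<eta>) * (1 + \<eta> \<bullet> \<eta>))" for \<eta>
  have "0 \<le> g" by (simp add: g_def)
  have vv: "v \<bullet> v = 1" using v by (simp add: norm_eq_1)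
  have lower: "O1 \<eta> + x * (\<eta> \<bullet> (M *v \<eta>)) \<le> ?F (v + \<eta>) - b" if "norm \<eta> \<le> 3/10" for \<eta>
  proof -
    have e1: "\<eta> \<bullet> \<eta> \<le> 9/100"
      using power_mono[OF that norm_ge_zero, of 2] by (simp add: dot_square_norm power2_eq_square)
    have "\<bar>v \<bullet> \<eta>\<bar> \<le> 3/10" using Cauchy_Schwarz_ineq2[of v \<eta>] v that by simp
    then have e2: "(v \<bullet> \<eta>)\<^sup>2 \<le> 9/100" using power_mono[of "\<bar>v \<bullet> \<eta>\<bar>" "3/10" 2] by (simp add: power2_eq_square)
    have "(v + \<eta>) \<bullet> (v + \<eta>) = 1 + \<eta> \<bullet> \<eta> + 2 * (v \<bullet> \<eta>)"
      by (simp add: inner_add_left inner_add_right vv inner_commute)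
    then have "((v + \<eta>) \<bullet> (v + \<eta>))\<^sup>2 = (1 + \<eta> \<bullet> \<eta>)\<^sup>2 + 4 * (v \<bullet> \<eta>)\<^sup>2 + 4 * ((v \<bullet> \<eta>) * (1 + \<eta> \<bullet> \<eta>))"
      by (simp add: power2_eq_square algebra_simps)
    moreover have "(1 + \<eta> \<bullet> \<eta>)\<^sup>2 \<le> (109/100)\<^sup>2" using e1 by (intro power_mono) auto
    ultimately have "((v + \<eta>) \<bullet> (v + \<eta>))\<^sup>2 \<le> 15481/10000 + 4 * ((v \<bullet> \<eta>) * (1 + \<eta> \<bullet> \<eta>))"
      using e2 by (simp add: power2_eq_square)
    then have "potential_rate x (v + \<eta>) \<le> g * (40962/10000 + 8 * ((v \<bullet> \<eta>) * (1 + \<eta> \<bullet> \<eta>)))"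
      unfolding potential_rate_def g_def[symmetric] using \<open>0 \<le> g\<close> by (intro mult_left_mono) auto
    then have "real \<tau> * potential_rate x (v + \<eta>) \<le> real \<tau> * (g * (40962/10000 + 8 * ((v \<bullet> \<eta>) * (1 + \<eta> \<bullet> \<eta>))))"
      by (intro mult_left_mono) auto
    moreover have "(v + \<eta>) \<bullet> (M *v (v + \<eta>)) = v \<bullet> (M *v v) + 2 * (v \<bullet> (M *v \<eta>)) + \<eta> \<bullet> (M *v \<eta>)"
      using inner_symmetric_matrix[OF sym, of v \<eta>]
      by (simp add: matrix_vector_right_distrib inner_add_left inner_add_right inner_commute)
    ultimately show ?thesis
      unfolding O1_def b_def g_def[symmetric] by (simp add: algebra_simps)
  qed
  have contF: "continuous_on UNIV (\<lambda>\<eta>. ?F (v + \<eta>))" by (intro continuous_intros continuous_on_compose2[OF continuous_on_potential_rate]) auto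
  have contO: "continuous_on UNIV O1" unfolding O1_def[abs_def] by (intro continuous_intros)
  have meas [measurable]: "(\<lambda>\<theta>. exp (?F \<theta>)) \<in> borel_measurable borel"
    by (rule borel_measurable_continuous_onI[OF continuous_on_potential_integrand])
  have "ball_integral (3/10) (\<lambda>\<eta>. exp b * (1 + (O1 \<eta> + x * (\<eta> \<bullet> (M *v \<eta>))))) \<le> ball_integral (3/10) (\<lambda>\<eta>. exp (?F (v + \<eta>)))"
  proof (rule ball_integral_mono)
    fix \<eta> :: "real^'n" assume "norm \<eta> \<le> 3/10"
    have "1 + (O1 \<eta> + x * (\<eta> \<bullet> (M *v \<eta>))) \<le> exp (?F (v + \<eta>) - b)"
      using lower[OF \<open>norm \<eta> \<le> 3/10\<close>] exp_ge_add_one_self[of "?F (v + \<eta>) - b"] by linarith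
    then have "exp b * (1 + (O1 \<eta> + x * (\<eta> \<bullet> (M *v \<eta>)))) \<le> exp b * exp (?F (v + \<eta>) - b)"
      by (intro mult_left_mono) auto
    then show "exp b * (1 + (O1 \<eta> + x * (\<eta> \<bullet> (M *v \<eta>)))) \<le> exp (?F (v + \<eta>))" by (simp flip: exp_add)
  qed (intro continuous_intros contO contF)+
  also have "ball_integral (3/10) (\<lambda>\<eta>. exp b * (1 + (O1 \<eta> + x * (\<eta> \<bullet> (M *v \<eta>))))) = exp b * measure lborel (cball (0 :: real^'n) (3/10))"
  proof -
    have "ball_integral (3/10) O1 = 0"
      by (intro ball_integral_odd contO) (simp add: O1_def linear_neg[OF matrix_vector_mul_linear])
    then show ?thesis
      by (simp add: ball_integral_cmult ball_integral_add ball_integral_const continuous_intros contO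
          ball_integral_zero_diag_quadratic[OF diag])
  qed
  also have "ball_integral (3/10) (\<lambda>\<eta>. exp (?F (v + \<eta>))) = (\<integral>\<theta>. indicator (cball v (3/10)) \<theta> * exp (?F \<theta>) \<partial>lborel)"
  proof -
    have "(\<integral>\<theta>. indicator (cball v (3/10)) \<theta> * exp (?F \<theta>) \<partial>lborel)
      = (\<integral>\<theta>. indicator (cball v (3/10)) \<theta> * exp (?F \<theta>) \<partial>(distr lborel borel ((+) v)))"
      by (simp only: lborel_distr_plus)
    also have "\<dots> = (\<integral>\<eta>. indicator (cball v (3/10)) (v + \<eta>) * exp (?F (v + \<eta>)) \<partial>lborel)"
      by (intro integral_distr borel_measurable_times borel_measurable_indicator meas) auto
    also have "\<dots> = ball_integral (3/10) (\<lambda>\<eta>. exp (?F (v + \<eta>)))"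
      unfolding ball_integral_def by (intro Bochner_Integration.integral_cong refl) (simp add: indicator_def dist_norm)
    finally show ?thesis ..
  qed
  also have "\<dots> \<le> potential x \<tau> M c"
    unfolding potential_def ball_integral_def
  proof (intro integral_mono integrable_cball_continuous continuous_on_potential_integrand)
    fix \<theta>
    have "norm \<theta> \<le> 13/10" if "dist v \<theta> \<le> 3/10"
      using that norm_triangle_ineq[of v "\<theta> - v"] v by (simp add: dist_norm norm_minus_commute)
    then show "indicator (cball v (3/10)) \<theta> * exp (?F \<theta>) \<le> indicator (cball 0 (13/10)) \<theta> * exp (?F \<theta>)"
      by (auto simp: indicator_def)
  qed
  finally show ?thesis unfolding b_def .
qed

subsection \<open>Iterated expectation over rank-one downdates\<close>

lemma potential_pos:
  assumes "\<And>i. M $ i $ i = 0" "transpose M = M"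
  shows "0 < potential x \<tau> M c"
proof -
  have "0 < exp z * measure lborel (cball (0 :: real^'n) (3/10))" for z
    by (intro mult_pos_pos) simp_all
  then show ?thesis
    using exp_quadratic_le_potential[OF norm_axis_1 assms, of x undefined c \<tau>]
    by (meson less_le_trans)
qed

lemma potential_0: "potential x 0 (0 :: real^'n^'n) 0 = measure lborel (cball (0 :: real^'n) (13/10))"
  by (simp add: potential_def ball_integral_const)

section \<open>The potential under one sign jump\<close>

lemma sign_vecs_inner_self: "y \<in> sign_vecs \<Longrightarrow> y \<bullet> (y :: real^'n) = real CARD('n)"
  by (simp add: inner_vec_def sign_vecs_square)

lemma sign_avg_cosh_le:
  fixes \<theta> :: "real^'n"
  assumes \<theta>: "norm \<theta> \<le> 13/10" and x: "0 \<le> x" "5 * real CARD('n) * x \<le> 3/10"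
  shows "sign_avg (\<lambda>y. (exp (x * ((\<theta> \<bullet> y)\<^sup>2 - \<theta> \<bullet> \<theta> + 1)) + exp (- (x * ((\<theta> \<bullet> y)\<^sup>2 - \<theta> \<bullet> \<theta> + 1)))) / 2)
     \<le> exp (potential_rate x \<theta>)"
proof -
  define p where "p = \<theta> \<bullet> \<theta>"
  have p: "0 \<le> p" "p \<le> 169/100"
    using power_mono[OF \<theta> norm_ge_zero, of 2] by (simp_all add: p_def dot_square_norm power2_eq_square)
  have d: "1 \<le> real CARD('n)" by (simp add: Suc_le_eq)
  have small: "\<bar>x * ((\<theta> \<bullet> y)\<^sup>2 - p + 1)\<bar> \<le> 3/10" if y: "y \<in> sign_vecs" for y
  proof -
    have "(\<theta> \<bullet> y)\<^sup>2 \<le> p * real CARD('n)"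
      using Cauchy_Schwarz_ineq[of \<theta> y] by (simp add: p_def sign_vecs_inner_self[OF y])
    also have "\<dots> \<le> 169/100 * real CARD('n)" using p by (intro mult_right_mono) auto
    finally have "(\<theta> \<bullet> y)\<^sup>2 \<le> 169/100 * real CARD('n)" .
    \<comment> \<open>The expression lies between -0.69 and \<open>1.69 * d + 1\<close>, with
      \<open>d\<close> the dimension.\<close>
    then have "\<bar>(\<theta> \<bullet> y)\<^sup>2 - p + 1\<bar> \<le> 5 * real CARD('n)" using p d zero_le_power2[of "\<theta> \<bullet> y"] unfolding abs_le_iff by linarith
    then have "x * \<bar>(\<theta> \<bullet> y)\<^sup>2 - p + 1\<bar> \<le> x * (5 * real CARD('n))" using x by (intro mult_left_mono) auto
    also have "\<dots> \<le> 3/10" using x by (simp add: mult_ac)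
    finally show ?thesis using x by (simp add: abs_mult)
  qed
  have "sign_avg (\<lambda>y. (exp (x * ((\<theta> \<bullet> y)\<^sup>2 - p + 1)) + exp (- (x * ((\<theta> \<bullet> y)\<^sup>2 - p + 1)))) / 2)
    \<le> sign_avg (\<lambda>y. 1 + 51/100 * (x * ((\<theta> \<bullet> y)\<^sup>2 - p + 1))\<^sup>2)"
    by (intro sign_avg_mono cosh_le_quadratic small)
  also have "\<dots> = sign_avg (\<lambda>y. 1 + 51/100 * x\<^sup>2 * ((\<theta> \<bullet> y)\<^sup>2 * (\<theta> \<bullet> y)\<^sup>2 + 2 * (1 - p) * (\<theta> \<bullet> y)\<^sup>2 + (1 - p)\<^sup>2))"
    by (intro sign_avg_cong) (simp add: power2_eq_square algebra_simps)
  also have "\<dots> = 1 + 51/100 * x\<^sup>2 * (quartic_moment 1 \<theta> \<theta> + 2 * (1 - p) * p + (1 - p)\<^sup>2)"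
    unfolding sign_avg_add sign_avg_cmult sign_avg_const sign_avg_quartic sign_avg_inner_square p_def[symmetric] ..
  also have "\<dots> \<le> 1 + 51/100 * x\<^sup>2 * (2 * p\<^sup>2 + 1)"
  proof -
    have "0 \<le> (\<Sum>j\<in>UNIV. (\<theta> $ j)\<^sup>2 * (\<theta> $ j)\<^sup>2)" by (intro sum_nonneg) auto
    then have "quartic_moment 1 \<theta> \<theta> \<le> 3 * p\<^sup>2"
      by (simp add: quartic_moment_def p_def[symmetric] power2_eq_square)
    \<comment> \<open>The linear terms cancel:
      \<open>3 * p\<^sup>2 + 2 * (1 - p) * p + (1 - p)\<^sup>2\<close> equals
      \<open>2 * p\<^sup>2 + 1\<close>.\<close>
    then have "quartic_moment 1 \<theta> \<theta> + 2 * (1 - p) * p + (1 - p)\<^sup>2 \<le> 2 * p\<^sup>2 + 1"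
      by (simp add: power2_eq_square algebra_simps)
    then show ?thesis by (intro add_left_mono mult_left_mono) auto
  qed
  also have "\<dots> \<le> exp (potential_rate x \<theta>)"
    unfolding potential_rate_def p_def by (rule exp_ge_add_one_self)
  finally show ?thesis unfolding p_def .
qed

text \<open>Supermartingale property. The average over \<open>y\<close> moves inside the ball
  integral, where its growth at each \<open>\<theta>\<close> is at most the factor
  \<open>exp (potential_rate x \<theta>)\<close> that the passage from \<open>\<tau>\<close> to
  \<open>Suc \<tau>\<close> takes away.\<close>

lemma potential_jump:
  fixes M :: "real^'n^'n"
  assumes x: "0 \<le> x" "5 * real CARD('n) * x \<le> 3/10"
  shows "sign_avg (\<lambda>y. (potential x (Suc \<tau>) (M + (outer_prod y - mat 1)) (c + 1)
     + potential x (Suc \<tau>) (M - (outer_prod y - mat 1)) (c - 1)) / 2) \<le> potential x \<tau> M c"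
proof -
  let ?J = "\<lambda>y. (potential x (Suc \<tau>) (M + (outer_prod y - mat 1)) (c + 1)
     + potential x (Suc \<tau>) (M - (outer_prod y - mat 1)) (c - 1)) / 2"
  define E where "E \<theta> = exp (x * (\<theta> \<bullet> (M *v \<theta>) + c) - real \<tau> * potential_rate x \<theta>)" for \<theta>
  define z where "z y \<theta> = x * ((\<theta> \<bullet> y)\<^sup>2 - \<theta> \<bullet> \<theta> + 1)" for y \<theta> :: "real^'n"
  define g where "g y \<theta> = (E \<theta> * exp (- potential_rate x \<theta>)) * ((exp (z y \<theta>) + exp (- z y \<theta>)) / 2)" for y \<theta>
  have contE: "continuous_on UNIV E" unfolding E_def[abs_def] by (intro continuous_intros)
  have contz: "continuous_on UNIV (z y)" for y unfolding z_def[abs_def] by (intro continuous_intros)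
  have contg: "continuous_on UNIV (g y)" for y
    unfolding g_def[abs_def] by (intro continuous_intros contE contz) auto
  have q: "\<theta> \<bullet> ((outer_prod y - mat 1) *v \<theta>) = (\<theta> \<bullet> y)\<^sup>2 - \<theta> \<bullet> \<theta>" for y \<theta> :: "real^'n"
    by (simp add: matrix_vector_mult_diff_rdistrib inner_diff_right outer_prod_mult_vec power2_eq_square inner_commute)
  have p1: "potential x (Suc \<tau>) (M + (outer_prod y - mat 1)) (c + 1)
      = ball_integral (13/10) (\<lambda>\<theta>. E \<theta> * exp (- potential_rate x \<theta>) * exp (z y \<theta>))" for y
    unfolding potential_def E_def z_def
    by (intro arg_cong[where f = "ball_integral (13/10)"] ext)
      (simp only: matrix_vector_mult_add_rdistrib[of M] inner_add_right[of _ "M *v _"] q, simp add: algebra_simps flip: exp_add)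
  have p2: "potential x (Suc \<tau>) (M - (outer_prod y - mat 1)) (c - 1)
      = ball_integral (13/10) (\<lambda>\<theta>. E \<theta> * exp (- potential_rate x \<theta>) * exp (- z y \<theta>))" for y
    unfolding potential_def E_def z_def
    by (intro arg_cong[where f = "ball_integral (13/10)"] ext)
      (simp only: matrix_vector_mult_diff_rdistrib[of M] inner_diff_right[of _ "M *v _"] q, simp add: algebra_simps flip: exp_add)
  have "?J y = ball_integral (13/10) (g y)" for y
  proof -
    have "ball_integral (13/10) (g y) = ball_integral (13/10) (\<lambda>\<theta>. 1/2 * (E \<theta> * exp (- potential_rate x \<theta>) * exp (z y \<theta>)
       + E \<theta> * exp (- potential_rate x \<theta>) * exp (- z y \<theta>)))"
      by (intro arg_cong[where f = "ball_integral (13/10)"] ext) (simp add: g_def algebra_simps)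
    also have "\<dots> = 1/2 * (ball_integral (13/10) (\<lambda>\<theta>. E \<theta> * exp (- potential_rate x \<theta>) * exp (z y \<theta>))
       + ball_integral (13/10) (\<lambda>\<theta>. E \<theta> * exp (- potential_rate x \<theta>) * exp (- z y \<theta>)))"
      unfolding ball_integral_cmult by (subst ball_integral_add) (auto intro!: continuous_intros contE contz)
    finally show ?thesis unfolding p1 p2 by simp
  qed
  then have "sign_avg (\<lambda>y. ?J y) = sign_avg (\<lambda>y. ball_integral (13/10) (g y))"
    by (intro sign_avg_cong)
  also have "\<dots> = ball_integral (13/10) (\<lambda>\<theta>. sign_avg (\<lambda>y. g y \<theta>))"
  proof -
    have "ball_integral (13/10) (\<lambda>\<theta>. 1 / real (card (sign_vecs :: (real^'n) set)) * (\<Sum>y\<in>sign_vecs. g y \<theta>))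
      = 1 / real (card (sign_vecs :: (real^'n) set)) * (\<Sum>y\<in>sign_vecs. ball_integral (13/10) (g y))"
      unfolding ball_integral_cmult by (subst ball_integral_sum) (auto intro: contg)
    then show ?thesis by (simp add: sign_avg_def)
  qed
  also have "\<dots> \<le> ball_integral (13/10) E"
  proof (rule ball_integral_mono)
    show "continuous_on UNIV (\<lambda>\<theta>. sign_avg (\<lambda>y. g y \<theta>))"
      unfolding sign_avg_def using card_sign_vecs_pos[where 'n = 'n] by (intro continuous_intros contg) auto
    fix \<theta> :: "real^'n" assume \<theta>: "norm \<theta> \<le> 13/10"
    have "sign_avg (\<lambda>y. g y \<theta>) = E \<theta> * exp (- potential_rate x \<theta>) * sign_avg (\<lambda>y. (exp (z y \<theta>) + exp (- z y \<theta>)) / 2)"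
      unfolding g_def by (rule sign_avg_cmult)
    also have "\<dots> \<le> E \<theta> * exp (- potential_rate x \<theta>) * exp (potential_rate x \<theta>)"
      unfolding z_def by (intro mult_left_mono sign_avg_cosh_le \<theta> x) (simp add: E_def)
    also have "\<dots> = E \<theta>" by (simp add: mult.assoc flip: exp_add)
    finally show "sign_avg (\<lambda>y. g y \<theta>) \<le> E \<theta>" .
  qed (rule contE)
  also have "\<dots> = potential x \<tau> M c" by (simp add: potential_def E_def[abs_def])
  finally show ?thesis .
qed

text \<open>Jensen's inequality for the concave power \<open>q\<close>, through its tangent line at
  \<open>S\<close>, which Young's inequality supplies.\<close>

lemma sign_avg_powr_le:
  fixes f g :: "real^'n \<Rightarrow> real"
  assumes pos: "\<And>y. y \<in> sign_vecs \<Longrightarrow> 0 < f y" "\<And>y. y \<in> sign_vecs \<Longrightarrow> 0 < g y" and q: "0 \<le> q" "q \<le> 1"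
    and le: "sign_avg (\<lambda>y. (f y + g y) / 2) \<le> S" "0 < S"
  shows "sign_avg (\<lambda>y. (f y powr q + g y powr q) / 2) \<le> S powr q"
proof -
  have t: "z powr q \<le> S powr q * (q / S * z + (1 - q))" if "0 < z" for z
  proof -
    have "(z / S) powr q * 1 powr (1 - q) \<le> q * (z / S) + (1 - q) * 1"
      using q le that by (intro Youngs_inequality_0) auto
    then have "S powr q * ((z / S) powr q) \<le> S powr q * (q / S * z + (1 - q))"
      by (intro mult_left_mono) auto
    then show ?thesis using le that by (simp add: powr_divide)
  qed
  have "sign_avg (\<lambda>y. (f y powr q + g y powr q) / 2) \<le> sign_avg (\<lambda>y. S powr q * (q / S * ((f y + g y) / 2) + (1 - q)))"
  proof (intro sign_avg_mono)
    fix y :: "real^'n" assume y: "y \<in> sign_vecs"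
    have "(f y powr q + g y powr q) / 2 \<le> (S powr q * (q / S * f y + (1 - q)) + S powr q * (q / S * g y + (1 - q))) / 2"
      by (intro divide_right_mono add_mono t pos y) simp
    also have "(X * (r * F + e) + X * (r * G + e)) / 2 = X * (r * ((F + G) / 2) + e)" for X r F G e :: real
      by (simp add: field_simps)
    finally show "(f y powr q + g y powr q) / 2 \<le> S powr q * (q / S * ((f y + g y) / 2) + (1 - q))" .
  qed
  also have "\<dots> = S powr q * (q / S * sign_avg (\<lambda>y. (f y + g y) / 2) + (1 - q))"
    unfolding sign_avg_add sign_avg_cmult sign_avg_const ..
  also have "\<dots> \<le> S powr q * (q / S * S + (1 - q))"
    using q le by (intro mult_left_mono add_right_mono) auto
  also have "\<dots> = S powr q" using le by simp
  finally show ?thesis .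
qed

definition diag_mat :: "('n \<Rightarrow> real) \<Rightarrow> real^'n^'n" where
  "diag_mat D = (\<chi> i j. if i = j then D i else 0)"

lemma transpose_diag_mat [simp]: "transpose (diag_mat D) = diag_mat D"
  by (auto simp: diag_mat_def transpose_def vec_eq_iff)

lemma diag_mat_quadratic: "v \<bullet> (diag_mat D *v v) = (\<Sum>j\<in>UNIV. (v $ j)\<^sup>2 * D j)"
  by (simp add: diag_mat_def inner_vec_def matrix_vector_mult_def power2_eq_square if_distrib if_distribR
      mult_ac cong: if_cong)

text \<open>Each eigenvalue is a quadratic form at its eigenvector \<open>v\<close>. The part from
  \<open>M\<close> and \<open>c\<close> is bounded uniformly in \<open>v\<close>; the diagonal part
  is bounded by convexity with weights \<open>(v $ j)\<^sup>2\<close>, which add up to 1 over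
  \<open>v\<close> for each \<open>j\<close>. So no dimensional factor arises besides the sum of
  \<open>exp (D j)\<close>.\<close>

lemma tr_exp_le_potential:
  fixes M :: "real^'n^'n"
  assumes diag: "\<And>i. M $ i $ i = 0" and sym: "transpose M = M" and q: "0 \<le> q"
  shows "tr_exp ((q * x) *\<^sub>R (M + c *\<^sub>R mat 1) + diag_mat D)
    \<le> (exp (real \<tau> * (51/100 * x\<^sup>2 * (40962/10000))) * potential x \<tau> M c
        / measure lborel (cball (0 :: real^'n) (3/10))) powr q * (\<Sum>j\<in>UNIV. exp (D j))"
proof -
  let ?A = "(q * x) *\<^sub>R (M + c *\<^sub>R mat 1) + diag_mat D"
  let ?V = "measure lborel (cball (0 :: real^'n) (3/10))"
  let ?X = "exp (real \<tau> * (51/100 * x\<^sup>2 * (40962/10000))) * potential x \<tau> M c / ?V"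
  have V: "0 < ?V" by simp
  have "transpose ?A = ?A" using sym by (simp add: transpose_simps)
  then obtain B l where eb: "eigenbasis ?A B l" using symmetric_eigenbasis_exists by blast
  have "exp (l v) \<le> ?X powr q * (\<Sum>j\<in>UNIV. (v $ j)\<^sup>2 * exp (D j))" if v: "v \<in> B" for v
  proof -
    note v1 = eigenbasis_norm[OF eb v]
    have vv: "(\<Sum>j\<in>UNIV. (v $ j)\<^sup>2) = 1"
      using eigenbasis_inner_self[OF eb v] by (simp add: inner_vec_def power2_eq_square)
    have "l v = v \<bullet> (?A *v v)" by (rule eigenbasis_eigenvalue[OF eb v])
    also have "\<dots> = q * (x * (v \<bullet> (M *v v) + c)) + (\<Sum>j\<in>UNIV. (v $ j)\<^sup>2 * D j)"
      using eigenbasis_inner_self[OF eb v]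
      by (simp add: matrix_vector_mult_add_rdistrib inner_add_right diag_mat_quadratic
          scaleR_matrix_vector_assoc[symmetric] algebra_simps)
    finally have "exp (l v) = exp (x * (v \<bullet> (M *v v) + c)) powr q * exp (\<Sum>j\<in>UNIV. (v $ j)\<^sup>2 * D j)"
      by (simp add: exp_add exp_powr_real mult.commute)
    also have "\<dots> \<le> ?X powr q * (\<Sum>j\<in>UNIV. (v $ j)\<^sup>2 * exp (D j))"
    proof (intro mult_mono powr_mono2 q)
      have "exp (x * (v \<bullet> (M *v v) + c) - real \<tau> * (51/100 * x\<^sup>2 * (40962/10000))) * ?V \<le> potential x \<tau> M c"
        by (rule exp_quadratic_le_potential[OF v1 diag sym])
      moreover have "exp r \<le> exp k * Y / ?V" if "exp (r - k) * ?V \<le> Y" for r k Y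
        using that V by (simp add: exp_diff field_simps)
      ultimately show "exp (x * (v \<bullet> (M *v v) + c)) \<le> ?X" by blast
      have "exp (\<Sum>j\<in>UNIV. (v $ j)\<^sup>2 *\<^sub>R D j) \<le> (\<Sum>j\<in>UNIV. (v $ j)\<^sup>2 * exp (D j))"
        by (rule convex_on_sum[OF _ _ exp_convex]) (auto simp: vv)
      then show "exp (\<Sum>j\<in>UNIV. (v $ j)\<^sup>2 * D j) \<le> (\<Sum>j\<in>UNIV. (v $ j)\<^sup>2 * exp (D j))" by simp
    qed auto
    finally show ?thesis .
  qed
  then have "tr_exp ?A \<le> (\<Sum>v\<in>B. ?X powr q * (\<Sum>j\<in>UNIV. (v $ j)\<^sup>2 * exp (D j)))"
    unfolding tr_exp_eigenbasis[OF eb] by (rule sum_mono)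
  also have "\<dots> = ?X powr q * (\<Sum>j\<in>UNIV. (\<Sum>v\<in>B. v $ j * v $ j) * exp (D j))"
    unfolding sum_distrib_left[symmetric] sum_distrib_right
    by (subst sum.swap) (simp add: power2_eq_square)
  also have "\<dots> = ?X powr q * (\<Sum>j\<in>UNIV. exp (D j))"
    unfolding eigenbasis_mat_unit[OF eb] by simp
  finally show ?thesis .
qed


lemma jump_avg_sum: "jump_avg h1 h2 (\<lambda>A. \<Sum>k\<in>I. c k * f k A) A = (\<Sum>k\<in>I. c k * jump_avg h1 h2 (f k) A)"
proof -
  have 1: "((\<Sum>k\<in>I. c k * f k X) + (\<Sum>k\<in>I. c k * f k Y)) / 2 = (\<Sum>k\<in>I. c k * ((f k X + f k Y) / 2))" for X Y
    by (simp add: sum.distrib[symmetric] sum_divide_distrib distrib_left)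
  have 2: "(\<Sum>j\<in>J. \<Sum>k\<in>I. c k * g j k) / d = (\<Sum>k\<in>I. c k * ((\<Sum>j\<in>J. g j k) / d))" for g :: "'n \<Rightarrow> _ \<Rightarrow> real" and J d
    by (subst sum.swap) (simp add: sum_divide_distrib sum_distrib_left)
  show ?thesis
    unfolding jump_avg_def 1 sign_avg_sum sign_avg_cmult 2 by (simp add: sum.distrib[symmetric] distrib_left)
qed

section \<open>Expected trace exponential for fixed and for binomial numbers of summands\<close>

context isotropic_law
begin

primrec downdate :: "real \<Rightarrow> nat \<Rightarrow> real^'n^'n \<Rightarrow> real" where
  "downdate s 0 A = tr_exp A"
| "downdate s (Suc k) A = (\<integral>w. downdate s k (A - s *\<^sub>R outer_prod w) \<partial>P)"

lemma borel_measurable_downdate [measurable]: "downdate s k \<in> borel_measurable borel"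
proof (induction k)
  case 0
  have "downdate s 0 = tr_exp" by (rule ext) simp
  then show ?case by simp
next
  case (Suc k)
  note [measurable] = Suc
  have "(\<lambda>A. \<integral>w. downdate s k (A - s *\<^sub>R outer_prod w) \<partial>P) \<in> borel_measurable borel" by measurable
  then show ?case by (simp add: fun_eq_iff[symmetric] cong: measurable_cong)
qed

lemma transpose_downdate: "transpose A = A \<Longrightarrow> transpose (A - s *\<^sub>R outer_prod w) = A - s *\<^sub>R outer_prod w"
  by (simp add: transpose_simps)

lemma downdate_bounds:
  assumes "0 \<le> s" "transpose A = A"
  shows "0 \<le> downdate s k A \<and> downdate s k A \<le> tr_exp A"
  using assms(2)
proof (induction k arbitrary: A)
  case 0
  then show ?case using tr_exp_pos[of A] by (simp add: less_imp_le)
next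
  case (Suc k)
  obtain B l where eb: "eigenbasis A B l" using symmetric_eigenbasis_exists[OF Suc.prems] by blast
  have *: "0 \<le> downdate s k (A - s *\<^sub>R outer_prod w) \<and> downdate s k (A - s *\<^sub>R outer_prod w) \<le> tr_exp A" for w
    using Suc.IH[OF transpose_downdate[OF Suc.prems]] tr_exp_rank_one_downdate(2)[OF eb Suc.prems assms(1)]
    by (meson order_trans)
  have int: "integrable P (\<lambda>w. downdate s k (A - s *\<^sub>R outer_prod w))"
    by (rule integrable_const_bound[where B = "tr_exp A"]) (use * in auto)
  have "(\<integral>w. downdate s k (A - s *\<^sub>R outer_prod w) \<partial>P) \<le> (\<integral>w. tr_exp A \<partial>P)"
    by (intro integral_mono int) (use * in auto)
  then show ?case using * by (auto simp: prob_space intro!: integral_nonneg_AE)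
qed

lemma integrable_downdate:
  assumes "0 \<le> s" "transpose A = A"
  shows "integrable P (\<lambda>w. downdate s k (A - s *\<^sub>R outer_prod w))"
proof -
  obtain B l where eb: "eigenbasis A B l" using symmetric_eigenbasis_exists[OF assms(2)] by blast
  have *: "0 \<le> downdate s k (A - s *\<^sub>R outer_prod w) \<and> downdate s k (A - s *\<^sub>R outer_prod w) \<le> tr_exp A" for w
    using downdate_bounds[OF assms(1) transpose_downdate[OF assms(2)]] tr_exp_rank_one_downdate(2)[OF eb assms(2,1)]
    by (meson order_trans)
  show ?thesis by (rule integrable_const_bound[where B = "tr_exp A"]) (use * in auto)
qed

lemma downdate_Suc_le:
  assumes s: "0 \<le> s" and "transpose A = A"
  shows "downdate s (Suc k) A \<le> downdate s k A"
  using assms(2)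
proof (induction k arbitrary: A)
  case 0
  have "(\<integral>w. tr_exp (A - s *\<^sub>R outer_prod w) \<partial>P) \<le> tr_exp A"
    using downdate_bounds[OF s 0, of 1] by simp
  then show ?case by simp
next
  case (Suc k)
  show ?case
    unfolding downdate.simps(2)[of s "Suc k"] downdate.simps(2)[of s k A]
    by (intro integral_mono integrable_downdate s Suc.prems Suc.IH transpose_downdate)
qed

lemma downdate_antimono:
  assumes "0 \<le> s" "transpose A = A" "k \<le> n"
  shows "downdate s n A \<le> downdate s k A"
  using assms(3)
proof (induction rule: dec_induct)
  case (step i)
  then show ?case using downdate_Suc_le[OF assms(1,2), of i] by linarith
qed simp

lemma downdate_chernoff:
  assumes s: "0 \<le> s" and "transpose A = A"
  shows "downdate s (Suc k) A \<le> (1 - s + s\<^sup>2 * (real CARD('n) + a - 1) / 2) * downdate s k A"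
  using assms(2)
proof (induction k arbitrary: A)
  case 0
  then show ?case using expectation_tr_exp_chernoff[OF _ s] by simp
next
  case (Suc k)
  let ?c = "1 - s + s\<^sup>2 * (real CARD('n) + a - 1) / 2"
  have "downdate s (Suc (Suc k)) A \<le> (\<integral>w. ?c * downdate s k (A - s *\<^sub>R outer_prod w) \<partial>P)"
    unfolding downdate.simps(2)[of s "Suc k"]
    by (intro integral_mono integrable_downdate integrable_mult_right s Suc.prems Suc.IH transpose_downdate)
  then show ?case by simp
qed

text \<open>The comparison holds for the innermost summand. It passes through each further
  integration because \<open>jump_avg\<close> averages translates of its argument, and translations
  commute with subtracting \<open>s *\<^sub>R outer_prod w\<close>.\<close>

lemma downdate_le_jumps:
  fixes m h1 h2 :: real
  assumes s: "0 \<le> s" and m: "0 < m"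
    and h1: "m * h1\<^sup>2 = s\<^sup>2" and h2: "m * h2\<^sup>2 = s\<^sup>2 * (a - 1) * real CARD('n)"
    and "transpose A = A"
  shows "downdate s (Suc k) A \<le> (1 - s - 2 * m) * downdate s k A + m * jump_avg h1 h2 (downdate s k) A"
  using assms(5)
proof (induction k arbitrary: A)
  case 0
  then show ?case
    using expectation_tr_exp_le_jumps[OF 0 s m h1 h2] by (simp add: jump_avg_def)
next
  case (Suc k)
  let ?D = "\<lambda>h y w. downdate s k (A + h *\<^sub>R outer_prod y - s *\<^sub>R outer_prod w)"
  have int: "integrable P (?D h y)" for h y
    by (intro integrable_downdate s) (use Suc.prems in \<open>simp add: transpose_simps\<close>)
  have D: "downdate s (Suc k) (A + h *\<^sub>R outer_prod y) = (\<integral>w. ?D h y w \<partial>P)" for h y by simp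
  have eqJ: "jump_avg h1 h2 (downdate s k) (A - s *\<^sub>R outer_prod w)
     = (\<Sum>y\<in>sign_vecs. (?D h1 y w + ?D (-h1) y w) / 2) / real (card (sign_vecs :: (real^'n) set))
      + (\<Sum>j\<in>UNIV. (?D h2 (axis j 1) w + ?D (-h2) (axis j 1) w) / 2) / real CARD('n)" for w
    unfolding jump_avg_def sign_avg_def by (simp add: algebra_simps)
  have intJ: "integrable P (\<lambda>w. jump_avg h1 h2 (downdate s k) (A - s *\<^sub>R outer_prod w))"
    unfolding eqJ by (intro Bochner_Integration.integrable_add integrable_divide Bochner_Integration.integrable_sum int)
  have J: "(\<integral>w. jump_avg h1 h2 (downdate s k) (A - s *\<^sub>R outer_prod w) \<partial>P) = jump_avg h1 h2 (downdate s (Suc k)) A"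
  proof -
    have "(\<integral>w. jump_avg h1 h2 (downdate s k) (A - s *\<^sub>R outer_prod w) \<partial>P)
      = (\<Sum>y\<in>sign_vecs. ((\<integral>w. ?D h1 y w \<partial>P) + (\<integral>w. ?D (-h1) y w \<partial>P)) / 2) / real (card (sign_vecs :: (real^'n) set))
      + (\<Sum>j\<in>UNIV. ((\<integral>w. ?D h2 (axis j 1) w \<partial>P) + (\<integral>w. ?D (-h2) (axis j 1) w \<partial>P)) / 2) / real CARD('n)"
      unfolding eqJ
      by (simp add: Bochner_Integration.integral_add Bochner_Integration.integral_sum int
          Bochner_Integration.integrable_add Bochner_Integration.integrable_sum del: scaleR_minus_left)
    also have "\<dots> = jump_avg h1 h2 (downdate s (Suc k)) A"
      unfolding D[symmetric] jump_avg_def sign_avg_def by simp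
    finally show ?thesis .
  qed
  have "downdate s (Suc (Suc k)) A \<le> (\<integral>w. (1 - s - 2 * m) * downdate s k (A - s *\<^sub>R outer_prod w)
     + m * jump_avg h1 h2 (downdate s k) (A - s *\<^sub>R outer_prod w) \<partial>P)"
    unfolding downdate.simps(2)[of s "Suc k"]
    by (intro integral_mono integrable_downdate Bochner_Integration.integrable_add integrable_mult_right
        s Suc.prems Suc.IH transpose_downdate intJ)
  also have "\<dots> = (1 - s - 2 * m) * downdate s (Suc k) A + m * jump_avg h1 h2 (downdate s (Suc k)) A"
    using integrable_downdate[OF s Suc.prems, of k] intJ J
    by (subst Bochner_Integration.integral_add) auto
  finally show ?case .
qed

text \<open>Mean of \<open>downdate s k A\<close> for \<open>k\<close> binomial with parameters
  \<open>N\<close> and \<open>p\<close>; \<open>Bernstein N k p\<close> is the binomial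
  weight.\<close>

definition thinned :: "real \<Rightarrow> real \<Rightarrow> nat \<Rightarrow> real^'n^'n \<Rightarrow> real" where
  "thinned s p N A = (\<Sum>k\<le>N. Bernstein N k p * downdate s k A)"

text \<open>Conditioning on one trial, that is, Pascal's rule for the binomial weights.\<close>

lemma thinned_Suc:
  "thinned s p (Suc N) A = (1 - p) * thinned s p N A + p * (\<Sum>k\<le>N. Bernstein N k p * downdate s (Suc k) A)"
proof -
  have B0: "Bernstein (Suc N) 0 p = (1 - p) * Bernstein N 0 p" by (simp add: Bernstein_def)
  have BS: "Bernstein (Suc N) (Suc k) p = (1 - p) * Bernstein N (Suc k) p + p * Bernstein N k p" if "k \<le> N" for k
  proof (cases "k = N")
    case False
    then have "N - k = Suc (N - Suc k)" using that by simp
    then show ?thesis by (simp add: Bernstein_def algebra_simps)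
  qed (simp add: Bernstein_def)
  have "thinned s p (Suc N) A = Bernstein (Suc N) 0 p * downdate s 0 A
     + (\<Sum>k\<le>N. Bernstein (Suc N) (Suc k) p * downdate s (Suc k) A)"
    unfolding thinned_def by (rule sum.atMost_Suc_shift)
  also have "(\<Sum>k\<le>N. Bernstein (Suc N) (Suc k) p * downdate s (Suc k) A)
    = (1 - p) * (\<Sum>k\<le>N. Bernstein N (Suc k) p * downdate s (Suc k) A) + p * (\<Sum>k\<le>N. Bernstein N k p * downdate s (Suc k) A)"
    unfolding sum_distrib_left sum.distrib[symmetric]
    by (intro sum.cong refl) (simp add: BS distrib_right mult.assoc del: downdate.simps)
  also have "Bernstein (Suc N) 0 p * downdate s 0 A
     + ((1 - p) * (\<Sum>k\<le>N. Bernstein N (Suc k) p * downdate s (Suc k) A) + p * (\<Sum>k\<le>N. Bernstein N k p * downdate s (Suc k) A))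
    = (1 - p) * (\<Sum>k\<le>Suc N. Bernstein N k p * downdate s k A) + p * (\<Sum>k\<le>N. Bernstein N k p * downdate s (Suc k) A)"
    unfolding B0 sum.atMost_Suc_shift[of _ N] by (simp add: distrib_left del: downdate.simps)
  also have "(\<Sum>k\<le>Suc N. Bernstein N k p * downdate s k A) = thinned s p N A"
    by (simp add: thinned_def Bernstein_def)
  finally show ?thesis .
qed

text \<open>With probability \<open>1 - p\<close> nothing is subtracted. This turns the coefficient
  \<open>1 - s - 2 * m\<close>, of either sign, into one that is nonnegative for small
  \<open>p\<close>, so that upper bounds can be inserted recursively.\<close>

lemma thinned_le_jumps:
  fixes m h1 h2 :: real
  assumes s: "0 \<le> s" and m: "0 < m"
    and h1: "m * h1\<^sup>2 = s\<^sup>2" and h2: "m * h2\<^sup>2 = s\<^sup>2 * (a - 1) * real CARD('n)"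
    and sym: "transpose A = A" and p: "0 \<le> p" "p \<le> 1"
  shows "thinned s p (Suc N) A \<le> (1 - p * (s + 2 * m)) * thinned s p N A + p * m * jump_avg h1 h2 (thinned s p N) A"
proof -
  have "(\<Sum>k\<le>N. Bernstein N k p * downdate s (Suc k) A)
    \<le> (\<Sum>k\<le>N. Bernstein N k p * ((1 - s - 2 * m) * downdate s k A + m * jump_avg h1 h2 (downdate s k) A))"
    by (intro sum_mono mult_left_mono downdate_le_jumps s m h1 h2 sym Bernstein_nonneg p)
  also have "\<dots> = (1 - s - 2 * m) * thinned s p N A + m * jump_avg h1 h2 (thinned s p N) A"
    unfolding thinned_def[abs_def] jump_avg_sum
    by (simp add: sum_distrib_left distrib_left sum.distrib mult_ac)
  finally have "p * (\<Sum>k\<le>N. Bernstein N k p * downdate s (Suc k) A)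
    \<le> p * ((1 - s - 2 * m) * thinned s p N A + m * jump_avg h1 h2 (thinned s p N) A)"
    using p by (intro mult_left_mono)
  then show ?thesis unfolding thinned_Suc by (simp add: algebra_simps)
qed

text \<open>\<open>downdate\<close> decreases in \<open>k\<close>, so it is enough that the binomial
  count is at most \<open>n\<close> with probability at least 1/2. Its variance is at most
  \<open>n\<close>, and its mean lies at least \<open>sqrt (2 * n)\<close> below
  \<open>n\<close>.\<close>

lemma thinned_ge:
  assumes s: "0 \<le> s" and sym: "transpose A = A" and p: "0 \<le> p" "p \<le> 1"
    and n: "0 < n" and Np: "real N * p \<le> real n - sqrt (2 * real n)"
  shows "downdate s n A \<le> 2 * thinned s p N A"
proof -
  define r where "r = real n - real N * p"
  \<comment> \<open>Chebyshev's inequality in pointwise form: \<open>?c k\<close> is at most 1, and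
    it is nonpositive for \<open>k > n\<close>.\<close>
  let ?c = "\<lambda>k. 1 - (real k - real N * p)\<^sup>2 / r\<^sup>2"
  have r: "sqrt (2 * real n) \<le> r" using Np by (simp add: r_def)
  have "0 < sqrt (2 * real n)" using n by simp
  then have r0: "0 < r" using r by linarith
  have r2: "2 * real n \<le> r\<^sup>2" using power_mono[OF r, of 2] by simp
  have var: "(\<Sum>k\<le>N. (real k - real N * p)\<^sup>2 * Bernstein N k p) = real N * p * (1 - p)"
  proof -
    have "(real k - real N * p)\<^sup>2 * Bernstein N k p = real k * (real k - 1) * Bernstein N k p
        + (1 - 2 * (real N * p)) * (real k * Bernstein N k p) + (real N * p)\<^sup>2 * Bernstein N k p" for k
      by (simp add: power2_eq_square algebra_simps)
    then have "(\<Sum>k\<le>N. (real k - real N * p)\<^sup>2 * Bernstein N k p) = real N * (real N - 1) * p\<^sup>2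
       + (1 - 2 * (real N * p)) * (real N * p) + (real N * p)\<^sup>2"
      by (simp add: sum.distrib sum_distrib_left[symmetric])
    then show ?thesis by (simp add: power2_eq_square algebra_simps)
  qed
  have "(\<Sum>k\<le>N. Bernstein N k p * ?c k) * downdate s n A \<le> thinned s p N A"
    unfolding thinned_def sum_distrib_right
  proof (intro sum_mono)
    fix k assume "k \<in> {..N}"
    have B: "0 \<le> Bernstein N k p" using p by (rule Bernstein_nonneg)
    show "Bernstein N k p * ?c k * downdate s n A \<le> Bernstein N k p * downdate s k A"
    proof (cases "k \<le> n")
      case True
      have "?c k * downdate s n A \<le> 1 * downdate s n A"
        using downdate_bounds[OF s sym, of n] by (intro mult_right_mono) auto
      also have "\<dots> \<le> downdate s k A" using downdate_antimono[OF s sym True] by simp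
      finally show ?thesis using B by (simp add: mult.assoc mult_left_mono)
    next
      case False
      then have "r \<le> real k - real N * p" by (simp add: r_def)
      then have "r\<^sup>2 \<le> (real k - real N * p)\<^sup>2" using r0 by (intro power_mono) auto
      then have "?c k \<le> 0" using r0 by simp
      then have "?c k * downdate s n A \<le> 0"
        using downdate_bounds[OF s sym, of n] by (simp add: mult_nonpos_nonneg)
      also have "\<dots> \<le> downdate s k A" using downdate_bounds[OF s sym] by blast
      finally show ?thesis using B by (simp add: mult.assoc mult_left_mono)
    qed
  qed
  also have "(\<Sum>k\<le>N. Bernstein N k p * ?c k) = 1 - real N * p * (1 - p) / r\<^sup>2"
  proof -
    have "(\<Sum>k\<le>N. Bernstein N k p * ?c k)
      = (\<Sum>k\<le>N. Bernstein N k p) - (\<Sum>k\<le>N. (real k - real N * p)\<^sup>2 * Bernstein N k p) / r\<^sup>2"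
      by (simp add: sum_subtractf[symmetric] sum_divide_distrib right_diff_distrib mult.commute del: sum_Bernstein)
    then show ?thesis by (simp add: var)
  qed
  finally have 1: "(1 - real N * p * (1 - p) / r\<^sup>2) * downdate s n A \<le> thinned s p N A" .
  have "real N * p * (1 - p) \<le> real N * p * 1" using p by (intro mult_left_mono) auto
  also have "\<dots> \<le> real n" using Np \<open>0 < sqrt (2 * real n)\<close> by linarith
  finally have "real N * p * (1 - p) / r\<^sup>2 \<le> 1/2" using r2 r0 n by (simp add: field_simps)
  then have "1/2 * downdate s n A \<le> (1 - real N * p * (1 - p) / r\<^sup>2) * downdate s n A"
    using downdate_bounds[OF s sym, of n] by (intro mult_right_mono) auto
  with 1 show ?thesis by linarith
qed

end

section \<open>Propagating the potential bound through the thinned steps\<close>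

lemma diag_mat_add_axis:
  "diag_mat D + h *\<^sub>R outer_prod (axis j 1) = diag_mat (D(j := D j + h))"
  by (auto simp: diag_mat_def outer_prod_def axis_def vec_eq_iff)

lemma sum_exp_fun_upd:
  "(\<Sum>i\<in>UNIV. exp ((D(j := D j + h)) i)) = (\<Sum>i\<in>UNIV. exp (D i)) + exp (D (j :: 'n::finite)) * (exp h - 1 :: real)"
  by (subst (1 2) sum.remove[of UNIV j]) (auto simp: exp_add algebra_simps)

context isotropic_law
begin

text \<open>\<open>\<gamma>\<close> is the growth of the bound per thinned step. A sign jump raises
  \<open>\<tau>\<close>, whence \<open>exp (q * \<Lambda>)\<close>, while the \<open>q\<close>-th
  power of the potential does not grow on average. A coordinate jump alters one \<open>D j\<close>;
  averaged over \<open>j\<close> and its sign it multiplies the sum of \<open>exp (D j)\<close> by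
  \<open>1 + (cosh h2 - 1) / d\<close>.\<close>

lemma thinned_le_potential:
  fixes m h2 s p q x c :: real and M :: "real^'n^'n"
  defines "\<Lambda> \<equiv> 51/100 * x\<^sup>2 * (40962/10000)"
    and "V \<equiv> measure lborel (cball (0 :: real^'n) (3/10))"
  defines "\<gamma> \<equiv> 1 - p * (s + 2 * m) + p * m * (exp (q * \<Lambda>) + (1 + ((exp h2 + exp (- h2)) / 2 - 1) / real CARD('n)))"
  assumes s: "0 \<le> s" and m: "0 < m"
    and h1: "m * (q * x)\<^sup>2 = s\<^sup>2" and h2: "m * h2\<^sup>2 = s\<^sup>2 * (a - 1) * real CARD('n)"
    and p: "0 \<le> p" "p \<le> 1" "p * (s + 2 * m) \<le> 1"
    and q: "0 \<le> q" "q \<le> 1" and x: "0 \<le> x" "5 * real CARD('n) * x \<le> 3/10"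
    and M: "\<And>i. M $ i $ i = 0" "transpose M = M"
  shows "thinned s p N ((q * x) *\<^sub>R (M + c *\<^sub>R mat 1) + diag_mat D)
     \<le> \<gamma> ^ N * ((exp (real \<tau> * \<Lambda>) * potential x \<tau> M c / V) powr q * (\<Sum>j\<in>UNIV. exp (D j)))"
  using M
proof (induction N arbitrary: M c D \<tau>)
  case 0
  then show ?case
    using tr_exp_le_potential[of M q x c D \<tau>] q
    by (simp add: thinned_def Bernstein_def \<Lambda>_def V_def)
next
  case (Suc N)
  have V: "0 < V" by (simp add: V_def)
  let ?A = "(q * x) *\<^sub>R (M + c *\<^sub>R mat 1) + diag_mat D"
  let ?X = "\<lambda>\<tau> M c. (exp (real \<tau> * \<Lambda>) * potential x \<tau> M c / V) powr q"
  let ?S = "\<Sum>j\<in>UNIV. exp (D j)"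
  let ?ch = "(exp h2 + exp (- h2)) / 2"
  let ?T = "\<lambda>h y. (thinned s p N (?A + h *\<^sub>R outer_prod y) + thinned s p N (?A - h *\<^sub>R outer_prod y)) / 2"
  have S: "0 \<le> ?S" by (intro sum_nonneg) auto
  have \<gamma>: "0 \<le> \<gamma>"
  proof -
    have "1 \<le> ?ch" using add_mono[OF exp_ge_add_one_self[of h2] exp_ge_add_one_self[of "- h2"]] by simp
    then show ?thesis unfolding \<gamma>_def using p m by (intro add_nonneg_nonneg mult_nonneg_nonneg) auto
  qed
  have symA: "transpose ?A = ?A" using Suc.prems by (simp add: transpose_simps)
  have J1: "sign_avg (\<lambda>y. ?T (q * x) y)
     \<le> \<gamma> ^ N * (exp (q * \<Lambda>) * (?X \<tau> M c * ?S))"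
  proof -
    let ?Y = "\<lambda>\<sigma> y. potential x (Suc \<tau>) (M + \<sigma> *\<^sub>R (outer_prod y - mat 1)) (c + \<sigma>)"
    let ?k = "\<gamma> ^ N * ((exp (real (Suc \<tau>) * \<Lambda>) / V) powr q * ?S)"
    have diag: "(M + \<sigma> *\<^sub>R (outer_prod y - mat 1)) $ i $ i = 0"
      if "y \<in> sign_vecs" for \<sigma> y i
      using Suc.prems sign_vecs_square[OF that] by (simp add: outer_prod_def mat_def)
    have sym: "transpose (M + \<sigma> *\<^sub>R (outer_prod y - mat 1)) = M + \<sigma> *\<^sub>R (outer_prod y - mat 1)" for \<sigma> y
      using Suc.prems by (simp add: transpose_simps)
    have pos: "0 < ?Y \<sigma> y" if "y \<in> sign_vecs" for \<sigma> y
      by (rule potential_pos[OF diag[OF that] sym])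
    have T: "thinned s p N (?A + (\<sigma> * (q * x)) *\<^sub>R outer_prod y) \<le> ?k * ?Y \<sigma> y powr q" if y: "y \<in> sign_vecs" for \<sigma> y
    proof -
      have "?A + (\<sigma> * (q * x)) *\<^sub>R outer_prod y
        = (q * x) *\<^sub>R ((M + \<sigma> *\<^sub>R (outer_prod y - mat 1)) + (c + \<sigma>) *\<^sub>R mat 1) + diag_mat D"
        by (simp add: algebra_simps)
      then have "thinned s p N (?A + (\<sigma> * (q * x)) *\<^sub>R outer_prod y)
        \<le> \<gamma> ^ N * ((exp (real (Suc \<tau>) * \<Lambda>) * ?Y \<sigma> y / V) powr q * ?S)"
        using Suc.IH[OF diag[OF y] sym, of \<sigma> "c + \<sigma>" D "Suc \<tau>"] by (simp only:)
      also have "exp (real (Suc \<tau>) * \<Lambda>) * ?Y \<sigma> y / V = exp (real (Suc \<tau>) * \<Lambda>) / V * ?Y \<sigma> y" by simp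
      also have "\<dots> powr q = (exp (real (Suc \<tau>) * \<Lambda>) / V) powr q * ?Y \<sigma> y powr q"
        by (rule powr_mult)
      finally show ?thesis by (simp only: mult_ac)
    qed
    have "sign_avg (\<lambda>y. ?T (q * x) y)
      \<le> sign_avg (\<lambda>y. ?k * ((?Y 1 y powr q + ?Y (-1) y powr q) / 2))"
    proof (intro sign_avg_mono)
      fix y :: "real^'n" assume y: "y \<in> sign_vecs"
      show "?T (q * x) y
         \<le> ?k * ((?Y 1 y powr q + ?Y (-1) y powr q) / 2)"
      proof -
        have "thinned s p N (?A + (q * x) *\<^sub>R outer_prod y) \<le> ?k * ?Y 1 y powr q" using T[OF y, of 1] by simp
        moreover have "thinned s p N (?A - (q * x) *\<^sub>R outer_prod y) \<le> ?k * ?Y (-1) y powr q" using T[OF y, of "-1"] by simp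
        ultimately have "?T (q * x) y
          \<le> (?k * ?Y 1 y powr q + ?k * ?Y (-1) y powr q) / 2" by (intro divide_right_mono add_mono) auto
        then show ?thesis by (simp only: distrib_left times_divide_eq_right)
      qed
    qed
    also have "\<dots> = ?k * sign_avg (\<lambda>y. (?Y 1 y powr q + ?Y (-1) y powr q) / 2)" by (rule sign_avg_cmult)
    also have "\<dots> \<le> ?k * potential x \<tau> M c powr q"
    proof (intro mult_left_mono sign_avg_powr_le q)
      show "sign_avg (\<lambda>y. (?Y 1 y + ?Y (-1) y) / 2) \<le> potential x \<tau> M c"
        using potential_jump[OF x, of \<tau> M c]
        by (simp only: scaleR_one scaleR_minus1_left add_uminus_conv_diff)
      show "0 < potential x \<tau> M c" by (rule potential_pos[OF Suc.prems])
      show "0 \<le> ?k" using \<gamma> S by simp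
    qed (rule pos, assumption)+
    also have "\<dots> = \<gamma> ^ N * (exp (q * \<Lambda>) * (?X \<tau> M c * ?S))"
    proof -
      have "exp (real (Suc \<tau>) * \<Lambda>) / V = exp \<Lambda> * (exp (real \<tau> * \<Lambda>) / V)" by (simp add: distrib_right exp_add)
      then have "(exp (real (Suc \<tau>) * \<Lambda>) / V) powr q = exp \<Lambda> powr q * (exp (real \<tau> * \<Lambda>) / V) powr q"
        by (simp only: powr_mult)
      also have "exp \<Lambda> powr q = exp (q * \<Lambda>)" by (simp add: exp_powr_real mult.commute)
      finally have e1: "(exp (real (Suc \<tau>) * \<Lambda>) / V) powr q = exp (q * \<Lambda>) * (exp (real \<tau> * \<Lambda>) / V) powr q" .
      have e2: "(exp (real \<tau> * \<Lambda>) / V) powr q * potential x \<tau> M c powr q = ?X \<tau> M c"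
        by (subst powr_mult[symmetric]) simp
      show ?thesis unfolding e1 e2[symmetric] by (simp only: mult_ac)
    qed
    finally show ?thesis .
  qed
  have J2: "(\<Sum>j\<in>UNIV. ?T h2 (axis j 1)) / real CARD('n)
     \<le> \<gamma> ^ N * ((1 + (?ch - 1) / real CARD('n)) * (?X \<tau> M c * ?S))"
  proof -
    have T: "thinned s p N (?A + h *\<^sub>R outer_prod (axis j 1)) \<le> \<gamma> ^ N * ?X \<tau> M c * (?S + exp (D j) * (exp h - 1))" for h j
      using Suc.IH[OF Suc.prems, of c "D(j := D j + h)" \<tau>]
      by (simp add: add.assoc diag_mat_add_axis sum_exp_fun_upd mult.assoc del: fun_upd_apply)
    have "(\<Sum>j\<in>UNIV. ?T h2 (axis j 1))
      \<le> (\<Sum>j\<in>UNIV. \<gamma> ^ N * ?X \<tau> M c * (?S + exp (D j) * (?ch - 1)))"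
    proof (intro sum_mono)
      fix j
      have "?T h2 (axis j 1)
        \<le> (\<gamma> ^ N * ?X \<tau> M c * (?S + exp (D j) * (exp h2 - 1)) + \<gamma> ^ N * ?X \<tau> M c * (?S + exp (D j) * (exp (- h2) - 1))) / 2"
        using T[of h2 j] T[of "- h2" j] by (intro divide_right_mono add_mono) auto
      also have "(k * (r + e * (u - 1)) + k * (r + e * (w - 1))) / 2 = k * (r + e * ((u + w) / 2 - 1))" for k r e u w :: real
        by (simp add: field_simps)
      finally show "?T h2 (axis j 1)
        \<le> \<gamma> ^ N * ?X \<tau> M c * (?S + exp (D j) * (?ch - 1))" .
    qed
    also have "\<dots> = \<gamma> ^ N * ?X \<tau> M c * (real CARD('n) * ?S + ?S * (?ch - 1))"
      unfolding sum_distrib_left[symmetric] sum.distrib sum_distrib_right[symmetric] by simp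
    finally have "(\<Sum>j\<in>UNIV. ?T h2 (axis j 1)) / real CARD('n)
      \<le> \<gamma> ^ N * ?X \<tau> M c * (real CARD('n) * ?S + ?S * (?ch - 1)) / real CARD('n)"
      by (rule divide_right_mono) simp
    also have "g * X * (n * S + S * e) / n = g * ((1 + e / n) * (X * S))" if "n > 0" for g X n S e :: real
      using that by (simp add: field_simps)
    finally show ?thesis by simp
  qed
  have "thinned s p (Suc N) ?A \<le> (1 - p * (s + 2 * m)) * thinned s p N ?A + p * m * jump_avg (q * x) h2 (thinned s p N) ?A"
    by (rule thinned_le_jumps[OF s m h1 h2 symA p(1,2)])
  also have "\<dots> \<le> (1 - p * (s + 2 * m)) * (\<gamma> ^ N * (?X \<tau> M c * ?S))
     + p * m * (\<gamma> ^ N * (exp (q * \<Lambda>) * (?X \<tau> M c * ?S)) + \<gamma> ^ N * ((1 + (?ch - 1) / real CARD('n)) * (?X \<tau> M c * ?S)))"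
    unfolding jump_avg_def using p m
    by (intro add_mono mult_left_mono J1 J2 Suc.IH[OF Suc.prems]) auto
  also have "\<dots> = \<gamma> ^ Suc N * (?X \<tau> M c * ?S)"
  proof -
    have "r * (g * Z) + t * (g * (e * Z) + g * (f * Z)) = ((r + t * (e + f)) * g) * Z" for r g Z t e f :: real
      by (simp add: algebra_simps)
    then show ?thesis unfolding power_Suc \<gamma>_def .
  qed
  finally show ?case .
qed

section \<open>Choice of parameters and numerical constants\<close>

lemma content_cball_ratio:
  "measure lborel (cball (0 :: real^'n) (13/10)) / measure lborel (cball (0 :: real^'n) (3/10)) = (13/3) ^ CARD('n)"
proof -
  have "measure lborel (cball (0 :: real^'n) r) = unit_ball_vol (real CARD('n)) * r ^ CARD('n)" if "0 \<le> r" for r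
    using content_cball[OF that, of "0 :: real^'n"] by simp
  then show ?thesis by (simp add: unit_ball_vol_pos[THEN less_imp_neq, symmetric] power_divide[symmetric] flip: power_divide)
qed


text \<open>Here \<open>m\<close> is the number of jumps per summand, so large that every jump is in the quadratic regime,
  and \<open>p\<close> is the thinning probability, so small that the comparison operator is positive.\<close>

lemma downdate_le_exp:
  assumes s: "0 < s" and X: "s \<le> X" and n: "144 \<le> n"
  shows "downdate s n 0 \<le> 2 * real CARD('n) * exp (- s * real n + 3/2 * s * sqrt (real n)
     + s / X * real CARD('n) * ln (13/3) + real n * (211/100 * s * X + 51/100 * s\<^sup>2 * a))"
proof -
  let ?E = "- s * real n + 3/2 * s * sqrt (real n) + real n * (211/100 * s * X + 51/100 * s\<^sup>2 * a)"
  define d where "d = real CARD('n)"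
  have d: "1 \<le> d" by (simp add: d_def Suc_le_eq)
  define q where "q = s / X"
  have X0: "0 < X" using s X by simp
  have q: "0 \<le> q" "q \<le> 1" "q * X = s" using s X X0 by (auto simp: q_def)
  \<comment> \<open>The first summand gives the smallness of \<open>x\<close> demanded by the sign
    jumps, the second gives \<open>h2\<^sup>2\<close> at most 1/100, the third gives
    \<open>x\<^sup>2\<close> at most 1/1000 and so \<open>q * \<Lambda>\<close> at most 1/100, and
    the last makes \<open>m\<close> positive.\<close>
  define m where "m = (50 * d * X)\<^sup>2 + 100 * s\<^sup>2 * a * d + 1000 * X\<^sup>2 + 1"
  have nn: "0 \<le> (50 * d * X)\<^sup>2" "0 \<le> 100 * s\<^sup>2 * a * d" "0 \<le> 1000 * X\<^sup>2" using d a_ge_1 by auto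
  have m: "0 < m" "(50 * d * X)\<^sup>2 \<le> m" "100 * s\<^sup>2 * a * d \<le> m" "1000 * X\<^sup>2 \<le> m"
    using nn unfolding m_def by linarith+
  define x where "x = X / sqrt m"
  have x2: "m * x\<^sup>2 = X\<^sup>2" using m(1) by (simp add: x_def power_divide)
  have x: "0 \<le> x" "5 * real CARD('n) * x \<le> 3/10"
  proof -
    show "0 \<le> x" using X0 m(1) by (simp add: x_def)
    have "50 * d * X \<le> sqrt m" using m(2) by (rule real_le_rsqrt)
    then have "5 * d * X \<le> 3/10 * sqrt m" using real_sqrt_ge_zero[of m] m(1) by linarith
    then show "5 * real CARD('n) * x \<le> 3/10" using m(1) by (simp add: x_def d_def[symmetric] field_simps)
  qed
  define h2 where "h2 = sqrt (s\<^sup>2 * (a - 1) * d / m)"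
  have h2sq: "h2\<^sup>2 = s\<^sup>2 * (a - 1) * d / m" unfolding h2_def using a_ge_1 d m(1) by (intro real_sqrt_pow2) auto
  then have h2: "m * h2\<^sup>2 = s\<^sup>2 * (a - 1) * real CARD('n)" using m(1) by (simp add: d_def)
  have h2le: "\<bar>h2\<bar> \<le> 3/10"
  proof -
    have "s\<^sup>2 * (a - 1) * d \<le> s\<^sup>2 * a * d" using d by (intro mult_right_mono mult_left_mono) auto
    then have "h2\<^sup>2 \<le> 1/100" unfolding h2sq using m by (simp add: divide_le_eq)
    then have "h2\<^sup>2 \<le> (3/10)\<^sup>2" by (simp add: power2_eq_square)
    then show ?thesis by (metis abs_ge_zero abs_le_square_iff abs_of_nonneg divide_nonneg_nonneg zero_le_numeral)
  qed
  have h1: "m * (q * x)\<^sup>2 = s\<^sup>2"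
  proof -
    have "m * (q * x)\<^sup>2 = q\<^sup>2 * (m * x\<^sup>2)" by (simp add: power_mult_distrib)
    also have "\<dots> = (q * X)\<^sup>2" by (simp add: x2 power_mult_distrib)
    finally show ?thesis by (simp add: q(3))
  qed
  define p where "p = 1 / (s + 2 * m + 1)"
  have p: "0 < p" "p \<le> 1" "p * (s + 2 * m) \<le> 1" using s m(1) by (auto simp: p_def field_simps)
  define \<Lambda> where "\<Lambda> = 51/100 * x\<^sup>2 * (40962/10000)"
  define ch where "ch = (exp h2 + exp (- h2)) / 2"
  define \<gamma> where "\<gamma> = 1 - p * (s + 2 * m) + p * m * (exp (q * \<Lambda>) + (1 + (ch - 1) / d))"
  define b where "b = m * (exp (q * \<Lambda>) - 1) + m * ((ch - 1) / d)"
  have \<gamma>b: "\<gamma> - 1 = p * (b - s)" by (simp add: \<gamma>_def b_def algebra_simps)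
  have ch1: "1 \<le> ch"
    using add_mono[OF exp_ge_add_one_self[of h2] exp_ge_add_one_self[of "- h2"]] by (simp add: ch_def)
  have \<Lambda>0: "0 \<le> \<Lambda>" by (simp add: \<Lambda>_def)
  have b0: "0 \<le> b" unfolding b_def using m(1) ch1 d q \<Lambda>0 by (intro add_nonneg_nonneg mult_nonneg_nonneg divide_nonneg_nonneg) auto
  have \<gamma>0: "0 \<le> \<gamma>"
    unfolding \<gamma>_def using p m ch1 d by (intro add_nonneg_nonneg mult_nonneg_nonneg divide_nonneg_nonneg) auto
  have ble: "b \<le> 211/100 * s * X + 51/100 * s\<^sup>2 * a"
  proof -
    have qL: "q * \<Lambda> \<le> 1/100"
    proof -
      have "x\<^sup>2 = X\<^sup>2 / m" using x2 m(1) by (simp add: field_simps)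
      then have "x\<^sup>2 \<le> 1/1000" using m(1,4) by (simp add: divide_le_eq)
      then have "\<Lambda> \<le> 51/100 * (1/1000) * (40962/10000)" unfolding \<Lambda>_def by (intro mult_mono) auto
      also have "\<dots> \<le> 1/100" by simp
      finally have "\<Lambda> \<le> 1/100" .
      then show ?thesis using q \<Lambda>0 mult_mono[of q 1 \<Lambda> "1/100"] by simp
    qed
    have t0: "0 \<le> q * \<Lambda>" using q \<Lambda>0 by simp
    have "exp (q * \<Lambda>) \<le> 1 + q * \<Lambda> + (q * \<Lambda>)\<^sup>2" using qL t0 by (intro exp_bound) auto
    also have "(q * \<Lambda>)\<^sup>2 \<le> 1/100 * (q * \<Lambda>)" unfolding power2_eq_square using qL t0 by (intro mult_right_mono)
    finally have "exp (q * \<Lambda>) - 1 \<le> 101/100 * (q * \<Lambda>)" by linarith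
    then have "m * (exp (q * \<Lambda>) - 1) \<le> m * (101/100 * (q * \<Lambda>))" using m by (intro mult_left_mono) auto
    also have "\<dots> = 101/100 * (51/100) * (40962/10000) * (q * (m * x\<^sup>2))" by (simp add: \<Lambda>_def)
    also have "q * (m * x\<^sup>2) = s * X" unfolding x2 using q(3) by (simp add: power2_eq_square)
    \<comment> \<open>The product 1.01 * 0.51 * 4.0962 is just below 2.11.\<close>
    also have "101/100 * (51/100) * (40962/10000) * (s * X) \<le> 211/100 * (s * X)"
      using s X0 by (intro mult_right_mono) auto
    finally have 1: "m * (exp (q * \<Lambda>) - 1) \<le> 211/100 * s * X" by simp
    have "ch - 1 \<le> 51/100 * h2\<^sup>2" using cosh_le_quadratic[OF h2le] unfolding ch_def[symmetric] by linarith
    then have "m * ((ch - 1) / d) \<le> m * ((51/100 * h2\<^sup>2) / d)"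
      using m d by (intro mult_left_mono divide_right_mono) auto
    also have "\<dots> = 51/100 * (m * h2\<^sup>2) / d" by simp
    also have "\<dots> = 51/100 * s\<^sup>2 * (a - 1)" unfolding h2 d_def by simp
    also have "\<dots> \<le> 51/100 * s\<^sup>2 * a" by (intro mult_left_mono) auto
    finally show ?thesis unfolding b_def using 1 by linarith
  qed
  have sqn: "12 \<le> sqrt (real n)" by (rule real_le_rsqrt) (use n in simp)
  have s2n: "sqrt (2 * real n) \<le> 1415/1000 * sqrt (real n)"
  proof -
    have "sqrt 2 \<le> 1415/1000" by (rule real_le_lsqrt) (simp_all add: power2_eq_square)
    then show ?thesis unfolding real_sqrt_mult by (intro mult_right_mono) auto
  qed
  have nsq: "sqrt (real n) * sqrt (real n) = real n" by simp
  have "12 * sqrt (real n) \<le> sqrt (real n) * sqrt (real n)" using sqn by (intro mult_right_mono) auto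
  then have pos: "0 \<le> real n - sqrt (2 * real n)" using s2n sqn nsq by linarith
  \<comment> \<open>The largest \<open>N\<close> with mean \<open>N * p\<close> at most
    \<open>n - sqrt (2 * n)\<close>; rounding loses at most \<open>p\<close>.\<close>
  define N where "N = nat \<lfloor>(real n - sqrt (2 * real n)) / p\<rfloor>"
  have Nle: "real N * p \<le> real n - sqrt (2 * real n)"
  proof -
    have "real N \<le> (real n - sqrt (2 * real n)) / p"
      unfolding N_def using pos p by (simp add: of_nat_nat)
    then show ?thesis using p by (simp add: field_simps)
  qed
  have Nge: "real n - sqrt (2 * real n) - p \<le> real N * p"
  proof -
    have "(real n - sqrt (2 * real n)) / p - 1 \<le> real N"
      unfolding N_def using pos p by (simp add: of_nat_nat)
    then show ?thesis using p by (simp add: field_simps)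
  qed
  have "thinned s p N ((q * x) *\<^sub>R (0 + 0 *\<^sub>R mat 1) + diag_mat (\<lambda>_. 0))
     \<le> \<gamma> ^ N * ((exp (real 0 * \<Lambda>) * potential x 0 (0 :: real^'n^'n) 0 / measure lborel (cball (0 :: real^'n) (3/10))) powr q
         * (\<Sum>j\<in>(UNIV :: 'n set). exp 0))"
    unfolding \<gamma>_def \<Lambda>_def ch_def d_def
    by (rule thinned_le_potential) (use s m h1 h2 p q x in \<open>auto simp: transpose_def vec_eq_iff\<close>)
  moreover have "(q * x) *\<^sub>R (0 + 0 *\<^sub>R mat 1) + diag_mat (\<lambda>_. 0) = (0 :: real^'n^'n)"
    by (simp add: diag_mat_def vec_eq_iff)
  ultimately have "thinned s p N 0 \<le> \<gamma> ^ N * (((13/3) ^ CARD('n)) powr q * d)"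
    by (simp add: potential_0 content_cball_ratio d_def)
  also have "((13/3 :: real) ^ CARD('n)) powr q = exp (q * d * ln (13/3))"
    by (simp add: powr_def ln_realpow d_def)
  also have "\<gamma> ^ N \<le> exp (real N * (\<gamma> - 1))"
  proof -
    have "\<gamma> \<le> exp (\<gamma> - 1)" using exp_ge_add_one_self[of "\<gamma> - 1"] by simp
    then have "\<gamma> ^ N \<le> exp (\<gamma> - 1) ^ N" using \<gamma>0 by (intro power_mono)
    then show ?thesis by (simp add: exp_of_nat_mult)
  qed
  also have "real N * (\<gamma> - 1) \<le> ?E"
  proof -
    \<comment> \<open>The gap between 1.5 and 1.415, times \<open>sqrt n\<close>, has to absorb
      \<open>p\<close>, which is at most 1: with \<open>n\<close> at least 144 it is at least
      1.02.\<close>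
    have "sqrt (2 * real n) + p \<le> 3/2 * sqrt (real n)" using s2n sqn p by linarith
    then have "real n - 3/2 * sqrt (real n) \<le> real N * p" using Nge by linarith
    then have "s * (real n - 3/2 * sqrt (real n)) \<le> s * (real N * p)" using s by (intro mult_left_mono) auto
    moreover have "(real N * p) * b \<le> real n * (211/100 * s * X + 51/100 * s\<^sup>2 * a)"
    proof (intro mult_mono ble)
      show "real N * p \<le> real n" using Nle real_sqrt_ge_zero[of "2 * real n"] by linarith
    qed (use b0 in auto)
    moreover have "real N * (\<gamma> - 1) = (real N * p) * b - s * (real N * p)" unfolding \<gamma>b by (simp add: algebra_simps)
    ultimately show ?thesis by (simp add: algebra_simps)
  qed
  finally have "thinned s p N 0 \<le> exp (?E)
      * (exp (q * d * ln (13/3)) * d)" using d by simp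
  moreover have "downdate s n 0 \<le> 2 * thinned s p N 0"
    by (rule thinned_ge) (use s p n Nle in \<open>auto simp: transpose_def vec_eq_iff\<close>)
  ultimately have "downdate s n 0 \<le> 2 * (exp (?E)
      * (exp (q * d * ln (13/3)) * d))" by linarith
  also have "\<dots> = 2 * d * exp (- s * real n + 3/2 * s * sqrt (real n)
     + q * d * ln (13/3) + real n * (211/100 * s * X + 51/100 * s\<^sup>2 * a))"
    by (simp add: exp_add mult_ac)
  finally show ?thesis by (simp add: q_def d_def)
qed

end

text \<open>With \<open>Y = s sqrt (n B)\<close>, the terms on the left are at most \<open>-5 Y\<close>, \<open>0.307 Y\<close>, \<open>1.784 Y\<close>,
  \<open>1.752 Y\<close> and \<open>0.408 Y\<close>, and \<open>L \<le> 0.625 Y\<close>; the constants in \<open>s\<close> and \<open>X\<close> are chosen to make the sum negative.\<close>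

lemma exponent_bound:
  fixes n d a L \<epsilon> B :: real
  assumes a: "1 \<le> a" and L: "12 < L" and B: "d \<le> B" "2 * a * L \<le> B" and d: "0 \<le> d"
    and \<epsilon>: "0 < \<epsilon>" "\<epsilon> < 1" and n: "25 * B \<le> n * \<epsilon>\<^sup>2"
  defines "s \<equiv> 8/10 * sqrt (2 * L / (n * a))" and "X \<equiv> 83/100 * sqrt (B / n)"
  shows "0 < s" "s \<le> X" "144 \<le> n"
    "s * n * (1 - \<epsilon>) + (- s * n + 3/2 * s * sqrt n + s / X * d * ln (13/3) + n * (211/100 * s * X + 51/100 * s\<^sup>2 * a)) \<le> - L" (is "?E \<le> _")
proof -
  have aL: "L \<le> a * L" using a L by simp
  have B24: "24 \<le> B" using B(2) aL L by linarith
  have "\<epsilon>\<^sup>2 \<le> 1" using \<epsilon> by (simp add: power_le_one)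
  have n0: "0 < n"
  proof (rule ccontr)
    assume "\<not> 0 < n"
    then have "n * \<epsilon>\<^sup>2 \<le> 0" by (simp add: mult_nonpos_nonneg)
    then show False using n B24 by linarith
  qed
  have "n * \<epsilon>\<^sup>2 \<le> n * 1" using n0 \<open>\<epsilon>\<^sup>2 \<le> 1\<close> by (intro mult_left_mono) auto
  then show n144: "144 \<le> n" using n B24 by linarith
  show s0: "0 < s" unfolding s_def using n0 a L by simp
  have X0: "0 < X" unfolding X_def using n0 B24 by simp
  have s2: "s\<^sup>2 = 64/100 * (2 * L / (n * a))" unfolding s_def using n0 a L by (simp add: power_mult_distrib power2_eq_square)
  have X2: "X\<^sup>2 = 6889/10000 * (B / n)" unfolding X_def using n0 B24 by (simp add: power_mult_distrib power2_eq_square)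
  show "s \<le> X"
  proof (rule power2_le_imp_le)
    have "2 * L / (n * a) \<le> 2 * L / (n * 1)" using n0 a L by (intro divide_left_mono mult_left_mono) auto
    also have "\<dots> \<le> B / n" using n0 B(2) aL by (simp add: divide_right_mono)
    finally have "64/100 * (2 * L / (n * a)) \<le> 64/100 * (B / n)" by (rule mult_left_mono) simp
    also have "\<dots> \<le> 6889/10000 * (B / n)" using n0 B24 by (intro mult_right_mono) auto
    finally show "s\<^sup>2 \<le> X\<^sup>2" unfolding s2 X2 .
  qed (use X0 in simp)
  define r where "r = sqrt n"
  define b where "b = sqrt B"
  have r: "0 < r" "r * r = n" using n0 by (auto simp: r_def)
  have b: "0 < b" "b * b = B" using B24 by (auto simp: b_def)
  have b489: "489/100 \<le> b" unfolding b_def by (rule real_le_rsqrt) (use B24 in \<open>simp add: power2_eq_square\<close>)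
  have Xr: "X = 83/100 * (b / r)" by (simp add: X_def b_def r_def real_sqrt_divide)
  define Y where "Y = s * r * b"
  have Y0: "0 < Y" using s0 r b by (simp add: Y_def)
  \<comment> \<open>\<open>Y\<^sup>2\<close> is \<open>1.28 * L * B / a\<close>, and
    \<open>B\<close> is at least \<open>2 * a * L\<close>; the result is
    \<open>2.56 * L\<^sup>2\<close>.\<close>
  have YL: "16/10 * L \<le> Y"
  proof (rule power2_le_imp_le)
    have "Y\<^sup>2 = s\<^sup>2 * (r * r) * (b * b)" by (simp add: Y_def power2_eq_square)
    also have "\<dots> = 64/100 * 2 * L / a * B" unfolding s2 r b using n0 by simp
    also have "\<dots> \<ge> 64/100 * 2 * L / a * (2 * a * L)" using B a L by (intro mult_left_mono) auto
    finally show "(16/10 * L)\<^sup>2 \<le> Y\<^sup>2" using a by (simp add: power2_eq_square)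
  qed (use Y0 in simp)
  have e1: "5 * Y \<le> s * n * \<epsilon>"
  proof -
    \<comment> \<open>The 5 is the square root of the 25 in the sample size.\<close>
    have "5 * b \<le> r * \<epsilon>"
    proof (rule power2_le_imp_le)
      show "(5 * b)\<^sup>2 \<le> (r * \<epsilon>)\<^sup>2" using n r b by (simp add: power2_eq_square power_mult_distrib algebra_simps)
    qed (use r \<epsilon> in simp)
    then have "s * r * (5 * b) \<le> s * r * (r * \<epsilon>)" using s0 r by (intro mult_left_mono) auto
    then show ?thesis by (simp add: Y_def r(2)[symmetric] mult_ac)
  qed
  have e2: "3/2 * s * sqrt n \<le> 307/1000 * Y"
  proof -
    have "3/2 \<le> 307/1000 * b" using b489 by linarith
    then have "(s * r) * (3/2) \<le> (s * r) * (307/1000 * b)" using s0 r by (intro mult_left_mono) auto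
    then show ?thesis by (simp add: Y_def r_def mult_ac)
  qed
  \<comment> \<open>The eighth power of 1.202 is just above 13/3, and 8 times 0.185 is 1.48.\<close>
  have ln: "ln (13/3) \<le> (148/100 :: real)"
  proof -
    have "1 + 185/1000 + (185/1000)\<^sup>2 / 2 \<le> exp (185/1000 :: real)" by (rule exp_lower_Taylor_quadratic) simp
    then have "(1202/1000 :: real) \<le> exp (185/1000)" by (simp add: power2_eq_square)
    then have "(1202/1000 :: real) ^ 8 \<le> exp (185/1000) ^ 8" by (intro power_mono) auto
    also have "\<dots> = exp (148/100)" by (simp flip: exp_of_nat_mult)
    finally have "(13/3 :: real) \<le> exp (148/100)" by (rule order_trans[rotated]) (simp add: power_divide)
    then have "ln (13/3 :: real) \<le> ln (exp (148/100))" by (subst ln_le_cancel_iff) auto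
    then show ?thesis by simp
  qed
  have e3: "s / X * d * ln (13/3) \<le> 1784/1000 * Y"
  proof -
    have "s / X * d * ln (13/3) \<le> s / X * B * (148/100)"
      using s0 X0 B d B24 ln by (intro mult_mono) auto
    also have "s / X * B = 100/83 * Y"
      unfolding Xr Y_def b(2)[symmetric] using r b by (simp add: field_simps)
    finally show ?thesis using Y0 by simp
  qed
  have e4: "n * (211/100 * s * X) = 211/100 * (83/100) * Y"
    unfolding Xr Y_def r(2)[symmetric] using r(1) by simp
  have e5: "n * (51/100 * s\<^sup>2 * a) = 51/100 * (64/100) * 2 * L"
    unfolding s2 using n0 a by simp
  show "?E \<le> - L"
  proof -
    have "?E
      = - (s * n * \<epsilon>) + 3/2 * s * sqrt n + s / X * d * ln (13/3) + n * (211/100 * s * X) + n * (51/100 * s\<^sup>2 * a)"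
      by (simp add: algebra_simps)
    then show ?thesis unfolding e4 e5 using e1 e2 e3 YL Y0 by linarith
  qed
qed

subsection \<open>Independent samples\<close>

lemma (in prob_space) indep_vars_reindex:
  assumes "indep_vars M' X I" "inj_on f J" "f ` J \<subseteq> I"
  shows "indep_vars (\<lambda>j. M' (f j)) (\<lambda>j. X (f j)) J"
proof -
  have "indep_vars (\<lambda>j. PiM {f j} M') (\<lambda>j \<omega>. restrict (\<lambda>i. X i \<omega>) {f j}) J"
    using assms by (intro indep_vars_restrict[OF assms(1)]) (auto simp: disjoint_family_on_def inj_on_def)
  then have "indep_vars (\<lambda>j. M' (f j)) (\<lambda>j \<omega>. (\<lambda>h. h (f j)) (restrict (\<lambda>i. X i \<omega>) {f j})) J"
    by (rule indep_vars_compose2) (rule measurable_component_singleton, simp)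
  then show ?thesis by simp
qed

lemma transpose_sum: "transpose (\<Sum>i\<in>I. f i) = (\<Sum>i\<in>I. transpose (f i :: real^'n^'m))"
  by (induction I rule: infinite_finite_induct) (auto simp: transpose_add transpose_def vec_eq_iff)

lemma tr_exp_sum_outer_prod_le:
  fixes A :: "real^'n^'n" and w :: "nat \<Rightarrow> real^'n"
  assumes "transpose A = A" "0 \<le> s"
  shows "tr_exp (A - s *\<^sub>R (\<Sum>i<k. outer_prod (w i))) \<le> tr_exp A"
proof (induction k)
  case (Suc k)
  let ?A = "A - s *\<^sub>R (\<Sum>i<k. outer_prod (w i))"
  have sym: "transpose ?A = ?A" using assms by (simp add: transpose_simps transpose_sum)
  obtain B l where "eigenbasis ?A B l" using symmetric_eigenbasis_exists[OF sym] by blast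
  then have "tr_exp (?A - s *\<^sub>R outer_prod (w k)) \<le> tr_exp ?A"
    by (rule tr_exp_rank_one_downdate(2)[OF _ sym assms(2)])
  then show ?case using Suc by (simp add: algebra_simps)
qed simp

locale isotropic_sample = prob_space M + law: isotropic_law P a
  for M :: "'b measure" and P :: "(real^'n) measure" and a :: real +
  fixes W :: "nat \<Rightarrow> 'b \<Rightarrow> real^'n" and n :: nat
  assumes indep: "indep_vars (\<lambda>_. borel) W {..<n}"
    and law: "\<And>i. i < n \<Longrightarrow> distr M borel (W i) = P"
begin

abbreviation gram :: "nat \<Rightarrow> 'b \<Rightarrow> real^'n^'n" where
  "gram k x \<equiv> \<Sum>i<k. outer_prod (W i x)"

lemma measurable_row [measurable]: "i < n \<Longrightarrow> W i \<in> borel_measurable M"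
  using indep by (simp add: indep_vars_def)

lemma measurable_sum_outer [measurable]: "k \<le> n \<Longrightarrow> gram k \<in> borel_measurable M"
  by (intro borel_measurable_sum measurable_compose[OF measurable_row borel_measurable_outer_prod]) auto

lemma integrable_tr_exp_sample:
  assumes "transpose A = A" "0 \<le> s" "k \<le> n"
  shows "integrable M (\<lambda>x. tr_exp (A - s *\<^sub>R gram k x))"
proof (rule integrable_const_bound[where B = "tr_exp A"])
  have "norm (tr_exp (A - s *\<^sub>R gram k x)) \<le> tr_exp A" for x
  proof -
    have "transpose (A - s *\<^sub>R gram k x) = A - s *\<^sub>R gram k x"
      using assms by (simp add: transpose_simps transpose_sum)
    from tr_exp_pos[OF this] show ?thesis
      using tr_exp_sum_outer_prod_le[OF assms(1,2), of "\<lambda>i. W i x" k] by simp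
  qed
  then show "AE x in M. norm (tr_exp (A - s *\<^sub>R gram k x)) \<le> tr_exp A" by simp
  show "(\<lambda>x. tr_exp (A - s *\<^sub>R gram k x)) \<in> borel_measurable M"
    using measurable_sum_outer[OF assms(3)] by measurable
qed

text \<open>Peel off row \<open>k\<close>: it is independent of the earlier rows, so Fubini allows
  integrating these first, with the matrix \<open>A\<close> lowered by the fixed last row. Since all
  rows share the law \<open>P\<close>, this matches the recursion of \<open>downdate\<close>, whose
  outermost integral belongs to the row peeled off.\<close>

lemma expectation_tr_exp_sample:
  assumes "transpose A = A" "0 \<le> s" "k \<le> n"
  shows "expectation (\<lambda>x. tr_exp (A - s *\<^sub>R gram k x)) = law.downdate s k A"
  using assms(1,3)
proof (induction k arbitrary: A)
  case 0
  then show ?case by (simp add: prob_space)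
next
  case (Suc k)
  let ?S = "gram k" and ?R = "\<lambda>x. outer_prod (W k x)"
  have k: "k < n" using Suc.prems by simp
  note [measurable] = measurable_row[OF k] measurable_sum_outer[OF less_imp_le[OF k]]
  have comp: "(\<lambda>h :: nat \<Rightarrow> real^'n. outer_prod (h i)) \<in> PiM J (\<lambda>_. borel) \<rightarrow>\<^sub>M borel" if "i \<in> J" for i J
    by (rule measurable_compose[OF _ borel_measurable_outer_prod]) (rule measurable_component_singleton[OF that])
  have "indep_var (PiM {k} (\<lambda>_. borel)) (\<lambda>\<omega>. restrict (\<lambda>i. W i \<omega>) {k}) (PiM {..<k} (\<lambda>_. borel)) (\<lambda>\<omega>. restrict (\<lambda>i. W i \<omega>) {..<k})"
    using k by (intro indep_var_restrict[OF indep]) auto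
  then have "indep_var borel ((\<lambda>h. outer_prod (h k)) \<circ> (\<lambda>\<omega>. restrict (\<lambda>i. W i \<omega>) {k}))
      borel ((\<lambda>h. \<Sum>i<k. outer_prod (h i)) \<circ> (\<lambda>\<omega>. restrict (\<lambda>i. W i \<omega>) {..<k}))"
  proof (rule indep_var_compose)
    show "(\<lambda>h :: nat \<Rightarrow> real^'n. outer_prod (h k)) \<in> PiM {k} (\<lambda>_. borel) \<rightarrow>\<^sub>M borel"
      by (rule comp) simp
    show "(\<lambda>h :: nat \<Rightarrow> real^'n. \<Sum>i<k. outer_prod (h i)) \<in> PiM {..<k} (\<lambda>_. borel) \<rightarrow>\<^sub>M borel"
      by (intro borel_measurable_sum comp)
  qed
  then have "indep_var borel ?R borel ?S" by (simp add: comp_def)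
  then have joint: "distr M borel ?R \<Otimes>\<^sub>M distr M borel ?S = distr M (borel \<Otimes>\<^sub>M borel) (\<lambda>x. (?R x, ?S x))"
    by (simp add: indep_var_distribution_eq)
  define f where "f = (\<lambda>(R, S). tr_exp (A - s *\<^sub>R R - s *\<^sub>R S))"
  have f_meas [measurable]: "f \<in> borel_measurable (borel \<Otimes>\<^sub>M borel)"
    unfolding f_def by measurable
  have pair_meas: "(\<lambda>x. (?R x, ?S x)) \<in> M \<rightarrow>\<^sub>M borel \<Otimes>\<^sub>M borel" by measurable
  have eq: "f (?R x, ?S x) = tr_exp (A - s *\<^sub>R gram (Suc k) x)" for x
    by (simp add: f_def algebra_simps)
  have int: "integrable (distr M (borel \<Otimes>\<^sub>M borel) (\<lambda>x. (?R x, ?S x))) f"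
    by (subst integrable_distr_eq[OF pair_meas f_meas])
      (use integrable_tr_exp_sample[OF Suc.prems(1) assms(2) Suc.prems(2)] in \<open>simp only: eq\<close>)
  have lawR: "distr M borel ?R = distr P borel outer_prod"
    unfolding law[OF k, symmetric] by (subst distr_distr) (auto simp: comp_def)
  interpret S: prob_space "distr M borel ?S" by (rule prob_space_distr) measurable
  interpret R: prob_space "distr M borel ?R" by (rule prob_space_distr) measurable
  interpret RS: pair_sigma_finite "distr M borel ?R" "distr M borel ?S" ..
  have inner: "(\<integral>S. f (R, S) \<partial>distr M borel ?S) = expectation (\<lambda>x. tr_exp (A - s *\<^sub>R R - s *\<^sub>R ?S x))" for R
  proof -
    have m: "(\<lambda>S. tr_exp (A - s *\<^sub>R R - s *\<^sub>R S)) \<in> borel_measurable borel" by measurable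
    show ?thesis unfolding f_def prod.case by (rule integral_distr[OF _ m]) measurable
  qed
  have meas_inner: "(\<lambda>R. \<integral>S. f (R, S) \<partial>distr M borel ?S) \<in> borel_measurable borel"
    by measurable
  have "expectation (\<lambda>x. tr_exp (A - s *\<^sub>R gram (Suc k) x)) = expectation (\<lambda>x. f (?R x, ?S x))"
    by (simp only: eq)
  also have "\<dots> = integral\<^sup>L (distr M borel ?R \<Otimes>\<^sub>M distr M borel ?S) f"
    unfolding joint by (rule integral_distr[OF pair_meas f_meas, symmetric])
  also have "\<dots> = (\<integral>R. (\<integral>S. f (R, S) \<partial>distr M borel ?S) \<partial>distr M borel ?R)"
    using int unfolding joint[symmetric] by (rule RS.integral_fst'[symmetric])
  also have "\<dots> = (\<integral>w. (\<integral>S. f (outer_prod w, S) \<partial>distr M borel ?S) \<partial>P)"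
    unfolding lawR by (rule integral_distr[OF _ meas_inner]) measurable
  also have "\<dots> = (\<integral>w. law.downdate s k (A - s *\<^sub>R outer_prod w) \<partial>P)"
    unfolding inner using Suc.prems
    by (intro Bochner_Integration.integral_cong refl Suc.IH) (simp_all add: transpose_simps)
  finally show ?case by simp
qed

abbreviation sample_covariance :: "'b \<Rightarrow> real^'n^'n" where
  "sample_covariance x \<equiv> (1 / real n) *\<^sub>R gram n x"

lemma transpose_sample_covariance: "transpose (sample_covariance x) = sample_covariance x"
  by (simp add: transpose_simps transpose_sum)

lemma sets_lambda_min_gt: "{x \<in> space M. c < lambda_min (sample_covariance x)} \<in> sets M"
proof -
  have "(\<lambda>x. tr_exp (real k *\<^sub>R (c *\<^sub>R mat 1 - sample_covariance x))) \<in> borel_measurable M" for k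
    using measurable_sum_outer[OF order.refl] by measurable
  then have "{x \<in> space M. tr_exp (real k *\<^sub>R (c *\<^sub>R mat 1 - sample_covariance x)) < 1} \<in> sets M" for k
    by measurable
  moreover have "{x \<in> space M. c < lambda_min (sample_covariance x)}
    = (\<Union>k. {x \<in> space M. tr_exp (real k *\<^sub>R (c *\<^sub>R mat 1 - sample_covariance x)) < 1})"
    by (auto simp: lambda_min_gt_iff_tr_exp[OF transpose_sample_covariance])
  ultimately show ?thesis by auto
qed

text \<open>Markov's inequality for the trace exponential of \<open>- s *\<^sub>R gram n x\<close>,
  which is at least \<open>exp (- (s * n * c))\<close> on the complementary event.\<close>

lemma prob_lambda_min_gt:
  assumes "0 \<le> s" "0 < n"
  shows "1 - exp (s * real n * c) * law.downdate s n 0 \<le> prob {x \<in> space M. c < lambda_min (sample_covariance x)}"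
proof -
  let ?G = "{x \<in> space M. c < lambda_min (sample_covariance x)}"
  let ?u = "\<lambda>x. tr_exp (0 - s *\<^sub>R gram n x)"
  let ?e = "exp (- (s * real n * c))"
  have sym0: "transpose (0 :: real^'n^'n) = 0" by (simp add: transpose_def vec_eq_iff)
  note int = integrable_tr_exp_sample[OF sym0 assms(1) order.refl]
  have "?e \<le> ?u x" if "\<not> c < lambda_min (sample_covariance x)" for x
  proof -
    have "exp (- (s * real n * c)) \<le> tr_exp ((- (s * real n)) *\<^sub>R sample_covariance x)"
      using that assms by (intro lambda_min_le_imp_tr_exp_ge transpose_sample_covariance) auto
    then show ?thesis using assms by simp
  qed
  then have sub: "space M - ?G \<subseteq> {x \<in> space M. ?e \<le> ?u x}" by blast
  have meas: "{x \<in> space M. ?e \<le> ?u x} \<in> sets M"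
    using borel_measurable_integrable[OF int] by measurable
  have "prob (space M - ?G) \<le> prob {x \<in> space M. ?e \<le> ?u x}" by (rule finite_measure_mono[OF sub meas])
  also have "\<dots> \<le> expectation ?u / ?e"
  proof (rule integral_Markov_inequality_measure[OF int, of "space M"])
    have "0 < ?u x" for x
      by (intro tr_exp_pos) (simp add: transpose_simps transpose_sum sym0)
    then show "AE x in M. 0 \<le> ?u x" by (simp add: less_imp_le)
  qed auto
  also have "\<dots> = exp (s * real n * c) * law.downdate s n 0"
    unfolding expectation_tr_exp_sample[OF sym0 assms(1) order.refl] by (simp add: exp_minus field_simps)
  finally show ?thesis using prob_compl[OF sets_lambda_min_gt[of c]] by simp
qed

text \<open>For \<open>L\<close> at most 12 the product \<open>d * L\<close> is itself of order
  \<open>d\<close>, so the direct matrix bound is good enough; only larger \<open>L\<close> calls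
  for the comparison with jumps.\<close>

theorem prob_lambda_min_gt_one_minus:
  assumes \<epsilon>: "0 < \<epsilon>" "\<epsilon> < 1" and \<delta>: "0 < \<delta>" "\<delta> < 1"
    and n: "25 * max (real CARD('n)) (2 * a * ln (2 * real CARD('n) / \<delta>)) \<le> real n * \<epsilon>\<^sup>2"
  shows "1 - \<delta> \<le> prob {x \<in> space M. 1 - \<epsilon> < lambda_min (sample_covariance x)}"
proof -
  define d where "d = real CARD('n)"
  define L where "L = ln (2 * d / \<delta>)"
  define B where "B = max d (2 * a * L)"
  have d: "1 \<le> d" by (simp add: d_def Suc_le_eq)
  have a: "1 \<le> a" by (rule law.a_ge_1)
  have nB: "25 * B \<le> real n * \<epsilon>\<^sup>2" using n by (simp add: B_def L_def d_def)
  have B1: "1 \<le> B" using d by (simp add: B_def)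
  have n0: "0 < n" using nB B1 by (cases n) auto
  have L0: "exp L = 2 * d / \<delta>" using d \<delta> by (simp add: L_def)
  have sym0: "transpose (0 :: real^'n^'n) = 0" by (simp add: transpose_def vec_eq_iff)
  have "\<exists>s\<ge>0. exp (s * real n * (1 - \<epsilon>)) * law.downdate s n 0 \<le> \<delta>"
  proof (cases "L \<le> 12")
    case True
    \<comment> \<open>Minimises the exponent
      \<open>- s * n * \<epsilon> + n * s\<^sup>2 * (d + a) / 2\<close>.\<close>
    define s where "s = \<epsilon> / (d + a)"
    have da: "0 < d + a" using d a by simp
    have s0: "0 \<le> s" using \<epsilon> da by (simp add: s_def)
    let ?c = "1 - s + s\<^sup>2 * (d + a - 1) / 2"
    have c0: "0 \<le> ?c"
    proof -
      have "s \<le> 1" using \<epsilon> d a by (simp add: s_def divide_le_eq)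
      then show ?thesis using d a by simp
    qed
    have "law.downdate s k 0 \<le> ?c ^ k * d" for k
    proof (induction k)
      case 0
      have "tr_exp (0 :: real^'n^'n) = d"
      proof -
        obtain B l where eb: "eigenbasis (0 :: real^'n^'n) B l" using symmetric_eigenbasis_exists[OF sym0] by blast
        have "l v = 0" if "v \<in> B" for v using eigenbasis_eigenvalue[OF eb that] by simp
        then show ?thesis by (simp add: tr_exp_eigenbasis[OF eb] eigenbasis_card[OF eb] d_def)
      qed
      then show ?case by simp
    next
      case (Suc k)
      have "law.downdate s (Suc k) 0 \<le> ?c * law.downdate s k 0"
        using law.downdate_chernoff[OF s0 sym0, of k] by (simp add: d_def)
      also have "\<dots> \<le> ?c * (?c ^ k * d)" using c0 Suc by (intro mult_left_mono)
      finally show ?case by (simp only: power_Suc mult.assoc)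
    qed
    then have "law.downdate s n 0 \<le> ?c ^ n * d" .
    also have "?c ^ n \<le> exp (- s + s\<^sup>2 * (d + a) / 2) ^ n"
    proof (intro power_mono c0)
      have "?c \<le> 1 + (- s + s\<^sup>2 * (d + a) / 2)" by (simp add: mult_left_mono)
      also have "\<dots> \<le> exp (- s + s\<^sup>2 * (d + a) / 2)" by (rule exp_ge_add_one_self)
      finally show "?c \<le> exp (- s + s\<^sup>2 * (d + a) / 2)" .
    qed
    also have "\<dots> = exp (real n * (- s + s\<^sup>2 * (d + a) / 2))" by (simp add: exp_of_nat_mult)
    finally have D: "law.downdate s n 0 \<le> exp (real n * (- s + s\<^sup>2 * (d + a) / 2)) * d" using d by simp
    have "exp (s * real n * (1 - \<epsilon>)) * law.downdate s n 0
      \<le> exp (s * real n * (1 - \<epsilon>)) * (exp (real n * (- s + s\<^sup>2 * (d + a) / 2)) * d)"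
      using D by (intro mult_left_mono) auto
    also have "\<dots> = exp (s * real n * (1 - \<epsilon>) + real n * (- s + s\<^sup>2 * (d + a) / 2)) * d" by (simp add: exp_add)
    also have "s * real n * (1 - \<epsilon>) + real n * (- s + s\<^sup>2 * (d + a) / 2) = - (real n * \<epsilon>\<^sup>2 / (2 * (d + a)))"
    proof -
      have sD: "s * (d + a) = \<epsilon>" using da by (simp add: s_def)
      have "s\<^sup>2 * (d + a) = s * \<epsilon>" by (simp only: power2_eq_square mult.assoc sD)
      then have "s * real n * (1 - \<epsilon>) + real n * (- s + s\<^sup>2 * (d + a) / 2) = - (real n * (s * \<epsilon>) / 2)"
        by (simp add: field_simps)
      also have "s * \<epsilon> = \<epsilon>\<^sup>2 / (d + a)" by (simp add: s_def power2_eq_square)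
      finally show ?thesis using da by simp
    qed
    also have "\<dots> \<le> - L"
    proof -
      \<comment> \<open>Where the threshold 12 comes from: \<open>24 * d\<close> and
        \<open>2 * a * L\<close> together use up exactly the constant 25.\<close>
      have "2 * (d + a) * L \<le> 24 * d + 2 * a * L" using True d by (simp add: algebra_simps)
      also have "\<dots> \<le> 24 * B + B" using d by (simp add: B_def)
      also have "\<dots> \<le> real n * \<epsilon>\<^sup>2" using nB by simp
      finally have "L \<le> real n * \<epsilon>\<^sup>2 / (2 * (d + a))" using da by (simp add: pos_le_divide_eq mult.commute)
      then show ?thesis by simp
    qed
    finally have "exp (s * real n * (1 - \<epsilon>)) * law.downdate s n 0 \<le> exp (- L) * d" using d by simp
    also have "\<dots> \<le> \<delta>" using L0 d \<delta> by (simp add: exp_minus field_simps)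
    finally show ?thesis using s0 by blast
  next
    case False
    define s where "s = 8/10 * sqrt (2 * L / (real n * a))"
    define X where "X = 83/100 * sqrt (B / real n)"
    have dB: "d \<le> B" and aB: "2 * a * L \<le> B" by (simp_all add: B_def)
    have L12: "12 < L" and d0: "0 \<le> d" using False d by auto
    note e = exponent_bound[OF a L12 dB aB d0 \<epsilon> nB, folded s_def X_def]
    have "144 \<le> n" using e(3) by simp
    note D = law.downdate_le_exp[OF e(1,2) this, folded d_def]
    let ?E = "- s * real n + 3/2 * s * sqrt (real n) + s / X * d * ln (13/3) + real n * (211/100 * s * X + 51/100 * s\<^sup>2 * a)"
    have "exp (s * real n * (1 - \<epsilon>)) * law.downdate s n 0 \<le> exp (s * real n * (1 - \<epsilon>)) * (2 * d * exp ?E)"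
      using D by (intro mult_left_mono) auto
    also have "\<dots> = 2 * d * exp (s * real n * (1 - \<epsilon>) + ?E)" by (simp only: exp_add mult_ac)
    also have "\<dots> \<le> 2 * d * exp (- L)" using e(4) d by (intro mult_left_mono) auto
    \<comment> \<open>The factor 2 lost to thinning is paid by the 2 in
      \<open>ln (2 * d / \<delta>)\<close>, and the \<open>d\<close> by the dimension there.\<close>
    also have "\<dots> = \<delta>" using L0 d \<delta> by (simp add: exp_minus field_simps)
    finally show ?thesis using e(1) by (intro exI[of _ s]) auto
  qed
  then obtain s where s: "0 \<le> s" "exp (s * real n * (1 - \<epsilon>)) * law.downdate s n 0 \<le> \<delta>" by blast
  then show ?thesis using prob_lambda_min_gt[OF s(1) n0, of "1 - \<epsilon>"] by linarith
qed

end

section \<open>Moments and law of one sparse row\<close>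

lemma borel_measurable_vec_lambda:
  assumes "\<And>j. f j \<in> borel_measurable M"
  shows "(\<lambda>x. (\<chi> j. f j x) :: real^'n) \<in> borel_measurable M"
proof -
  have "(\<chi> j. f j x) = (\<Sum>j\<in>UNIV. f j x *\<^sub>R axis j 1)" for x
    by (simp add: vec_eq_iff axis_def if_distrib cong: if_cong)
  then show ?thesis using assms by simp
qed

lemma abs_power_le_one_plus_power4:
  assumes "c \<le> 4"
  shows "\<bar>x :: real\<bar> ^ c \<le> 1 + x ^ 4"
proof (cases "\<bar>x\<bar> \<le> 1")
  case True
  then have "\<bar>x\<bar> ^ c \<le> 1" by (simp add: power_le_one)
  then show ?thesis by (smt (verit) zero_le_even_power even_numeral)
next
  case False
  then have "\<bar>x\<bar> ^ c \<le> \<bar>x\<bar> ^ 4" using assms by (intro power_increasing) auto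
  then show ?thesis by simp
qed

context prob_space
begin

text \<open>Supplies the equality of laws of the Bernoulli variables, which are specified only
  through their values and the probability of 1.\<close>

lemma distr_zero_one_valued_eq:
  fixes X Y :: "'a \<Rightarrow> real"
  assumes [measurable]: "X \<in> borel_measurable M" "Y \<in> borel_measurable M"
    and X: "\<And>x. x \<in> space M \<Longrightarrow> X x \<in> {0, 1}" and Y: "\<And>x. x \<in> space M \<Longrightarrow> Y x \<in> {0, 1}"
    and eq: "prob {x \<in> space M. X x = 1} = prob {x \<in> space M. Y x = 1}"
  shows "distr M borel X = distr M borel Y"
proof (rule measure_eqI)
  fix S assume "S \<in> sets (distr M borel X)"
  then have S: "S \<in> sets borel" by simp
  have p: "prob (Z -` S \<inter> space M) = (if 1 \<in> S then prob {x \<in> space M. Z x = 1} else 0)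
      + (if 0 \<in> S then 1 - prob {x \<in> space M. Z x = 1} else 0)"
    if [measurable]: "Z \<in> borel_measurable M" and Z: "\<And>x. x \<in> space M \<Longrightarrow> Z x \<in> {0, 1}" for Z :: "'a \<Rightarrow> real"
  proof -
    have c: "prob {x \<in> space M. Z x = 0} = 1 - prob {x \<in> space M. Z x = 1}"
    proof -
      have "{x \<in> space M. Z x = 0} = space M - {x \<in> space M. Z x = 1}" using Z by fastforce
      then show ?thesis using prob_compl[of "{x \<in> space M. Z x = 1}"] by simp
    qed
    have u: "prob (space M) = 1" by (rule prob_space)
    consider "1 \<in> S" "0 \<in> S" | "1 \<in> S" "0 \<notin> S" | "1 \<notin> S" "0 \<in> S" | "1 \<notin> S" "0 \<notin> S" by blast
    then show ?thesis
    proof cases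
      case 1
      then have "Z -` S \<inter> space M = space M" using Z by fastforce
      then show ?thesis using 1 u by simp
    next
      case 2
      then have "Z -` S \<inter> space M = {x \<in> space M. Z x = 1}" using Z by fastforce
      then show ?thesis using 2 by simp
    next
      case 3
      then have "Z -` S \<inter> space M = {x \<in> space M. Z x = 0}" using Z by fastforce
      then show ?thesis using 3 c by simp
    next
      case 4
      then have "Z -` S \<inter> space M = {}" using Z by fastforce
      then show ?thesis using 4 by simp
    qed
  qed
  show "emeasure (distr M borel X) S = emeasure (distr M borel Y) S"
    using p[OF assms(1) X] p[OF assms(2) Y] eq S by (simp add: emeasure_distr emeasure_eq_measure)
qed simp

text \<open>Mixed moments factor over the coordinates by independence. The scale
  \<open>sqrt (d / \<zeta>)\<close> restores variance 1, and the fourth moment becomes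
  \<open>(d / \<zeta>)\<^sup>2 * (\<zeta> / d) * C\<close>, whence the value of
  \<open>a\<close>.\<close>

lemma isotropic_law_sparse_row:
  fixes \<xi> \<phi> :: "'d::finite \<Rightarrow> 'a \<Rightarrow> real" and \<psi> :: "'a \<Rightarrow> real" and \<zeta> C :: real
  defines "d \<equiv> real CARD('d)"
  defines "sample \<equiv> (\<lambda>x. \<chi> j. sqrt (d / \<zeta>) * (\<xi> j x * \<phi> j x))"
  assumes \<zeta>: "0 < \<zeta>" "\<zeta> \<le> d"
    and \<psi>: "\<psi> \<in> borel_measurable M" "integrable M (\<lambda>x. \<psi> x ^ 4)" "expectation \<psi> = 0" "variance \<psi> = 1"
      "expectation (\<lambda>x. \<bar>\<psi> x\<bar> ^ 4) = C"
    and \<xi>: "\<And>j. \<xi> j \<in> borel_measurable M" "\<And>j x. x \<in> space M \<Longrightarrow> \<xi> j x \<in> {0, 1}"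
      "\<And>j. prob {x \<in> space M. \<xi> j x = 1} = \<zeta> / d"
    and \<phi>: "\<And>j. \<phi> j \<in> borel_measurable M" "\<And>j. distr M borel (\<phi> j) = distr M borel \<psi>"
    and indep: "indep_vars (\<lambda>_. borel) (case_sum \<xi> \<phi>) UNIV"
  shows "isotropic_law (distr M borel sample) (C * d / \<zeta>)"
proof -
  note [measurable] = \<psi>(1) \<xi>(1) \<phi>(1)
  define K where "K = sqrt (d / \<zeta>)"
  define w where "w j x = K * (\<xi> j x * \<phi> j x)" for j x
  \<comment> \<open>The moment of order \<open>c\<close> of one coordinate. The case distinction
    reflects that \<open>\<xi> ^ c\<close> equals \<open>\<xi>\<close> for positive \<open>c\<close>
    but 1 for \<open>c = 0\<close>.\<close>
  define \<mu> where "\<mu> c = K ^ c * ((if c = 0 then 1 else \<zeta> / d) * expectation (\<lambda>x. \<psi> x ^ c))" for c :: nat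
  have d: "0 < d" using \<zeta> by simp
  have K2: "K\<^sup>2 = d / \<zeta>" using \<zeta> d by (simp add: K_def)
  have int\<psi>: "integrable M (\<lambda>x. \<psi> x ^ c)" if "c \<le> 4" for c
  proof (rule Bochner_Integration.integrable_bound)
    show "integrable M (\<lambda>x. 1 + \<psi> x ^ 4)" using \<psi>(2) by simp
    show "AE x in M. norm (\<psi> x ^ c) \<le> norm (1 + \<psi> x ^ 4)"
      using abs_power_le_one_plus_power4[OF that] by (simp add: power_abs)
  qed measurable
  have \<phi>\<psi>: "integrable M (\<lambda>x. \<phi> j x ^ c)" "expectation (\<lambda>x. \<phi> j x ^ c) = expectation (\<lambda>x. \<psi> x ^ c)" if "c \<le> 4" for j c
  proof -
    have m: "(\<lambda>z::real. z ^ c) \<in> borel_measurable borel" by measurable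
    have "integrable (distr M borel \<psi>) (\<lambda>z. z ^ c)"
      using int\<psi>[OF that] by (subst integrable_distr_eq[OF _ m]) simp_all
    then show "integrable M (\<lambda>x. \<phi> j x ^ c)"
      unfolding \<phi>(2)[of j, symmetric] by (subst (asm) integrable_distr_eq[OF _ m]) simp_all
    have "expectation (\<lambda>x. \<phi> j x ^ c) = (\<integral>z. z ^ c \<partial>distr M borel (\<phi> j))" by (rule integral_distr[OF _ m, symmetric]) simp
    also have "\<dots> = expectation (\<lambda>x. \<psi> x ^ c)" unfolding \<phi>(2) by (rule integral_distr[OF _ m]) simp
    finally show "expectation (\<lambda>x. \<phi> j x ^ c) = expectation (\<lambda>x. \<psi> x ^ c)" .
  qed
  have \<xi>c: "integrable M (\<lambda>x. \<xi> j x ^ c)" "expectation (\<lambda>x. \<xi> j x ^ c) = (if c = 0 then 1 else \<zeta> / d)" for j c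
  proof -
    have b: "\<bar>\<xi> j x ^ c\<bar> \<le> 1" if "x \<in> space M" for x using \<xi>(2)[OF that, of j] by (auto simp: power_0_left)
    show "integrable M (\<lambda>x. \<xi> j x ^ c)"
      by (rule integrable_const_bound[where B = 1]) (use b in auto)
    have "expectation (\<lambda>x. \<xi> j x ^ c) = expectation (indicator {x \<in> space M. \<xi> j x = 1})" if "c \<noteq> 0"
      using \<xi>(2)[of _ j] that by (intro Bochner_Integration.integral_cong refl) (fastforce simp: indicator_def)
    then show "expectation (\<lambda>x. \<xi> j x ^ c) = (if c = 0 then 1 else \<zeta> / d)"
      using \<xi>(3)[of j] by (auto simp: prob_space Int_absorb2 Collect_conj_eq)
  qed
  have moment: "integrable M (\<lambda>x. \<Prod>j\<in>UNIV. w j x ^ c j)" "expectation (\<lambda>x. \<Prod>j\<in>UNIV. w j x ^ c j) = (\<Prod>j\<in>UNIV. \<mu> (c j))"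
    if c: "\<And>j. c j \<le> 4" for c :: "'d \<Rightarrow> nat"
  proof -
    let ?X = "\<lambda>k x. case_sum \<xi> \<phi> k x ^ case_sum c c k"
    have ind: "indep_vars (\<lambda>_. borel) ?X UNIV"
      by (rule indep_vars_compose2[OF indep, where Y = "\<lambda>k z. z ^ case_sum c c k"]) measurable
    have int: "integrable M (?X k)" for k by (cases k) (simp_all add: \<xi>c \<phi>\<psi> c)
    have P: "(\<Prod>k\<in>UNIV. f k) = (\<Prod>j\<in>UNIV. f (Inl j)) * (\<Prod>j\<in>UNIV. f (Inr j))" for f :: "'d + 'd \<Rightarrow> real"
      unfolding UNIV_Plus_UNIV[symmetric] by (subst prod.Plus) (auto simp: comp_def)
    have eq: "(\<Prod>j\<in>UNIV. w j x ^ c j) = (\<Prod>j\<in>UNIV. K ^ c j) * (\<Prod>k\<in>UNIV. ?X k x)" for x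
      unfolding P by (simp add: w_def power_mult_distrib prod.distrib mult.assoc)
    show "integrable M (\<lambda>x. \<Prod>j\<in>UNIV. w j x ^ c j)"
      unfolding eq by (intro integrable_mult_right indep_vars_integrable ind int) auto
    have "expectation (\<lambda>x. \<Prod>j\<in>UNIV. w j x ^ c j) = (\<Prod>j\<in>UNIV. K ^ c j) * expectation (\<lambda>x. \<Prod>k\<in>UNIV. ?X k x)"
      unfolding eq by simp
    also have "expectation (\<lambda>x. \<Prod>k\<in>UNIV. ?X k x) = (\<Prod>k\<in>UNIV. expectation (?X k))"
      by (rule indep_vars_lebesgue_integral[OF _ ind int]) simp
    also have "(\<Prod>j\<in>UNIV. K ^ c j) * (\<Prod>k\<in>UNIV. expectation (?X k)) = (\<Prod>j\<in>UNIV. \<mu> (c j))"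
      unfolding P \<mu>_def by (simp add: \<xi>c(2) \<phi>\<psi>(2)[OF c] prod.distrib mult.assoc)
    finally show "expectation (\<lambda>x. \<Prod>j\<in>UNIV. w j x ^ c j) = (\<Prod>j\<in>UNIV. \<mu> (c j))" .
  qed
  have E\<psi>2: "expectation (\<lambda>x. \<psi> x ^ 2) = 1" using \<psi>(3,4) by simp
  have E\<psi>4: "expectation (\<lambda>x. \<psi> x ^ 4) = C" using \<psi>(5) by simp
  have \<mu>0: "\<mu> 0 = 1" by (simp add: \<mu>_def prob_space)
  have \<mu>1: "\<mu> (Suc 0) = 0" by (simp add: \<mu>_def \<psi>(3))
  have \<mu>2: "\<mu> 2 = 1" unfolding \<mu>_def K2 E\<psi>2 using \<zeta> d by simp
  have \<mu>4: "\<mu> 4 = C * d / \<zeta>"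
  proof -
    have "K ^ 4 = (d / \<zeta>)\<^sup>2" using K2 by (metis power_mult numeral_Bit0 mult_2 power_add power2_eq_square)
    then show ?thesis unfolding \<mu>_def E\<psi>4 using \<zeta> d by (simp add: power2_eq_square field_simps)
  qed
  have z1: "(\<Prod>i\<in>UNIV. z i ^ of_bool (i = j)) = (z j :: real)" for z :: "'d \<Rightarrow> real" and j
  proof -
    have "(\<Prod>i\<in>UNIV. z i ^ of_bool (i = j)) = (\<Prod>i\<in>UNIV. if i = j then z i else 1)" by (intro prod.cong) auto
    then show ?thesis by simp
  qed
  have sample: "sample x $ j = w j x" for x j by (simp add: sample_def w_def K_def)
  have row_meas: "sample \<in> borel_measurable M"
    unfolding sample_def by (intro borel_measurable_vec_lambda) measurable
  interpret P: prob_space "distr M borel sample" by (rule prob_space_distr[OF row_meas])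
  \<comment> \<open>Multiplicity of the index \<open>i\<close> in the monomial. Products with
    repeated indices thus become products over distinct coordinates, to which \<open>moment\<close>
    applies.\<close>
  let ?c4 = "\<lambda>j k l m i. of_bool (i = j) + of_bool (i = k) + of_bool (i = l) + of_bool (i = m) :: nat"
  let ?c2 = "\<lambda>j k i. of_bool (i = j) + of_bool (i = k) :: nat"
  have p4: "w j x * w k x * w l x * w m x = (\<Prod>i\<in>UNIV. w i x ^ ?c4 j k l m i)" for j k l m x
    by (simp add: power_add prod.distrib z1)
  have p2: "w j x * w k x = (\<Prod>i\<in>UNIV. w i x ^ ?c2 j k i)" for j k x
    by (simp add: power_add prod.distrib z1)
  have c4: "?c4 j k l m i \<le> 4" for j k l m i by auto
  have c2: "?c2 j k i \<le> 4" for j k i by auto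
  show ?thesis
  proof
    show "sets (distr M borel sample) = sets borel" by simp
    show "1 \<le> C * d / \<zeta>"
    proof -
      \<comment> \<open>The fourth moment is at least the squared variance: expand the mean of
        \<open>(\<psi>\<^sup>2 - 1)\<^sup>2\<close>.\<close>
      have "0 \<le> expectation (\<lambda>x. (\<psi> x ^ 2 - 1)\<^sup>2)" by (intro integral_nonneg_AE) simp
      also have "(\<lambda>x. (\<psi> x ^ 2 - 1)\<^sup>2) = (\<lambda>x. \<psi> x ^ 4 - 2 * \<psi> x ^ 2 + 1)"
        by (simp add: fun_eq_iff power2_eq_square power4_eq_xxxx algebra_simps)
      also have "expectation \<dots> = C - 2 * 1 + 1"
        using int\<psi>[of 4] int\<psi>[of 2] E\<psi>2 E\<psi>4 by (simp add: prob_space)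
      finally have "1 \<le> C" by simp
      moreover have "1 \<le> d / \<zeta>" using \<zeta> by simp
      ultimately show ?thesis using mult_mono[of 1 C 1 "d / \<zeta>"] by simp
    qed
  next
    fix j k :: 'd
    have m: "(\<lambda>v :: real^'d. v $ j * v $ k) \<in> borel_measurable borel"
      by (intro borel_measurable_continuous_onI continuous_intros)
    show "integrable (distr M borel sample) (\<lambda>v. v $ j * v $ k)"
      unfolding integrable_distr_eq[OF row_meas m] sample p2 by (rule moment(1)[OF c2])
    have "(\<integral>v. v $ j * v $ k \<partial>distr M borel sample) = (\<Prod>i\<in>UNIV. \<mu> (?c2 j k i))"
      unfolding integral_distr[OF row_meas m] sample p2 by (rule moment(2)[OF c2])
    also have "\<dots> = (if j = k then 1 else 0)"
    proof (cases "j = k")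
      case True
      have "\<mu> (?c2 j k i) = 1" for i using True \<mu>0 \<mu>2 by (cases "i = j") (simp_all add: numeral_2_eq_2)
      then show ?thesis using True by simp
    next
      case False
      then have "\<mu> (?c2 j k j) = 0" using \<mu>1 by simp
      then have "\<exists>i\<in>UNIV. \<mu> (?c2 j k i) = 0" by (rule bexI) (rule UNIV_I)
      then have "(\<Prod>i\<in>UNIV. \<mu> (?c2 j k i)) = 0" by (rule prod_zero[OF finite])
      then show ?thesis using False by simp
    qed
    finally show "(\<integral>v. v $ j * v $ k \<partial>distr M borel sample) = (if j = k then 1 else 0)" .
  next
    let ?E = "\<lambda>j k l m. \<integral>v. v $ j * v $ k * v $ l * v $ m \<partial>distr M borel sample"
    have m: "(\<lambda>v :: real^'d. v $ j * v $ k * v $ l * v $ m) \<in> borel_measurable borel" for j k l m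
      by (intro borel_measurable_continuous_onI continuous_intros)
    show "integrable (distr M borel sample) (\<lambda>v. v $ j * v $ k * v $ l * v $ m)" for j k l m
      unfolding integrable_distr_eq[OF row_meas m] sample p4 by (rule moment(1)[OF c4])
    have E: "?E j k l m = (\<Prod>i\<in>UNIV. \<mu> (?c4 j k l m i))" for j k l m
      unfolding integral_distr[OF row_meas m] sample p4 by (rule moment(2)[OF c4])
    show "?E j k l m = moment_tensor (C * d / \<zeta>) j k l m" for j k l m
    proof (rule fourth_moment_tensor[of ?E])
      fix j k l m :: 'd assume "j \<notin> {k, l, m}"
      then have "\<mu> (?c4 j k l m j) = 0" using \<mu>1 by simp
      then have "\<exists>i\<in>UNIV. \<mu> (?c4 j k l m i) = 0" by (rule bexI) (rule UNIV_I)
      then show "?E j k l m = 0" unfolding E by (rule prod_zero[OF finite])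
    next
      fix j k :: 'd assume "j \<noteq> k"
      then have "\<mu> (?c4 j j k k i) = 1" for i using \<mu>0 \<mu>2 by (cases "i = j"; cases "i = k") (simp_all add: numeral_2_eq_2)
      then show "?E j j k k = 1" unfolding E by simp
    next
      fix j :: 'd
      have "?E j j j j = (\<Prod>i\<in>UNIV. if i = j then \<mu> 4 else 1)"
        unfolding E using \<mu>0 by (intro prod.cong refl) (simp add: eval_nat_numeral)
      then show "?E j j j j = C * d / \<zeta>" using \<mu>4 by simp
    qed (simp_all add: mult_ac)
  qed
qed

end

section \<open>Independent, identically distributed sparse rows\<close>

theorem theorem5p4:
  fixes M :: "'a measure"
    and \<zeta> C \<epsilon> \<delta> :: real
    and n :: nat
    and \<psi> :: "'a \<Rightarrow> real"
    and \<xi>s \<psi>s :: "nat \<Rightarrow> 'd::finite \<Rightarrow> 'a \<Rightarrow> real"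
  assumes "prob_space M"
    and "0 < \<zeta>" and "\<zeta> \<le> real CARD('d)"
    and "\<psi> \<in> borel_measurable M"
    and "integrable M (\<lambda>x. \<psi> x ^ 4)"
    and "prob_space.expectation M \<psi> = 0"
    and "prob_space.variance M \<psi> = 1"
    and "prob_space.expectation M (\<lambda>x. \<bar>\<psi> x\<bar> ^ 4) = C"
    and "\<And>i j. \<xi>s i j \<in> borel_measurable M"
    and "\<And>i j x. x \<in> space M \<Longrightarrow> \<xi>s i j x \<in> {0, 1}"
    and "\<And>i j. measure M {x \<in> space M. \<xi>s i j x = 1} = \<zeta> / real CARD('d)"
    and "\<And>i j. \<psi>s i j \<in> borel_measurable M"
    and "\<And>i j. distr M borel (\<psi>s i j) = distr M borel \<psi>"
    and "prob_space.indep_vars M (\<lambda>_. borel)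
           (\<lambda>k. case k of Inl (i, j) \<Rightarrow> \<xi>s i j | Inr (i, j) \<Rightarrow> \<psi>s i j)
           (({..<n} \<times> UNIV) <+> ({..<n} \<times> UNIV))"
    and "0 < \<epsilon>" and "\<epsilon> < 1" and "0 < \<delta>" and "\<delta> < 1"
    and "real n \<ge> 25 * real CARD('d)
           * max 1 (2 * C / \<zeta> * ln (2 * real CARD('d) / \<delta>)) / \<epsilon>\<^sup>2"
  shows "measure M {x \<in> space M.
            lambda_min ((1 / real n) *\<^sub>R
              (\<Sum>i<n. outer_prod (\<chi> j. sqrt (real CARD('d) / \<zeta>) * (\<xi>s i j x * \<psi>s i j x))))
            > 1 - \<epsilon>} \<ge> 1 - \<delta>"
proof -
  interpret prob_space M by fact
  let ?d = "real CARD('d)"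
  note [measurable] = assms(9,12)
  define Z where "Z = (\<lambda>k. case k of Inl (i, j) \<Rightarrow> \<xi>s i j | Inr (i, j) \<Rightarrow> \<psi>s i j)"
  \<comment> \<open>Every row is the same measurable function of its \<open>2 * d\<close> underlying
    variables, so independence and equality of laws carry over from these.\<close>
  define g where "g h = (\<chi> j. sqrt (?d / \<zeta>) * (h (Inl j) * h (Inr j)))" for h :: "'d + 'd \<Rightarrow> real"
  define sample where "sample i x = g (\<lambda>k. case_sum (\<xi>s i) (\<psi>s i) k x)" for i x
  have Z: "indep_vars (\<lambda>_. borel) Z (({..<n} \<times> UNIV) <+> ({..<n} \<times> UNIV))"
    using assms(14) by (simp add: Z_def)
  have nB: "25 * max ?d (2 * (C * ?d / \<zeta>) * ln (2 * ?d / \<delta>)) \<le> real n * \<epsilon>\<^sup>2"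
  proof -
    have "?d * max 1 (2 * C / \<zeta> * ln (2 * ?d / \<delta>)) = max ?d (2 * (C * ?d / \<zeta>) * ln (2 * ?d / \<delta>))"
      by (subst max_mult_distrib_left) (simp add: mult_ac)
    then show ?thesis using assms(15,19) by (simp add: pos_divide_le_eq mult.assoc)
  qed
  \<comment> \<open>Row 0 serves as the reference law, so it must be one of the \<open>n\<close>
    rows covered by the independence assumption.\<close>
  have n0: "0 < n"
  proof (rule ccontr)
    assume "\<not> 0 < n"
    then have "max ?d (2 * (C * ?d / \<zeta>) * ln (2 * ?d / \<delta>)) \<le> 0" using nB by simp
    then have "?d \<le> 0" by (rule order_trans[OF max.cobounded1])
    then show False by simp
  qed
  have indep_row: "indep_vars (\<lambda>_. borel) (case_sum (\<xi>s i) (\<psi>s i)) UNIV" if "i < n" for i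
  proof -
    let ?f = "case_sum (\<lambda>j. Inl (i, j)) (\<lambda>j. Inr (i, j)) :: 'd + 'd \<Rightarrow> (nat \<times> 'd) + (nat \<times> 'd)"
    have "indep_vars (\<lambda>j. borel) (\<lambda>j. Z (?f j)) UNIV"
      using that by (intro indep_vars_reindex[OF Z, of ?f UNIV]) (auto simp: inj_on_def split: sum.splits)
    also have "(\<lambda>j. Z (?f j)) = case_sum (\<xi>s i) (\<psi>s i)" by (auto simp: Z_def fun_eq_iff split: sum.splits)
    finally show ?thesis .
  qed
  have rv: "case_sum (\<xi>s i) (\<psi>s i) k \<in> borel_measurable M" for i k by (cases k) simp_all
  have g_meas: "g \<in> borel_measurable (PiM UNIV (\<lambda>_. borel))"
    unfolding g_def[abs_def] by (intro borel_measurable_vec_lambda) measurable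
  have row_law: "distr M borel (sample i) = distr M borel (sample 0)" if "i < n" for i
  proof -
    \<comment> \<open>By independence within a row its law depends only on the marginals, which
      agree across rows.\<close>
    have joint: "distr M borel (sample i) = distr (PiM UNIV (\<lambda>k. distr M borel (case_sum (\<xi>s i) (\<psi>s i) k))) borel g" if "i < n" for i
    proof -
      let ?J = "\<lambda>x. \<lambda>k\<in>UNIV. case_sum (\<xi>s i) (\<psi>s i) k x"
      have J: "?J \<in> M \<rightarrow>\<^sub>M PiM UNIV (\<lambda>_. borel)" by (intro measurable_restrict rv)
      have "distr M borel (sample i) = distr (distr M (PiM UNIV (\<lambda>_. borel)) ?J) borel g"
        by (subst distr_distr[OF g_meas J]) (simp add: sample_def[abs_def] comp_def restrict_UNIV)
      also have "distr M (PiM UNIV (\<lambda>_. borel)) ?J = PiM UNIV (\<lambda>k. distr M borel (case_sum (\<xi>s i) (\<psi>s i) k))"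
        using indep_row[OF that] by (subst (asm) indep_vars_iff_distr_eq_PiM) (auto intro: rv)
      finally show ?thesis .
    qed
    have "distr M borel (case_sum (\<xi>s i) (\<psi>s i) k) = distr M borel (case_sum (\<xi>s 0) (\<psi>s 0) k)" for k
    proof (cases k)
      case (Inl j)
      have "distr M borel (\<xi>s i j) = distr M borel (\<xi>s 0 j)"
        by (rule distr_zero_one_valued_eq) (simp_all only: assms(9,10,11))
      then show ?thesis using Inl by simp
    qed (simp add: assms(13))
    then show ?thesis using joint[OF that] joint[OF n0] by simp
  qed
  have iso: "isotropic_law (distr M borel (sample 0)) (C * ?d / \<zeta>)"
  proof -
    have "sample 0 = (\<lambda>x. \<chi> j. sqrt (?d / \<zeta>) * (\<xi>s 0 j x * \<psi>s 0 j x))" by (simp add: sample_def[abs_def] g_def)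
    then show ?thesis
      using isotropic_law_sparse_row[OF assms(2-8) assms(9,10,11,12,13) indep_row[OF n0]] by simp
  qed
  have rows: "indep_vars (\<lambda>_. borel) sample {..<n}"
  proof -
    \<comment> \<open>The index blocks of different rows are disjoint, so functions of the separate
      blocks are independent.\<close>
    let ?K = "\<lambda>i. ({i} \<times> UNIV) <+> ({i} \<times> UNIV) :: ((nat \<times> 'd) + (nat \<times> 'd)) set"
    let ?G = "\<lambda>i h. g (\<lambda>k. h (case_sum (\<lambda>j. Inl (i, j)) (\<lambda>j. Inr (i, j)) k))"
    have "indep_vars (\<lambda>i. PiM (?K i) (\<lambda>_. borel)) (\<lambda>i \<omega>. restrict (\<lambda>k. Z k \<omega>) (?K i)) {..<n}"
      by (rule indep_vars_restrict[OF Z]) (auto simp: disjoint_family_on_def)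
    then have "indep_vars (\<lambda>_. borel) (\<lambda>i \<omega>. ?G i (restrict (\<lambda>k. Z k \<omega>) (?K i))) {..<n}"
    proof (rule indep_vars_compose2)
      fix i
      have c: "(\<lambda>h. h k) \<in> borel_measurable (PiM (?K i) (\<lambda>_. borel :: real measure))" if "k \<in> ?K i" for k
        using that by (rule measurable_component_singleton)
      show "?G i \<in> borel_measurable (PiM (?K i) (\<lambda>_. borel))"
        unfolding g_def
        by (intro borel_measurable_vec_lambda borel_measurable_times borel_measurable_const c) auto
    qed
    moreover have "?G i (restrict (\<lambda>k. Z k \<omega>) (?K i)) = sample i \<omega>" for i \<omega>
      by (simp add: sample_def g_def Z_def vec_eq_iff InlI InrI)
    ultimately show ?thesis by simp
  qed
  interpret isotropic_sample M "distr M borel (sample 0)" "C * ?d / \<zeta>" sample n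
  proof (intro isotropic_sample.intro isotropic_sample_axioms.intro)
  qed (fact prob_space_axioms iso rows row_law)+
  have "sample i x = (\<chi> j. sqrt (?d / \<zeta>) * (\<xi>s i j x * \<psi>s i j x))" for i x by (simp add: sample_def g_def)
  then show ?thesis
    using prob_lambda_min_gt_one_minus[OF assms(15-18) nB] by simp
qed

end
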